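(* Let $M$ be an Abelian subgroup of maximal order of $W=W(E_7)$; then $M\cong\mathbb{Z}_2^7$ and $M$ is generated by the reflections $s_{\beta_1},\dots,s_{\beta_7}$ in seven pairwise (strongly) orthogonal roots, these being the only reflections in $M$. Consider the action of $M$ on the $56$ weights of the $56$-dimensional minuscule representation of $E_7$. Then: (i) $M$ has exactly seven orbits, each of size $8$, and the incidence structure whose points are the seven reflections $s_{\beta_i}$ and whose lines are the seven orbits, with $s_{\beta_i}$ incident to an orbit $O$ iff $\langle\beta_i,\lambda\rangle\neq0$ for the weights $\lambda\in O$, is a Fano plane (each line contains three points, each point lies on three lines, any two points lie on exactly one line). (ii) The discrete Weyl group $N_W(M)/M$ is isomorphic to $PSL(2,7)$.
   Context: $\langle\cdot,\cdot\rangle$ is the $W$-invariant inner product on the ambient space of the roots and weights. $N_W(M)$ denotes the normalizer of $M$ in $W$. The Fano plane is the projective plane of order $2$ (7 points, 7 lines). *)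

theory Defs
  imports "HOL-Analysis.Analysis" "HOL-Algebra.Product_Groups" "HOL-Algebra.Group_Action"
begin

definition E8_roots :: "(real^8) set" where
  "E8_roots = {x. (\<exists>i j. i \<noteq> j \<and> \<bar>x$i\<bar> = 1 \<and> \<bar>x$j\<bar> = 1 \<and> (\<forall>k. k \<noteq> i \<and> k \<noteq> j \<longrightarrow> x$k = 0))
                 \<or> ((\<forall>i. \<bar>x$i\<bar> = 1/2) \<and> (\<exists>k::int. (\<Sum>i\<in>UNIV. x$i) = 2 * of_int k))}"

definition theta :: "real^8" where
  "theta = (\<chi> i. 1/2)"

definition E7_roots :: "(real^8) set" where
  "E7_roots = {a \<in> E8_roots. a \<bullet> theta = 0}"

definition refl :: "real^8 \<Rightarrow> real^8 \<Rightarrow> real^8" where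
  "refl b x = x - (2 * (x \<bullet> b) / (b \<bullet> b)) *\<^sub>R b"

inductive_set Weyl_E7 :: "(real^8 \<Rightarrow> real^8) set" where
  id: "id \<in> Weyl_E7"
| step: "a \<in> E7_roots \<Longrightarrow> w \<in> Weyl_E7 \<Longrightarrow> refl a \<circ> w \<in> Weyl_E7"

definition WE7 :: "(real^8 \<Rightarrow> real^8) monoid" where
  "WE7 = \<lparr>carrier = Weyl_E7, mult = (\<circ>), one = id\<rparr>"

text \<open>omega7 = e1 + e2 - theta/2 = (3/4,3/4,-1/4,...,-1/4) lies in the E7 span (orthogonal to
  theta) and pairs with every E7 root to -1, 0 or 1: it is the (highest, minuscule) weight
  of the 56-dimensional representation; the weights of that representation form its W-orbit.\<close>
definition omega7 :: "real^8" where
  "omega7 = (\<chi> i. if i = 1 \<or> i = 2 then 3/4 else - 1/4)"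

definition weights56 :: "(real^8) set" where
  "weights56 = (\<lambda>w. w omega7) ` Weyl_E7"

definition fano_plane :: "'p set \<Rightarrow> 'l set \<Rightarrow> ('p \<Rightarrow> 'l \<Rightarrow> bool) \<Rightarrow> bool" where
  "fano_plane P L inc \<longleftrightarrow>
     finite P \<and> finite L \<and> card P = 7 \<and> card L = 7 \<and>
     (\<forall>l\<in>L. card {p\<in>P. inc p l} = 3) \<and>
     (\<forall>p\<in>P. card {l\<in>L. inc p l} = 3) \<and>
     (\<forall>p\<in>P. \<forall>q\<in>P. p \<noteq> q \<longrightarrow> (\<exists>!l. l \<in> L \<and> inc p l \<and> inc q l))"

text \<open>SL(2,7): 2x2 matrices (a,b,c,d) = [[a,b],[c,d]] over Z/7 (entries in 0..6) of determinant 1.\<close>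
definition SL27 :: "(int \<times> int \<times> int \<times> int) monoid" where
  "SL27 = \<lparr>carrier = {(a,b,c,d). a \<in> {0..<7} \<and> b \<in> {0..<7} \<and> c \<in> {0..<7} \<and> d \<in> {0..<7}
                                   \<and> (a*d - b*c) mod 7 = 1},
           mult = (\<lambda>(a,b,c,d) (e,f,g,h). ((a*e + b*g) mod 7, (a*f + b*h) mod 7,
                                          (c*e + d*g) mod 7, (c*f + d*h) mod 7)),
           one = (1,0,0,1)\<rparr>"

definition PSL27 where
  "PSL27 = SL27 Mod {(1,0,0,1), (6,0,0,6)}"

end

(* The 56 weights form a set without obtuse angles. If an abelian group B of isometries permutes such a
   set faithfully, then the orthogonal sum of the orbits along a chain of stabilizers is a set of |B|
   points without obtuse angles in the orthogonal complement of the fixed space, so by Danzer and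
   Gruenbaum |B| is at most 2 to the codimension of the fixed space. Hence an abelian subgroup M of
   maximal order has order 128. Since 126 is 2 modulo 4, the 2-group M preserves a pair {beta, -beta} of
   roots. The 12 weights x with <x, beta> = 1 are the vertices of a 6-dimensional cross polytope centred
   at beta/2; applying the same bound there, the orbits of the stabilizer of beta in M on it are squares
   {f, -f, g, -g}, and M contains the reflections in f - g and f + g. So M is generated by the
   reflections in beta and in six further roots, and all such frames of roots are conjugate.

   Indexing the eight coordinates by the projective line over F_7, Moebius transformations lie in the
   symmetric group S_8, which lies in W, and permute up to sign the frame given by the quadratic residue
   code. As PSL(2,7) is transitive on the triples of non-collinear points of the Fano plane, it covers
   N(M)/M. *)
theory Submission
  imports Defs "HOL-Algebra.Zassenhaus"
begin

section \<open>Sets without obtuse angles\<close>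

text \<open>The ambient space has dimension 8 and the Weyl group fixes \<open>theta\<close>, which
  is why the first bound is 128. In the second use the bound is attained: the stabilizer
  \<open>B\<close> of the root in \<open>M\<close> has order 64, the most for an abelian group of
  isometries that permute the cross polytope and fix the root and \<open>theta\<close>, inside the
  Weyl group or not. So any such isometry that commutes with \<open>B\<close> and has its square in
  \<open>B\<close> already lies in \<open>B\<close>. An orbit {f, -f} would thus put the reflection
  in f into the Weyl group, and a cyclic action on {f, g, -f, -g} the quarter turn of the plane of f
  and g. Both send some weight x to a vector having inner product 1 with x, whereas two weights only
  have the inner products 3/2, 1/2, -1/2, -3/2. Hence the action is that of a Klein four-group, and
  it preserves the lines through f - g and f + g. The Fano plane comes from lengths. A weight v has
  v \<bullet> v = 3/2 and pairs with each root of a frame to 0, 1 or -1; since v is half the sum of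
  the roots with these coefficients, exactly three are nonzero, and their signs give the eight
  elements of an orbit.\<close>

definition nonobtuse :: "'a::real_inner set \<Rightarrow> bool" where
  "nonobtuse S \<longleftrightarrow> (\<forall>a\<in>S. \<forall>b\<in>S. \<forall>c\<in>S. 0 \<le> (a - b) \<bullet> (c - b))"

text \<open>A packing argument: shrinking the hull by 1/2 towards each point of \<open>S\<close>
  gives \<open>card S\<close> translates of one body, all inside the hull, each with the fraction
  1/2^d of its volume, and overlapping only in hyperplanes. The interior makes the volume positive,
  so that it can be cancelled.\<close>

lemma nonobtuse_card_full_dim:
  fixes S :: "'a::euclidean_space set"
  assumes fin: "finite S" and obt: "nonobtuse S" and int: "interior (convex hull S) \<noteq> {}"
  shows "card S \<le> 2 ^ DIM('a)"
proof -
  define P where "P = convex hull S"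
  define T where "T = (\<lambda>s. (\<lambda>x. (1/2) *\<^sub>R x + (1/2) *\<^sub>R s) ` P)"
  have comp: "compact P"
    unfolding P_def using fin by (simp add: finite_imp_compact_convex_hull)
  have conv: "convex P" by (simp add: P_def)
  have SP: "S \<subseteq> P" unfolding P_def by (rule hull_subset)
  have TP: "T s \<subseteq> P" if "s \<in> S" for s
  proof -
    have "(1/2) *\<^sub>R x + (1/2) *\<^sub>R s \<in> P" if "x \<in> P" for x
      using that \<open>s \<in> S\<close> SP by (intro convexD[OF conv]) auto
    then show ?thesis by (auto simp: T_def)
  qed
  have Tm: "T s \<in> lmeasurable" for s
    unfolding T_def
    by (intro lmeasurable_compact compact_continuous_image comp continuous_intros)
  have meas: "measure lebesgue (T s) = (1/2) ^ DIM('a) * measure lebesgue P" for s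
    unfolding T_def by (subst measure_lebesgue_affine) simp
  \<comment> \<open>Since no angle at \<open>t\<close> is obtuse, the whole hull lies behind the
    hyperplane through \<open>t\<close> normal to \<open>t - s\<close>. Exchanging \<open>s\<close>
    and \<open>t\<close> confines the hull to a slab.\<close>
  have slab: "p \<bullet> (t - s) \<le> t \<bullet> (t - s)" if "s \<in> S" "t \<in> S" "p \<in> P" for s t p
  proof -
    have "S \<subseteq> {x. (t - s) \<bullet> x \<le> (t - s) \<bullet> t}"
    proof
      fix c assume "c \<in> S"
      then have "0 \<le> (c - t) \<bullet> (s - t)"
        using obt that by (auto simp: nonobtuse_def)
      then show "c \<in> {x. (t - s) \<bullet> x \<le> (t - s) \<bullet> t}"
        by (simp add: inner_diff_left inner_diff_right inner_commute)
    qed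
    then have "P \<subseteq> {x. (t - s) \<bullet> x \<le> (t - s) \<bullet> t}"
      unfolding P_def by (intro hull_minimal convex_halfspace_le)
    then show ?thesis using that(3) by (auto simp: inner_commute)
  qed
  have disj: "negligible (T s \<inter> T t)" if "s \<in> S" "t \<in> S" "s \<noteq> t" for s t
  proof -
    \<comment> \<open>The shrunken copies of the slab lie on opposite sides of the perpendicular
      bisector of \<open>s\<close> and \<open>t\<close>.\<close>
    have "T s \<inter> T t \<subseteq> {x. (t - s) \<bullet> x = (t - s) \<bullet> ((1/2) *\<^sub>R (s + t))}"
    proof
      fix x assume "x \<in> T s \<inter> T t"
      then obtain p q where p: "p \<in> P" "x = (1/2) *\<^sub>R p + (1/2) *\<^sub>R s"
        and q: "q \<in> P" "x = (1/2) *\<^sub>R q + (1/2) *\<^sub>R t"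
        by (auto simp: T_def)
      define u where "u = t - s"
      have "p \<bullet> u \<le> t \<bullet> u" "q \<bullet> (- u) \<le> s \<bullet> (- u)"
        unfolding u_def using slab[OF that(1,2) p(1)] slab[OF that(2,1) q(1)] by simp_all
      moreover have "x \<bullet> u = (1/2) * (p \<bullet> u) + (1/2) * (s \<bullet> u)"
        by (simp add: p(2) inner_add_left)
      moreover have "x \<bullet> u = (1/2) * (q \<bullet> u) + (1/2) * (t \<bullet> u)"
        by (simp add: q(2) inner_add_left)
      ultimately have "x \<bullet> u = (s \<bullet> u + t \<bullet> u) / 2"
        by simp
      then have "x \<bullet> (t - s) = (s \<bullet> (t - s) + t \<bullet> (t - s)) / 2"
        by (simp only: u_def)
      then show "x \<in> {x. (t - s) \<bullet> x = (t - s) \<bullet> ((1/2) *\<^sub>R (s + t))}"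
        by (simp add: inner_commute[of _ "t - s"] inner_add_right)
    qed
    moreover have "negligible {x. (t - s) \<bullet> x = (t - s) \<bullet> ((1/2) *\<^sub>R (s + t))}"
      using that by (intro negligible_hyperplane) auto
    ultimately show ?thesis using negligible_subset by blast
  qed
  have "real (card S) * ((1/2) ^ DIM('a) * measure lebesgue P) = (\<Sum>s\<in>S. measure lebesgue (T s))"
    by (simp add: meas)
  also have "\<dots> = measure lebesgue (\<Union>(T ` S))"
    using fin Tm disj
    by (intro measure_negligible_finite_Union_image[symmetric]) (auto simp: pairwise_def)
  also have "\<dots> \<le> measure lebesgue P"
  proof (rule measure_mono_fmeasurable)
    show "\<Union>(T ` S) \<in> sets lebesgue"
      using fin Tm by (intro sets.finite_UN) (auto dest: fmeasurableD)
  qed (use TP comp in \<open>auto intro: lmeasurable_compact\<close>)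
  finally have le: "real (card S) * (1/2) ^ DIM('a) * measure lebesgue P \<le> 1 * measure lebesgue P"
    by simp
  have "measure lebesgue P \<noteq> 0"
    using int negligible_convex_interior[OF conv] negligible_iff_measure0[OF lmeasurable_compact[OF comp]]
    by (simp add: P_def)
  then have "measure lebesgue P > 0"
    using measure_nonneg[of lebesgue P] by linarith
  then have "real (card S) * (1/2) ^ DIM('a) \<le> 1"
    using le mult_le_cancel_right_pos by blast
  then have "real (card S) \<le> real (2 ^ DIM('a))"
    by (simp add: field_simps power_one_over)
  then show ?thesis by (simp only: of_nat_le_iff)
qed

text \<open>This is a right prism over \<open>S\<close>. Heights in {0, 1} add (s - t) * (u - t) *
  (a \<bullet> a) to an inner product, and this is never negative.\<close>

lemma nonobtuse_Un_orthogonal_translate: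
  assumes "nonobtuse S" and a: "\<And>x y. x \<in> S \<Longrightarrow> y \<in> S \<Longrightarrow> a \<bullet> x = a \<bullet> y"
  shows "nonobtuse (S \<union> (+) a ` S)"
proof -
  have *: "(x + s *\<^sub>R a - (y + t *\<^sub>R a)) \<bullet> (z + u *\<^sub>R a - (y + t *\<^sub>R a))
      = (x - y) \<bullet> (z - y) + (s - t) * (u - t) * (a \<bullet> a)"
    if "x \<in> S" "y \<in> S" "z \<in> S" for x y z s t u
  proof -
    have "a \<bullet> (x - y) = 0" "a \<bullet> (z - y) = 0"
      using a[OF that(1,2)] a[OF that(3,2)] by (simp_all add: inner_diff_right)
    moreover have "x + s *\<^sub>R a - (y + t *\<^sub>R a) = (x - y) + (s - t) *\<^sub>R a"
      "z + u *\<^sub>R a - (y + t *\<^sub>R a) = (z - y) + (u - t) *\<^sub>R a"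
      by (simp_all add: algebra_simps)
    ultimately show ?thesis
      by (simp only: inner_add_left inner_add_right inner_scaleR_left inner_scaleR_right
          inner_commute[of "x - y" a]) simp
  qed
  have **: "\<exists>x\<in>S. \<exists>s\<in>{0,1}. v = x + s *\<^sub>R a" if "v \<in> S \<union> (+) a ` S" for v
    using that by (auto simp: add.commute)
  show ?thesis
    unfolding nonobtuse_def
  proof (intro ballI)
    fix p q r assume "p \<in> S \<union> (+) a ` S" "q \<in> S \<union> (+) a ` S" "r \<in> S \<union> (+) a ` S"
    then obtain x s y t z u where "x \<in> S" "y \<in> S" "z \<in> S" "s \<in> {0,1}" "t \<in> {0,1}" "u \<in> {0,1::real}"
      and eq: "p = x + s *\<^sub>R a" "q = y + t *\<^sub>R a" "r = z + u *\<^sub>R a"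
      using ** by metis
    moreover from this have "0 \<le> (s - t) * (u - t)" by auto
    ultimately show "0 \<le> (p - q) \<bullet> (r - q)"
      using assms(1) by (auto simp: * nonobtuse_def)
  qed
qed

lemma card_Un_translate:
  fixes a :: "'a::real_inner"
  assumes "finite S" "a \<noteq> 0" and a: "\<And>x y. x \<in> S \<Longrightarrow> y \<in> S \<Longrightarrow> a \<bullet> x = a \<bullet> y"
  shows "card (S \<union> (+) a ` S) = 2 * card S"
proof -
  have "S \<inter> (+) a ` S = {}"
  proof (rule ccontr)
    assume "S \<inter> (+) a ` S \<noteq> {}"
    then obtain x where "x \<in> S" "a + x \<in> S" by auto
    then have "a \<bullet> (a + x) = a \<bullet> x" by (rule a[rotated])
    with \<open>a \<noteq> 0\<close> show False by (simp add: inner_add_right)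
  qed
  with assms(1) show ?thesis
    by (simp add: card_Un_disjoint card_image)
qed

text \<open>The volume argument needs full dimension. A flat \<open>S\<close> lies in a hyperplane,
  and the prism along its normal has twice as many points and a larger affine dimension; hence
  induction on the codimension of the affine hull.\<close>

theorem nonobtuse_card_le:
  fixes S :: "'a::euclidean_space set"
  assumes "finite S" "nonobtuse S"
  shows "card S \<le> 2 ^ DIM('a)"
  using assms
proof (induction "nat (DIM('a) - aff_dim S)" arbitrary: S rule: less_induct)
  case less
  show ?case
  proof (cases "interior (convex hull S) = {}")
    case False
    with less.prems show ?thesis by (rule nonobtuse_card_full_dim)
  next
    case True
    show ?thesis
    proof (cases "S = {}")
      case False
      obtain a b where ab: "a \<noteq> 0" "convex hull S \<subseteq> {x. a \<bullet> x = b}"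
        using True empty_interior_subset_hyperplane[OF convex_convex_hull] by metis
      have Sab: "a \<bullet> x = b" if "x \<in> S" for x
        using that ab(2) hull_subset[of S convex] by auto
      define S' where "S' = S \<union> (+) a ` S"
      have "affine hull S \<subseteq> {x. a \<bullet> x = b}"
        by (intro hull_minimal affine_hyperplane) (use Sab in auto)
      moreover obtain x where "x \<in> S" using False by auto
      moreover have "a \<bullet> (a + x) \<noteq> b"
        using ab(1) Sab[OF \<open>x \<in> S\<close>] by (simp add: inner_add_right)
      moreover have "a + x \<in> affine hull S'"
        using \<open>x \<in> S\<close> by (intro hull_inc) (auto simp: S'_def)
      moreover have "affine hull S \<subseteq> affine hull S'"
        by (intro hull_mono) (auto simp: S'_def)
      ultimately have "affine hull S \<subset> affine hull S'" by blast
      then have "aff_dim S < aff_dim S'" by (rule aff_dim_psubset)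
      moreover have "aff_dim S' \<le> DIM('a)" by (rule aff_dim_le_DIM)
      ultimately have "nat (DIM('a) - aff_dim S') < nat (DIM('a) - aff_dim S)" by linarith
      moreover have "finite S'" using less.prems by (simp add: S'_def)
      moreover have "nonobtuse S'"
        unfolding S'_def using less.prems Sab by (intro nonobtuse_Un_orthogonal_translate) auto
      ultimately have "card S' \<le> 2 ^ DIM('a)" by (intro less.hyps) auto
      moreover have "card S' = 2 * card S"
        unfolding S'_def using less.prems ab(1) Sab by (intro card_Un_translate) auto
      ultimately show ?thesis by simp
    qed auto
  qed
qed

section \<open>Orders of finite abelian groups of isometries\<close>

text \<open>Plain sets of maps instead of subgroups of \<open>WE7\<close>: the bound is also applied
  to groups extended by isometries that are not known to lie in the Weyl group.\<close>

definition abelian_isometries :: "('a::real_inner \<Rightarrow> 'a) set \<Rightarrow> bool" where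
  "abelian_isometries B \<longleftrightarrow> finite B \<and> id \<in> B \<and> (\<forall>a\<in>B. \<forall>b\<in>B. a \<circ> b \<in> B \<and> (\<forall>x. a (b x) = b (a x))) \<and>
     (\<forall>b\<in>B. \<exists>c\<in>B. \<forall>x. c (b x) = x) \<and> (\<forall>b\<in>B. linear b \<and> (\<forall>x y. b x \<bullet> b y = x \<bullet> y))"

lemma abelian_isometriesD:
  assumes "abelian_isometries B"
  shows "finite B" "id \<in> B" "\<And>a b. a \<in> B \<Longrightarrow> b \<in> B \<Longrightarrow> a \<circ> b \<in> B"
    "\<And>a b x. a \<in> B \<Longrightarrow> b \<in> B \<Longrightarrow> a (b x) = b (a x)"
    "\<And>b. b \<in> B \<Longrightarrow> \<exists>c\<in>B. \<forall>x. c (b x) = x"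
    "\<And>b. b \<in> B \<Longrightarrow> linear b" "\<And>b x y. b \<in> B \<Longrightarrow> b x \<bullet> b y = x \<bullet> y"
  using assms unfolding abelian_isometries_def by blast+

lemma abelian_isometries_stabilizer:
  assumes B: "abelian_isometries B"
  shows "abelian_isometries {b \<in> B. b x = x}"
proof -
  note D = abelian_isometriesD[OF B]
  have "\<exists>c\<in>{b \<in> B. b x = x}. \<forall>y. c (b y) = y" if "b \<in> B" "b x = x" for b
  proof -
    obtain c where "c \<in> B" "\<forall>y. c (b y) = y" using D(5) \<open>b \<in> B\<close> by blast
    moreover from this have "c x = x" using that(2) by metis
    ultimately show ?thesis by blast
  qed
  with D show ?thesis
    unfolding abelian_isometries_def by auto
qed

lemma card_orbit_stabilizer:
  assumes B: "abelian_isometries B"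
  shows "card B = card ((\<lambda>b. b x) ` B) * card {b \<in> B. b x = x}"
proof -
  note D = abelian_isometriesD[OF B]
  have fib: "card {b \<in> B. b x = y} = card {b \<in> B. b x = x}" if "y \<in> (\<lambda>b. b x) ` B" for y
  proof -
    obtain a where a: "a \<in> B" "y = a x" using \<open>y \<in> _\<close> by auto
    obtain c where c: "c \<in> B" "\<And>z. c (a z) = z" using D(5)[OF a(1)] by auto
    have ac: "a (c z) = z" for z using D(4)[OF a(1) c(1)] c(2) by simp
    have "bij_betw ((\<circ>) a) {b \<in> B. b x = x} {b \<in> B. b x = y}"
      by (rule bij_betw_byWitness[where f' = "(\<circ>) c"])
        (use a c ac D(3) in \<open>auto simp: fun_eq_iff\<close>)
    then show ?thesis by (simp add: bij_betw_same_card)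
  qed
  have "card B = (\<Sum>y\<in>(\<lambda>b. b x) ` B. card {b \<in> B. b x = y})"
    using sum.image_gen[OF D(1), of "\<lambda>_. 1::nat" "\<lambda>b. b x"] by simp
  also have "\<dots> = (\<Sum>y\<in>(\<lambda>b. b x) ` B. card {b \<in> B. b x = x})"
    by (rule sum.cong) (use fib in auto)
  finally show ?thesis by simp
qed

lemma nonobtuse_orthogonal_sum:
  assumes S: "nonobtuse S" and T: "nonobtuse T" and fin: "finite S" "finite T"
    and orth: "\<And>s s' t t'. s \<in> S \<Longrightarrow> s' \<in> S \<Longrightarrow> t \<in> T \<Longrightarrow> t' \<in> T \<Longrightarrow> (s - s') \<bullet> (t - t') = 0"
  defines "U \<equiv> (\<lambda>(s, t). s + t) ` (S \<times> T)"
  shows "nonobtuse U" "card U = card S * card T" "finite U"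
proof -
  have "inj_on (\<lambda>(s, t). s + t) (S \<times> T)"
  proof (rule inj_onI, clarify)
    fix s t s' t' assume st: "s \<in> S" "t \<in> T" "s' \<in> S" "t' \<in> T" and "s + t = s' + t'"
    then have eq: "s - s' = t' - t" by (simp add: algebra_simps)
    have "(s - s') \<bullet> (s - s') = 0"
      using orth[OF st(1,3) st(4,2)] by (simp only: eq)
    then have "s - s' = 0" by (simp only: inner_eq_zero_iff)
    with eq show "s = s' \<and> t = t'" by simp
  qed
  then show "card U = card S * card T" by (simp add: U_def card_image card_cartesian_product)
  show "finite U" using fin by (simp add: U_def)
  show "nonobtuse U"
    unfolding nonobtuse_def
  proof (intro ballI)
    fix a b c assume "a \<in> U" "b \<in> U" "c \<in> U"
    then obtain s t s' t' s'' t'' where st: "s \<in> S" "s' \<in> S" "s'' \<in> S" "t \<in> T" "t' \<in> T" "t'' \<in> T"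
      and eq: "a = s + t" "b = s' + t'" "c = s'' + t''"
      unfolding U_def by auto
    have "(a - b) \<bullet> (c - b) = ((s - s') + (t - t')) \<bullet> ((s'' - s') + (t'' - t'))"
      unfolding eq by (simp add: algebra_simps)
    also have "\<dots> = (s - s') \<bullet> (s'' - s') + (t - t') \<bullet> (t'' - t')"
      using orth[OF st(1,2,6,5)] orth[OF st(3,2,4,5)]
      by (simp only: inner_add_left inner_add_right inner_commute[of "t - t'" "s'' - s'"])
    finally show "0 \<le> (a - b) \<bullet> (c - b)"
      using S T st unfolding nonobtuse_def by (metis add_nonneg_nonneg)
  qed
qed

text \<open>Since \<open>B\<close> is abelian, the stabilizer \<open>C\<close> of a moved point
  fixes the whole orbit of that point. The model of \<open>C\<close> is orthogonal to everything
  fixed by \<open>C\<close>, hence to the orbit, so the two sets can be added orthogonally and the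
  cardinalities multiply to \<open>card B\<close>.\<close>

lemma nonobtuse_model_of_abelian_isometries:
  assumes "abelian_isometries B" and X: "finite X" "nonobtuse X"
    and perm: "\<And>b x. b \<in> B \<Longrightarrow> x \<in> X \<Longrightarrow> b x \<in> X"
    and sep: "\<And>b. b \<in> B \<Longrightarrow> (\<And>x. x \<in> X \<Longrightarrow> b x = x) \<Longrightarrow> b = id"
  shows "\<exists>T. finite T \<and> nonobtuse T \<and> card T = card B \<and>
    (\<forall>t\<in>T. \<forall>v. (\<forall>b\<in>B. b v = v) \<longrightarrow> t \<bullet> v = 0)"
  using assms(1) perm sep
proof (induction "card B" arbitrary: B rule: less_induct)
  case less
  note D = abelian_isometriesD[OF less.prems(1)]
  show ?case
  proof (cases "\<forall>b\<in>B. \<forall>x\<in>X. b x = x")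
    case True
    then have "B = {id}" using less.prems(3) D(2) by blast
    then show ?thesis
      by (intro exI[of _ "{0}"]) (auto simp: nonobtuse_def)
  next
    case False
    then obtain b0 x where b0: "b0 \<in> B" "x \<in> X" "b0 x \<noteq> x" by auto
    define C where "C = {b \<in> B. b x = x}"
    have "C \<subset> B" using b0 by (auto simp: C_def)
    then have "card C < card B" using D(1) by (rule psubset_card_mono[rotated])
    moreover have "abelian_isometries C"
      unfolding C_def using less.prems(1) by (rule abelian_isometries_stabilizer)
    moreover have "b x \<in> X" if "b \<in> C" "x \<in> X" for b x
      using that less.prems(2) by (simp add: C_def)
    moreover have "b = id" if "b \<in> C" "\<And>x. x \<in> X \<Longrightarrow> b x = x" for b
      using that less.prems(3) by (simp add: C_def)
    ultimately have "\<exists>T. finite T \<and> nonobtuse T \<and> card T = card C \<and>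
        (\<forall>t\<in>T. \<forall>v. (\<forall>b\<in>C. b v = v) \<longrightarrow> t \<bullet> v = 0)"
      by (rule less.hyps)
    then obtain T where T: "finite T" "nonobtuse T" "card T = card C"
      and Tperp: "\<And>t v. t \<in> T \<Longrightarrow> (\<And>b. b \<in> C \<Longrightarrow> b v = v) \<Longrightarrow> t \<bullet> v = 0"
      by metis
    \<comment> \<open>Shifting \<open>x\<close> to the origin makes the orbit orthogonal to the
      fixed space of \<open>B\<close>: if \<open>b v = v\<close>, then \<open>b x\<close> and
      \<open>x\<close> have the same inner product with \<open>v\<close>.\<close>
    define S where "S = (\<lambda>b. b x - x) ` B"
    have Seq: "S = (\<lambda>y. y - x) ` (\<lambda>b. b x) ` B" by (auto simp: S_def)
    have finS: "finite S" using D(1) by (simp add: S_def)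
    have obtS: "nonobtuse S"
      using X(2) less.prems(2) b0(2) unfolding nonobtuse_def S_def by simp
    have cardS: "card S = card ((\<lambda>b. b x) ` B)"
      unfolding Seq by (rule card_image) (auto simp: inj_on_def)
    have fixS: "c s = s" if "s \<in> S" "c \<in> C" for s c
    proof -
      obtain b where b: "b \<in> B" "s = b x - x" using \<open>s \<in> S\<close> by (auto simp: S_def)
      show ?thesis
        using \<open>c \<in> C\<close> b D(4)[of c b x] by (simp add: C_def linear_diff D(6))
    qed
    have Sperp: "s \<bullet> v = 0" if "s \<in> S" "\<And>b. b \<in> B \<Longrightarrow> b v = v" for s v
    proof -
      obtain b where b: "b \<in> B" "s = b x - x" using \<open>s \<in> S\<close> by (auto simp: S_def)
      show ?thesis using D(7)[OF b(1), of x v] that(2)[OF b(1)] by (simp add: b(2) inner_diff_left)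
    qed
    have TS: "t \<bullet> s = 0" if "t \<in> T" "s \<in> S" for s t
      by (rule Tperp) (use that fixS in auto)
    define U where "U = (\<lambda>(t, s). t + s) ` (T \<times> S)"
    have "(t - t') \<bullet> (s - s') = 0" if "t \<in> T" "t' \<in> T" "s \<in> S" "s' \<in> S" for t t' s s'
      using that by (simp add: TS inner_diff_left inner_diff_right)
    note U = nonobtuse_orthogonal_sum[OF T(2) obtS T(1) finS this, folded U_def]
    have "card U = card B"
      using U(2) T(3) cardS card_orbit_stabilizer[OF less.prems(1), of x]
      by (simp add: C_def mult.commute)
    moreover have "u \<bullet> v = 0" if "u \<in> U" "\<And>b. b \<in> B \<Longrightarrow> b v = v" for u v
    proof -
      obtain t s where ts: "t \<in> T" "s \<in> S" "u = t + s"
        using \<open>u \<in> U\<close> by (auto simp: U_def)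
      have "t \<bullet> v = 0" by (rule Tperp) (use ts that(2) in \<open>auto simp: C_def\<close>)
      moreover have "s \<bullet> v = 0" by (rule Sperp) (use ts that(2) in auto)
      ultimately show ?thesis by (simp add: ts(3) inner_add_left)
    qed
    ultimately show ?thesis using U(1,3) by blast
  qed
qed

text \<open>Instead of passing to the orthogonal complement of the fixed vectors \<open>D\<close>,
  the model set is extended to a prism along each of them. Each direction doubles it, and the bound
  of the full space applies at the end.\<close>

theorem card_abelian_isometries:
  fixes B :: "('a::euclidean_space \<Rightarrow> 'a) set"
  assumes B: "abelian_isometries B" and X: "finite X" "nonobtuse X"
    and perm: "\<And>b x. b \<in> B \<Longrightarrow> x \<in> X \<Longrightarrow> b x \<in> X"
    and sep: "\<And>b. b \<in> B \<Longrightarrow> (\<And>x. x \<in> X \<Longrightarrow> b x = x) \<Longrightarrow> b = id"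
    and D: "finite D" "pairwise orthogonal D" "0 \<notin> D" "\<And>b d. b \<in> B \<Longrightarrow> d \<in> D \<Longrightarrow> b d = d"
  shows "card B * 2 ^ card D \<le> 2 ^ DIM('a)"
proof -
  have "\<exists>T. finite T \<and> nonobtuse T \<and> card T = card B \<and>
      (\<forall>t\<in>T. \<forall>v. (\<forall>b\<in>B. b v = v) \<longrightarrow> t \<bullet> v = 0)"
    by (rule nonobtuse_model_of_abelian_isometries[OF B X]; fact perm sep)
  then obtain T where T: "finite T" "nonobtuse T" "card T = card B"
      and Tperp: "\<And>t v. t \<in> T \<Longrightarrow> (\<And>b. b \<in> B \<Longrightarrow> b v = v) \<Longrightarrow> t \<bullet> v = 0"
    by metis
  \<comment> \<open>\<open>E\<close> collects the directions already used; orthogonality to the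
    remaining ones is what the next prism needs.\<close>
  have "\<exists>U. finite U \<and> nonobtuse U \<and> card U = card B * 2 ^ card E \<and>
      (\<forall>u\<in>U. \<forall>d\<in>D - E. d \<bullet> u = 0)" if "E \<subseteq> D" for E
    using finite_subset[OF that D(1)] that
  proof (induction E rule: finite_induct)
    case empty
    show ?case
      using T Tperp D(4) by (intro exI[of _ T]) (simp add: inner_commute)
  next
    case (insert a E)
    then obtain U where U: "finite U" "nonobtuse U" "card U = card B * 2 ^ card E"
      "\<And>u d. u \<in> U \<Longrightarrow> d \<in> D - E \<Longrightarrow> d \<bullet> u = 0" by auto
    have a: "a \<noteq> 0" "\<And>x y. x \<in> U \<Longrightarrow> y \<in> U \<Longrightarrow> a \<bullet> x = a \<bullet> y"
      using insert D(3) U(4) by auto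
    have "d \<bullet> a = 0" if "d \<in> D - insert a E" for d
      using D(2) that insert.prems by (auto simp: pairwise_def orthogonal_def)
    then have "d \<bullet> u = 0" if "u \<in> U \<union> (+) a ` U" "d \<in> D - insert a E" for d u
      using that U(4) by (auto simp: inner_add_right)
    moreover have "nonobtuse (U \<union> (+) a ` U)"
      using U(2) a(2) by (rule nonobtuse_Un_orthogonal_translate)
    moreover have "card (U \<union> (+) a ` U) = 2 * card U"
      using U(1) a by (rule card_Un_translate)
    ultimately show ?case
      using U insert by (intro exI[of _ "U \<union> (+) a ` U"]) auto
  qed
  from this[OF order.refl] show ?thesis using nonobtuse_card_le by metis
qed

section \<open>Roots and weights\<close>

lemma linear_refl: "linear (refl b)"
  unfolding refl_def
  by (rule linearI) (simp_all add: inner_add_left add_divide_distrib algebra_simps)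

lemma refl_inner: "refl b x \<bullet> refl b y = x \<bullet> y"
proof (cases "b = 0")
  case False
  define s t where "s = 2 * (x \<bullet> b) / (b \<bullet> b)" and "t = 2 * (y \<bullet> b) / (b \<bullet> b)"
  have "s * (b \<bullet> b) = 2 * (x \<bullet> b)" using False by (simp add: s_def)
  then have "s * t * (b \<bullet> b) = 2 * t * (x \<bullet> b)" by algebra
  moreover have "t * (x \<bullet> b) = s * (y \<bullet> b)" by (simp add: s_def t_def)
  moreover have "(x - s *\<^sub>R b) \<bullet> (y - t *\<^sub>R b) = x \<bullet> y - t * (x \<bullet> b) - s * (y \<bullet> b) + s * t * (b \<bullet> b)"
    using inner_commute[of b y] by (simp add: inner_diff_left inner_diff_right algebra_simps)
  ultimately show ?thesis by (simp add: refl_def s_def t_def)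
qed (simp add: refl_def)

lemma orthogonal_refl: "orthogonal_transformation (refl b)"
  by (simp add: orthogonal_transformation_def linear_refl refl_inner)

lemma refl_refl [simp]: "refl b (refl b x) = x"
proof (cases "b = 0")
  case False
  then have "refl b b = - b" by (simp add: refl_def scaleR_2)
  then have "refl b (x - c *\<^sub>R b) = refl b x + c *\<^sub>R b" for c
    by (simp add: linear_diff[OF linear_refl] linear_cmul[OF linear_refl])
  then show ?thesis by (subst (2) refl_def) (simp add: refl_def)
qed (simp add: refl_def)

lemma refl_fixes: "x \<bullet> b = 0 \<Longrightarrow> refl b x = x"
  by (simp add: refl_def)

lemma refl_self: "refl b b = - b"
  by (cases "b = 0") (simp_all add: refl_def scaleR_2)

lemma refl_minus: "refl (- b) = refl b"
  by (simp add: refl_def fun_eq_iff)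

lemma refl_norm2: "b \<bullet> b = 2 \<Longrightarrow> refl b x = x - (x \<bullet> b) *\<^sub>R b"
  by (simp add: refl_def)

lemma refl_conj:
  assumes "orthogonal_transformation w"
  shows "w (refl b x) = refl (w b) (w x)"
  using assms
  by (simp add: orthogonal_transformation_def refl_def linear_diff linear_cmul)

section \<open>Coordinates for roots and weights\<close>

definition ind :: "8 set \<Rightarrow> real^8" where
  "ind S = (\<chi> i. if i \<in> S then 1 else 0)"

lemma ind_nth [simp]: "ind S $ i = (if i \<in> S then 1 else 0)"
  by (simp add: ind_def)

lemma inner_ind: "x \<bullet> ind S = (\<Sum>i\<in>S. x $ i)"
proof -
  have "x \<bullet> ind S = (\<Sum>i\<in>UNIV. if i \<in> S then x $ i else 0)"
    unfolding inner_vec_def by (intro sum.cong) auto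
  then show ?thesis by (simp add: sum.If_cases)
qed

lemma ind_inner_ind [simp]: "ind S \<bullet> ind T = real (card (S \<inter> T))"
  by (simp add: inner_ind sum.If_cases Int_commute)

lemma card_Compl_8: "card (- S) = 8 - card (S :: 8 set)"
  by (simp add: Compl_eq_Diff_UNIV card_Diff_subset)

lemma theta_eq: "theta = (1/2) *\<^sub>R ind UNIV"
  by (simp add: theta_def vec_eq_iff)

lemma theta_inner_theta [simp]: "theta \<bullet> theta = 2"
  by (simp add: theta_eq)

lemma inner_theta: "x \<bullet> theta = (\<Sum>i\<in>UNIV. x $ i) / 2"
  by (simp add: theta_eq inner_ind)

text \<open>For a 4-subset \<open>S\<close> this is a half-integral root, and the complement of
  \<open>S\<close> gives its negative. Inner products become sizes of intersections.\<close>

definition root_of :: "8 set \<Rightarrow> real^8" where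
  "root_of S = ind S - (1/2) *\<^sub>R ind UNIV"

text \<open>The pair {1, 2} gives \<open>omega7\<close>; the 28 pairs and their negatives give all
  56 weights.\<close>

definition weight :: "8 set \<Rightarrow> real^8" where
  "weight P = ind P - (1/4) *\<^sub>R ind UNIV"

lemma root_inner_root: "card S = 4 \<Longrightarrow> card T = 4 \<Longrightarrow> root_of S \<bullet> root_of T = real (card (S \<inter> T)) - 2"
  by (simp add: root_of_def inner_diff_left inner_diff_right)

lemma weight_inner_weight:
  "card P = 2 \<Longrightarrow> card Q = 2 \<Longrightarrow> weight P \<bullet> weight Q = real (card (P \<inter> Q)) - 1/2"
  by (simp add: weight_def inner_diff_left inner_diff_right)

lemma weight_inner_root:
  "card P = 2 \<Longrightarrow> card S = 4 \<Longrightarrow> weight P \<bullet> root_of S = real (card (P \<inter> S)) - 1"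
  by (simp add: weight_def root_of_def inner_diff_left inner_diff_right)

lemma weight_inner_theta: "card P = 2 \<Longrightarrow> weight P \<bullet> theta = 0"
  by (simp add: weight_def theta_eq inner_diff_left)

lemma root_inner_theta: "card S = 4 \<Longrightarrow> root_of S \<bullet> theta = 0"
  by (simp add: root_of_def theta_eq inner_diff_left)

text \<open>Orthogonality to \<open>theta\<close> means coordinate sum 0. So an integral root has
  one entry 1 and one entry -1, and a half-integral one has four entries of each sign.\<close>

lemma E7_roots_eq:
  "E7_roots = {ind {i} - ind {j} | i j. i \<noteq> j} \<union> {root_of S | S. card S = 4}"
proof (intro equalityI subsetI)
  fix x assume "x \<in> E7_roots"
  then have x: "x \<in> E8_roots" and sum0: "(\<Sum>i\<in>UNIV. x $ i) = 0"
    by (auto simp: E7_roots_def inner_theta)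
  from x consider (int) i j where "i \<noteq> j" "\<bar>x$i\<bar> = 1" "\<bar>x$j\<bar> = 1" "\<And>k. k \<noteq> i \<Longrightarrow> k \<noteq> j \<Longrightarrow> x$k = 0"
    | (half) "\<And>i. \<bar>x$i\<bar> = 1/2"
    unfolding E8_roots_def by auto
  then show "x \<in> {ind {i} - ind {j} | i j. i \<noteq> j} \<union> {root_of S | S. card S = 4}"
  proof cases
    case int
    have "(\<Sum>k\<in>UNIV. x $ k) = (\<Sum>k\<in>{i,j}. x $ k)"
      by (rule sum.mono_neutral_right) (use int in auto)
    then have ij: "x $ i + x $ j = 0" using sum0 int(1) by simp
    have "x = ind {i} - ind {j} \<or> x = ind {j} - ind {i}"
      using ij int by (auto simp: vec_eq_iff abs_if split: if_splits)
    then show ?thesis using int(1) by blast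
  next
    case half
    define S where "S = {i. x $ i = 1/2}"
    have val: "x $ i = (if i \<in> S then 1/2 else -1/2)" for i
      using half[of i] by (auto simp: S_def abs_if split: if_splits)
    then have "x = root_of S" by (simp add: root_of_def vec_eq_iff)
    moreover have "card S = 4"
    proof -
      have "(\<Sum>i\<in>UNIV. x $ i) = ind UNIV \<bullet> root_of S"
        using \<open>x = root_of S\<close> by (simp add: inner_ind[symmetric] inner_commute)
      also have "\<dots> = real (card S) - 4"
        by (simp add: root_of_def inner_diff_right)
      finally show ?thesis using sum0 by simp
    qed
    ultimately show ?thesis by blast
  qed
next
  fix x assume "x \<in> {ind {i} - ind {j} | i j. i \<noteq> j} \<union> {root_of S | S. card S = 4}"
  then consider (int) i j where "i \<noteq> j" "x = ind {i} - ind {j}" | (half) S where "card S = 4" "x = root_of S"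
    by auto
  then show "x \<in> E7_roots"
  proof cases
    case int
    then have "x \<in> E8_roots" unfolding E8_roots_def by auto
    moreover have "x \<bullet> theta = 0" by (simp add: int theta_eq inner_diff_left)
    ultimately show ?thesis by (simp add: E7_roots_def)
  next
    case half
    have th: "x \<bullet> theta = 0" using half by (simp add: root_inner_theta)
    then have "(\<Sum>i\<in>UNIV. x $ i) = 2 * of_int 0" by (simp add: inner_theta)
    then have "\<exists>k::int. (\<Sum>i\<in>UNIV. x $ i) = 2 * of_int k" by blast
    moreover have "\<forall>i. \<bar>x $ i\<bar> = 1/2" by (simp add: half root_of_def)
    ultimately have "x \<in> E8_roots" unfolding E8_roots_def by blast
    with th show ?thesis by (simp add: E7_roots_def)
  qed
qed

lemma root_in_E7: "card S = 4 \<Longrightarrow> root_of S \<in> E7_roots"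
  by (auto simp: E7_roots_eq)

lemma E7_root_norm: "a \<in> E7_roots \<Longrightarrow> a \<bullet> a = 2"
  by (auto simp: E7_roots_eq root_inner_root inner_diff_left inner_diff_right)

lemma E7_root_theta: "a \<in> E7_roots \<Longrightarrow> a \<bullet> theta = 0"
  by (simp add: E7_roots_def)

text \<open>An explicit form of \<open>weights56\<close>, on which inner products can be computed;
  \<open>weights56_eq\<close> identifies the two.\<close>

definition wts :: "(real^8) set" where
  "wts = {weight P | P. card P = 2} \<union> {- weight P | P. card P = 2}"

lemma wtsE:
  assumes "x \<in> wts"
  obtains P where "card P = 2" "x = weight P" | P where "card P = 2" "x = - weight P"
  using assms by (auto simp: wts_def)

lemma weight_in_wts: "card P = 2 \<Longrightarrow> weight P \<in> wts"
  by (auto simp: wts_def)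

lemma minus_in_wts: "x \<in> wts \<Longrightarrow> - x \<in> wts"
  by (auto simp: wts_def)

lemma finite_wts: "finite wts"
proof -
  have "wts \<subseteq> range weight \<union> uminus ` range weight" by (auto simp: wts_def)
  then show ?thesis by (rule finite_subset) simp
qed

lemma wts_theta: "x \<in> wts \<Longrightarrow> x \<bullet> theta = 0"
  by (erule wtsE) (simp_all add: weight_inner_theta)

lemma wts_norm: "x \<in> wts \<Longrightarrow> x \<bullet> x = 3/2"
  by (erule wtsE) (simp_all add: weight_inner_weight)

lemma card_2_Int_cases:
  assumes "card P = 2" "card Q = 2"
  shows "P = Q \<or> card (P \<inter> Q) = 1 \<or> card (P \<inter> Q) = 0"
proof -
  have "finite P" "finite Q" using assms by (auto intro: card_ge_0_finite)
  then have "card (P \<inter> Q) \<le> 2" using assms by (metis card_mono inf_le1)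
  moreover have "P = Q" if "card (P \<inter> Q) = 2"
    using that assms \<open>finite P\<close> \<open>finite Q\<close> by (metis card_subset_eq inf_le1 inf_le2)
  ultimately show ?thesis by linarith
qed

lemma weight_inner_weight_cases:
  assumes "card P = 2" "card Q = 2"
  shows "P = Q \<or> weight P \<bullet> weight Q = 1/2 \<or> weight P \<bullet> weight Q = -1/2"
  using card_2_Int_cases[OF assms] weight_inner_weight[OF assms] by auto

lemma wts_inner:
  assumes "x \<in> wts" "y \<in> wts"
  shows "x = y \<or> x = - y \<or> x \<bullet> y = 1/2 \<or> x \<bullet> y = -1/2"
  using assms by (auto elim!: wtsE dest: weight_inner_weight_cases)

lemma nonobtuse_wts: "nonobtuse wts"
  unfolding nonobtuse_def
proof (intro ballI)
  fix a b c assume abc: "a \<in> wts" "b \<in> wts" "c \<in> wts"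
  have "(a - b) \<bullet> (c - b) = a \<bullet> c - a \<bullet> b - b \<bullet> c + 3/2"
    using wts_norm[OF abc(2)] by (simp add: inner_diff_left inner_diff_right)
  \<comment> \<open>With \<open>a\<close> and \<open>c\<close> distinct from \<open>b\<close>, both
    subtracted products are at most 1/2, which suffices unless \<open>c = - a\<close>; in that case
    they cancel and the angle at \<open>b\<close> is right.\<close>
  moreover have "a \<bullet> c - a \<bullet> b - b \<bullet> c + 3/2 \<ge> 0" if "a \<noteq> b" "c \<noteq> b"
    using wts_inner[OF abc(1,2)] wts_inner[OF abc(2,3)] wts_inner[OF abc(1,3)] that
      wts_norm[OF abc(1)] wts_norm[OF abc(2)] wts_norm[OF abc(3)]
    by (auto simp: inner_commute)
  ultimately show "0 \<le> (a - b) \<bullet> (c - b)"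
    by (cases "a = b \<or> c = b") auto
qed

lemma card_2_Int_1:
  assumes "card P = 2" "card Q = 2" "card (P \<inter> Q) = 1"
  obtains i j k where "P = {i, j}" "Q = {i, k}" "i \<noteq> j" "i \<noteq> k" "j \<noteq> k"
proof -
  obtain i where i: "P \<inter> Q = {i}" using assms(3) card_1_singletonE by blast
  then have "i \<in> P" "i \<in> Q" by auto
  then have "card (P - {i}) = 1" "card (Q - {i}) = 1" using assms by (simp_all add: card_Diff_singleton)
  then obtain j k where jk: "P - {i} = {j}" "Q - {i} = {k}" by (metis card_1_singletonE)
  show ?thesis by (rule that[of i j k]) (use i jk in blast)+
qed

text \<open>A description of the roots by weights and inner products alone. Invariance of the roots
  under the Weyl group then follows from that of the weights, without cases on pairs of
  roots.\<close>

lemma E7_roots_eq_diff: "E7_roots = {x - y | x y. x \<in> wts \<and> y \<in> wts \<and> x \<bullet> y = 1/2}"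
proof (intro equalityI subsetI)
  fix a assume "a \<in> E7_roots"
  then consider (int) i j where "i \<noteq> j" "a = ind {i} - ind {j}" | (half) S where "card S = 4" "a = root_of S"
    by (auto simp: E7_roots_eq)
  then show "a \<in> {x - y | x y. x \<in> wts \<and> y \<in> wts \<and> x \<bullet> y = 1/2}"
  proof cases
    case int
    have "card {i,j} < card (UNIV :: 8 set)" using int by simp
    then obtain k where "k \<notin> {i,j}" by (metis UNIV_I card_mono finite subsetI leD)
    then have k: "k \<noteq> i" "k \<noteq> j" by auto
    \<comment> \<open>Any third coordinate \<open>k\<close> serves: it cancels in the
      difference.\<close>
    have "a = weight {i,k} - weight {j,k}"
      using k int by (simp add: weight_def vec_eq_iff)
    moreover have "weight {i,k} \<bullet> weight {j,k} = 1/2"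
      using k int by (subst weight_inner_weight) (auto simp: Int_insert_left)
    ultimately show ?thesis using k weight_in_wts by force
  next
    case half
    then obtain P where P: "P \<subseteq> S" "card P = 2" using obtain_subset_with_card_n[of 2 S] by auto
    then have Q: "card (S - P) = 2" using half by (simp add: card_Diff_subset)
    \<comment> \<open>A half-integral root is the sum of the weights of two pairs that partition
      \<open>S\<close>, hence a difference of a weight and a negated weight.\<close>
    have "a = weight P - - weight (S - P)"
      using P(1) by (auto simp: half weight_def root_of_def vec_eq_iff)
    moreover have "weight P \<bullet> - weight (S - P) = 1/2"
      by (simp add: weight_inner_weight P Q)
    ultimately show ?thesis using P Q weight_in_wts minus_in_wts by blast
  qed
next
  fix a assume "a \<in> {x - y | x y. x \<in> wts \<and> y \<in> wts \<and> x \<bullet> y = 1/2}"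
  then obtain x y where xy: "x \<in> wts" "y \<in> wts" "x \<bullet> y = 1/2" and a: "a = x - y" by auto
  have diff: "weight P - weight Q \<in> E7_roots"
    if PQ: "card P = 2" "card Q = 2" "card (P \<inter> Q) = 1" for P Q
  proof -
    obtain i j k where "P = {i, j}" "Q = {i, k}" "i \<noteq> j" "i \<noteq> k" "j \<noteq> k"
      by (rule card_2_Int_1[OF PQ])
    then have "weight P - weight Q = ind {j} - ind {k}" "j \<noteq> k"
      by (auto simp: weight_def vec_eq_iff)
    then show ?thesis by (auto simp: E7_roots_eq)
  qed
  have add: "weight P + weight Q = root_of (P \<union> Q)" "- weight P - weight Q = root_of (- (P \<union> Q))"
      "card (P \<union> Q) = 4" "card (- (P \<union> Q)) = 4"
    if "card P = 2" "card Q = 2" "card (P \<inter> Q) = 0" for P Q :: "8 set"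
  proof -
    have e: "P \<inter> Q = {}" using that by (simp add: card_eq_0_iff)
    then show "weight P + weight Q = root_of (P \<union> Q)" "- weight P - weight Q = root_of (- (P \<union> Q))"
      by (auto simp: weight_def root_of_def vec_eq_iff)
    show c: "card (P \<union> Q) = 4" using e that by (simp add: card_Un_disjoint)
    show "card (- (P \<union> Q)) = 4" unfolding card_Compl_8 c by simp
  qed
  from xy(1,2) show "a \<in> E7_roots"
  proof (elim wtsE)
    fix P Q assume *: "card P = 2" "x = weight P" "card Q = 2" "y = weight Q"
    then show ?thesis using xy(3) diff[of P Q] by (simp add: a weight_inner_weight)
  next
    fix P Q assume *: "card P = 2" "x = weight P" "card Q = 2" "y = - weight Q"
    then have "card (P \<inter> Q) = 0" using xy(3) by (simp add: weight_inner_weight)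
    then show ?thesis using add(1,3)[of P Q] * by (simp add: a root_in_E7)
  next
    fix P Q assume *: "card P = 2" "x = - weight P" "card Q = 2" "y = weight Q"
    then have "card (P \<inter> Q) = 0" using xy(3) by (simp add: weight_inner_weight)
    then show ?thesis using add(2,4)[of P Q] * by (simp add: a root_in_E7)
  next
    fix P Q assume *: "card P = 2" "x = - weight P" "card Q = 2" "y = - weight Q"
    then show ?thesis using xy(3) diff[of Q P] by (simp add: a weight_inner_weight Int_commute)
  qed
qed

section \<open>The Weyl group\<close>

lemma refl_weight_int:
  assumes "card P = 2" "i \<noteq> j"
  shows "refl (ind {i} - ind {j}) (weight P) \<in> wts"
proof -
  let ?a = "ind {i} - ind {j}"
  have norm: "?a \<bullet> ?a = 2" using assms by (simp add: inner_diff_left inner_diff_right)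
  have ip: "weight P \<bullet> ?a = (if i \<in> P then 1 else 0) - (if j \<in> P then 1 else 0)"
    by (simp add: weight_def inner_diff_left inner_diff_right)
  note rf = refl_norm2[OF norm, of "weight P", unfolded ip]
  consider "(i \<in> P) = (j \<in> P)" | "i \<in> P" "j \<notin> P" | "i \<notin> P" "j \<in> P" by blast
  then show ?thesis
  proof cases
    case 1
    then have "refl ?a (weight P) = weight P" by (intro refl_fixes) (simp add: ip)
    then show ?thesis using assms by (simp add: weight_in_wts)
  next
    case 2
    then have "refl ?a (weight P) = weight (insert j (P - {i}))"
      unfolding rf using assms by (auto simp: weight_def vec_eq_iff)
    moreover have "card (insert j (P - {i})) = 2" using 2 assms by (simp add: card_insert_if card_Diff_singleton)
    ultimately show ?thesis by (simp add: weight_in_wts)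
  next
    case 3
    then have "refl ?a (weight P) = weight (insert i (P - {j}))"
      unfolding rf using assms by (auto simp: weight_def vec_eq_iff)
    moreover have "card (insert i (P - {j})) = 2" using 3 assms by (simp add: card_insert_if card_Diff_singleton)
    ultimately show ?thesis by (simp add: weight_in_wts)
  qed
qed

text \<open>The inner product is -1, 0 or 1 according to how many points of \<open>P\<close> lie in
  \<open>S\<close>. Apart from the fixed case, the image is the negative of the weight of the other
  pair in the part of the partition {S, - S} that contains \<open>P\<close>.\<close>

lemma refl_weight_half:
  assumes P: "card P = 2" and S: "card S = 4"
  shows "refl (root_of S) (weight P) \<in> wts"
proof -
  have norm: "root_of S \<bullet> root_of S = 2" using S by (simp add: root_inner_root)
  have fin: "finite P" by simp
  have ip: "weight P \<bullet> root_of S = real (card (P \<inter> S)) - 1"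
    using P S by (rule weight_inner_root)
  note rf = refl_norm2[OF norm, of "weight P", unfolded ip]
  have "card (P \<inter> S) \<le> 2" using P by (metis card_mono fin inf_le1)
  then consider "card (P \<inter> S) = 0" | "card (P \<inter> S) = 1" | "card (P \<inter> S) = 2" by linarith
  then show ?thesis
  proof cases
    case 1
    then have e: "P \<inter> S = {}" by (simp add: card_eq_0_iff)
    have "refl (root_of S) (weight P) = - weight (- (P \<union> S))"
      unfolding rf 1 using e by (auto simp: weight_def root_of_def vec_eq_iff)
    moreover have c: "card (P \<union> S) = 6" using e P S by (simp add: card_Un_disjoint)
    have "card (- (P \<union> S)) = 2" unfolding card_Compl_8 c by simp
    ultimately show ?thesis by (simp only: minus_in_wts weight_in_wts)
  next
    case 2
    then have "refl (root_of S) (weight P) = weight P" by (intro refl_fixes) (simp add: ip)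
    then show ?thesis using P by (simp add: weight_in_wts)
  next
    case 3
    then have sub: "P \<subseteq> S" using P fin by (metis card_subset_eq inf_le1 inf_le2)
    then have "refl (root_of S) (weight P) = - weight (S - P)"
      unfolding rf 3 by (auto simp: weight_def root_of_def vec_eq_iff)
    moreover have "card (S - P) = 2" using sub S P by (simp add: card_Diff_subset)
    ultimately show ?thesis by (simp only: minus_in_wts weight_in_wts)
  qed
qed

lemma refl_wts:
  assumes "a \<in> E7_roots" "x \<in> wts"
  shows "refl a x \<in> wts"
proof -
  have "refl a (weight P) \<in> wts" if "card P = 2" for P
    using assms(1) that refl_weight_int refl_weight_half by (auto simp: E7_roots_eq)
  moreover have "refl a (- y) = - refl a y" for y
    by (rule linear_neg[OF linear_refl])
  ultimately show ?thesis
    using assms(2) minus_in_wts by (elim wtsE) simp_all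
qed

lemma Weyl_orthogonal: "w \<in> Weyl_E7 \<Longrightarrow> orthogonal_transformation w"
proof (induction rule: Weyl_E7.induct)
  case id
  then show ?case by (simp add: orthogonal_transformation_def linear_id)
next
  case (step a w)
  then show ?case by (intro orthogonal_transformation_compose orthogonal_refl)
qed

lemma Weyl_linear: "w \<in> Weyl_E7 \<Longrightarrow> linear w"
  by (simp add: Weyl_orthogonal orthogonal_transformation_linear)

lemma Weyl_inner: "w \<in> Weyl_E7 \<Longrightarrow> w x \<bullet> w y = x \<bullet> y"
  using Weyl_orthogonal orthogonal_transformation_def by blast

lemma Weyl_theta: "w \<in> Weyl_E7 \<Longrightarrow> w theta = theta"
  by (induction rule: Weyl_E7.induct) (auto intro: refl_fixes simp: E7_root_theta inner_commute)

lemma Weyl_wts: "w \<in> Weyl_E7 \<Longrightarrow> x \<in> wts \<Longrightarrow> w x \<in> wts"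
  by (induction rule: Weyl_E7.induct) (auto intro: refl_wts)

lemma Weyl_roots:
  assumes "w \<in> Weyl_E7" "a \<in> E7_roots"
  shows "w a \<in> E7_roots"
proof -
  obtain x y where "x \<in> wts" "y \<in> wts" "x \<bullet> y = 1/2" "a = x - y"
    using assms(2) by (auto simp: E7_roots_eq_diff)
  then have "w x \<in> wts" "w y \<in> wts" "w x \<bullet> w y = 1/2" "w a = w x - w y"
    using assms(1) by (simp_all add: Weyl_wts Weyl_inner linear_diff Weyl_linear)
  then show ?thesis by (auto simp: E7_roots_eq_diff)
qed

lemma Weyl_comp: "v \<in> Weyl_E7 \<Longrightarrow> w \<in> Weyl_E7 \<Longrightarrow> v \<circ> w \<in> Weyl_E7"
  by (induction rule: Weyl_E7.induct) (auto simp: comp_assoc intro: Weyl_E7.step)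

lemma refl_in_Weyl: "a \<in> E7_roots \<Longrightarrow> refl a \<in> Weyl_E7"
  using Weyl_E7.step[OF _ Weyl_E7.id] by simp

lemma Weyl_inverse:
  assumes "w \<in> Weyl_E7"
  shows "\<exists>v\<in>Weyl_E7. v \<circ> w = id \<and> w \<circ> v = id"
  using assms
proof (induction rule: Weyl_E7.induct)
  case id
  then show ?case by (intro bexI[of _ id] Weyl_E7.id) simp
next
  case (step a w)
  then obtain v where "v \<in> Weyl_E7" "v \<circ> w = id" "w \<circ> v = id" by blast
  moreover from this have "v \<circ> refl a \<in> Weyl_E7"
    using step.hyps(1) by (intro Weyl_comp refl_in_Weyl)
  ultimately show ?case
    by (intro bexI[of _ "v \<circ> refl a"]) (auto simp: fun_eq_iff)
qed

lemma WE7_simps [simp]: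
  "carrier WE7 = Weyl_E7" "x \<otimes>\<^bsub>WE7\<^esub> y = x \<circ> y" "\<one>\<^bsub>WE7\<^esub> = id"
  by (simp_all add: WE7_def)

lemma group_WE7: "group WE7"
proof (rule groupI)
  fix x assume "x \<in> carrier WE7"
  then show "\<exists>y\<in>carrier WE7. y \<otimes>\<^bsub>WE7\<^esub> x = \<one>\<^bsub>WE7\<^esub>"
    using Weyl_inverse by auto
qed (auto simp: Weyl_comp Weyl_E7.id comp_assoc)

lemma inv_WE7:
  assumes "w \<in> Weyl_E7"
  shows "inv\<^bsub>WE7\<^esub> w \<in> Weyl_E7" "(inv\<^bsub>WE7\<^esub> w) (w x) = x" "w ((inv\<^bsub>WE7\<^esub> w) x) = x"
  using assms group.inv_closed[OF group_WE7, of w] group.l_inv[OF group_WE7, of w]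
    group.r_inv[OF group_WE7, of w]
  by (auto simp: fun_eq_iff)

lemma linear_eq_ind:
  assumes "linear f" "linear g" "\<And>i. f (ind {i}) = g (ind {i})"
  shows "f = g"
proof (rule linear_eq_stdbasis[OF assms(1,2)])
  fix b :: "real^8" assume "b \<in> Basis"
  then obtain i where "b = axis i 1" by (auto simp: Basis_vec_def)
  then have "b = ind {i}" by (simp add: axis_def vec_eq_iff)
  then show "f b = g b" using assms(3) by simp
qed

lemma Weyl_eqI:
  assumes "v \<in> Weyl_E7" "w \<in> Weyl_E7" "\<And>x. x \<in> wts \<Longrightarrow> v x = w x"
  shows "v = w"
proof (rule linear_eq_ind)
  fix i :: 8
  have "card {i} < card (UNIV :: 8 set)" by simp
  then obtain j where "j \<notin> {i}" by (metis UNIV_I card_mono finite subsetI leD)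
  then have j: "j \<noteq> i" by simp
  have "card {i,j} < card (UNIV :: 8 set)" using j by simp
  then obtain k where "k \<notin> {i,j}" by (metis UNIV_I card_mono finite subsetI leD)
  then have k: "k \<noteq> i" "k \<noteq> j" by auto
  \<comment> \<open>Adding half of \<open>theta\<close> turns \<open>weight P\<close> into
    \<open>ind P\<close>, and \<open>theta\<close> is fixed by the Weyl group. So the values on
    weights determine those on the standard basis.\<close>
  let ?w = "\<lambda>P. weight P + (1/2) *\<^sub>R theta"
  have ind: "ind {i} = (1/2) *\<^sub>R (?w {i,j} + ?w {i,k} - ?w {j,k})"
    using j k by (auto simp: weight_def theta_eq vec_eq_iff)
  have "v (weight P) = w (weight P)" if "card P = 2" for P
    using assms(3) that by (simp add: weight_in_wts)
  moreover have "card {i,j} = 2" "card {i,k} = 2" "card {j,k} = 2" using j k by auto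
  ultimately show "v (ind {i}) = w (ind {i})"
    unfolding ind using assms(1,2)
    by (simp add: linear_add linear_diff linear_cmul Weyl_linear Weyl_theta)
qed (use assms in \<open>auto intro: Weyl_linear\<close>)

text \<open>Restriction to the finite invariant set \<open>wts\<close> is injective on the group, by
  \<open>Weyl_eqI\<close>.\<close>

lemma finite_Weyl: "finite Weyl_E7"
proof (rule finite_imageD)
  have "(\<lambda>w. restrict w wts) ` Weyl_E7 \<subseteq> (\<Pi>\<^sub>E x\<in>wts. wts)"
    by (auto simp: Weyl_wts)
  then show "finite ((\<lambda>w. restrict w wts) ` Weyl_E7)"
    by (rule finite_subset) (simp add: finite_PiE finite_wts)
  show "inj_on (\<lambda>w. restrict w wts) Weyl_E7"
    by (rule inj_onI) (metis Weyl_eqI restrict_apply')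
qed

section \<open>Coordinate permutations inside the Weyl group\<close>

definition permc :: "(8 \<Rightarrow> 8) \<Rightarrow> real^8 \<Rightarrow> real^8" where
  "permc p x = (\<chi> i. x $ inv_into UNIV p i)"

lemma permc_comp: "bij p \<Longrightarrow> bij q \<Longrightarrow> permc (p \<circ> q) = permc p \<circ> permc q"
  by (simp add: permc_def fun_eq_iff o_inv_distrib)

lemma permc_ind: "bij p \<Longrightarrow> permc p (ind S) = ind (p ` S)"
  by (auto simp: permc_def vec_eq_iff image_iff bij_is_surj surj_f_inv_f bij_is_inj inv_f_f intro!: bexI[rotated])

lemma linear_permc: "linear (permc p)"
  by (rule linearI) (simp_all add: permc_def vec_eq_iff)

lemma permc_root: "bij p \<Longrightarrow> permc p (root_of S) = root_of (p ` S)"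
  by (simp add: root_of_def linear_diff[OF linear_permc] linear_cmul[OF linear_permc] permc_ind bij_is_surj)

lemma permc_weight: "bij p \<Longrightarrow> permc p (weight S) = weight (p ` S)"
  by (simp add: weight_def linear_diff[OF linear_permc] linear_cmul[OF linear_permc] permc_ind bij_is_surj)

lemma permc_transpose:
  assumes "i \<noteq> j"
  shows "permc (Transposition.transpose i j) = refl (ind {i} - ind {j})"
proof
  fix x
  have "(ind {i} - ind {j}) \<bullet> (ind {i} - ind {j}) = 2"
    using assms by (simp add: inner_diff_left inner_diff_right)
  then show "permc (Transposition.transpose i j) x = refl (ind {i} - ind {j}) x"
    using assms
    by (auto simp: permc_def refl_norm2 vec_eq_iff inner_diff_right inner_ind Transposition.transpose_def)
qed

text \<open>Transpositions are the reflections in the integral roots, and they generate the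
  symmetric group.\<close>

lemma permc_in_Weyl:
  assumes "bij p"
  shows "permc p \<in> Weyl_E7"
proof -
  from assms have "p permutes UNIV" by (simp add: permutes_univ bij_iff)
  then show ?thesis using finite[of "UNIV :: 8 set"]
  proof (induction rule: permutes_induct)
    case id
    have "permc id = id" by (simp add: permc_def fun_eq_iff vec_eq_iff)
    then show ?case using Weyl_E7.id by argo
  next
    case (swap a b p)
    have "permc (Transposition.transpose a b \<circ> p) = refl (ind {a} - ind {b}) \<circ> permc p"
      using swap by (subst permc_comp) (auto simp: permc_transpose permutes_bij)
    moreover have "ind {a} - ind {b} \<in> E7_roots" using swap by (auto simp: E7_roots_eq)
    ultimately show ?case using Weyl_E7.step[of _ "permc p"] swap by metis
  qed
qed

lemma ex_bij_image_eq:
  fixes S T :: "8 set"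
  assumes "card S = card T"
  shows "\<exists>p. bij p \<and> p ` S = T"
proof -
  obtain f where f: "bij_betw f S T" using finite_same_card_bij[OF finite finite assms] by blast
  have "card (- S) = card (- T)" using assms by (simp add: card_Compl_8)
  then obtain g where g: "bij_betw g (- S) (- T)" using finite_same_card_bij[OF finite finite] by blast
  let ?h = "\<lambda>x. if x \<in> S then f x else g x"
  have "bij_betw ?h (S \<union> - S) (T \<union> - T)"
    using f g by (intro bij_betw_disjoint_Un) auto
  then have "bij ?h" by (simp add: Compl_partition)
  moreover have "?h ` S = T" using f by (auto simp: bij_betw_def)
  ultimately show ?thesis by blast
qed

section \<open>Orthogonal frames of roots and maximal abelian subgroups\<close>

definition frame :: "(nat \<Rightarrow> real^8) \<Rightarrow> bool" where
  "frame \<beta> \<longleftrightarrow> (\<forall>i<7. \<beta> i \<in> E7_roots) \<and> (\<forall>i<7. \<forall>j<7. i \<noteq> j \<longrightarrow> \<beta> i \<bullet> \<beta> j = 0)"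

text \<open>For a frame this is the product of the reflections in the \<beta> j with j in
  \<open>J\<close>. Orthogonality makes the order irrelevant, and roots have x \<bullet> \<beta> j
  as coefficient because their squared length is 2.\<close>

definition flip :: "(nat \<Rightarrow> real^8) \<Rightarrow> nat set \<Rightarrow> real^8 \<Rightarrow> real^8" where
  "flip \<beta> J x = x - (\<Sum>j\<in>J. (x \<bullet> \<beta> j) *\<^sub>R \<beta> j)"

lemma theta_nonzero: "theta \<noteq> 0"
  by (metis inner_zero_left theta_inner_theta zero_neq_numeral)

lemma eq_if_inner_orthogonal_eq:
  fixes x y :: "'a::euclidean_space"
  assumes "finite D" "pairwise orthogonal D" "0 \<notin> D" "card D = DIM('a)"
    and "\<And>d. d \<in> D \<Longrightarrow> x \<bullet> d = y \<bullet> d"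
  shows "x = y"
proof -
  have "independent D" using assms(2,3) by (rule pairwise_orthogonal_independent)
  then have "span D = UNIV"
    using assms(1,4) by (metis card_eq_dim dim_UNIV span_eq_dim span_UNIV subset_UNIV top.extremum_uniqueI
      dim_eq_full dim_eq_card_independent)
  moreover have "orthogonal (x - y) d" if "d \<in> D" for d
    using assms(5)[OF that] by (simp add: orthogonal_def inner_diff_left)
  ultimately have "orthogonal (x - y) (x - y)"
    by (metis UNIV_I orthogonal_to_span)
  then show ?thesis by (simp add: orthogonal_def)
qed

context
  fixes \<beta> :: "nat \<Rightarrow> real^8"
  assumes fr: "frame \<beta>"
begin

lemma frame_root: "i < 7 \<Longrightarrow> \<beta> i \<in> E7_roots"
  using fr by (simp add: frame_def)

lemma frame_inner: "i < 7 \<Longrightarrow> j < 7 \<Longrightarrow> \<beta> i \<bullet> \<beta> j = (if i = j then 2 else 0)"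
  using fr by (auto simp: frame_def E7_root_norm)

lemma frame_inj: "inj_on \<beta> {..<7}"
proof (rule inj_onI)
  fix i j assume ij: "i \<in> {..<7}" "j \<in> {..<7}" "\<beta> i = \<beta> j"
  then have "\<beta> i \<bullet> \<beta> j = 2" using frame_inner[of i i] by simp
  then show "i = j" using ij frame_inner[of i j] by (auto split: if_splits)
qed

text \<open>A frame together with \<open>theta\<close> is an orthogonal basis of the space.\<close>

lemma frame_eqI:
  assumes "\<And>i. i < 7 \<Longrightarrow> x \<bullet> \<beta> i = y \<bullet> \<beta> i" "x \<bullet> theta = y \<bullet> theta"
  shows "x = y"
proof (rule eq_if_inner_orthogonal_eq)
  let ?D = "insert theta (\<beta> ` {..<7})"
  have th: "\<beta> i \<bullet> theta = 0" if "i < 7" for i using that by (simp add: frame_root E7_root_theta)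
  then have "theta \<notin> \<beta> ` {..<7}" using theta_inner_theta by force
  then show "card ?D = DIM(real^8)" by (simp add: card_image frame_inj)
  show "pairwise orthogonal ?D"
    using th by (auto simp: pairwise_insert pairwise_image orthogonal_def inner_commute frame_inner
        pairwise_def)
  have "\<beta> i \<noteq> 0" if "i < 7" for i using frame_inner[OF that that] by auto
  then show "0 \<notin> ?D" using theta_nonzero by auto
  show "x \<bullet> d = y \<bullet> d" if "d \<in> ?D" for d using that assms by auto
qed simp

lemma flip_inner:
  assumes "J \<subseteq> {..<7}" "i < 7"
  shows "flip \<beta> J x \<bullet> \<beta> i = (if i \<in> J then - (x \<bullet> \<beta> i) else x \<bullet> \<beta> i)"
proof -
  have "finite J" using assms(1) finite_subset by blast
  have "(\<Sum>j\<in>J. (x \<bullet> \<beta> j) *\<^sub>R \<beta> j) \<bullet> \<beta> i = (\<Sum>j\<in>J. if j = i then 2 * (x \<bullet> \<beta> i) else 0)"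
    unfolding inner_sum_left using assms by (intro sum.cong) (auto simp: frame_inner subset_iff)
  then show ?thesis using \<open>finite J\<close> by (simp add: flip_def inner_diff_left)
qed

lemma flip_theta:
  assumes "J \<subseteq> {..<7}"
  shows "flip \<beta> J x \<bullet> theta = x \<bullet> theta"
proof -
  have "(\<Sum>j\<in>J. (x \<bullet> \<beta> j) *\<^sub>R \<beta> j) \<bullet> theta = 0"
    unfolding inner_sum_left using assms by (intro sum.neutral) (auto simp: frame_root E7_root_theta)
  then show ?thesis by (simp add: flip_def inner_diff_left)
qed

text \<open>In the orthogonal basis, flips only change signs, and a sign changed twice is unchanged;
  so composition is symmetric difference of index sets.\<close>

lemma flip_flip:
  assumes "J \<subseteq> {..<7}" "K \<subseteq> {..<7}"
  shows "flip \<beta> J (flip \<beta> K x) = flip \<beta> ((J - K) \<union> (K - J)) x"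
proof (rule frame_eqI)
  have JK: "(J - K) \<union> (K - J) \<subseteq> {..<7}" using assms by auto
  show "flip \<beta> J (flip \<beta> K x) \<bullet> \<beta> i = flip \<beta> ((J - K) \<union> (K - J)) x \<bullet> \<beta> i" if "i < 7" for i
    using flip_inner[OF JK that] assms that by (auto simp: flip_inner)
  show "flip \<beta> J (flip \<beta> K x) \<bullet> theta = flip \<beta> ((J - K) \<union> (K - J)) x \<bullet> theta"
    using flip_theta[OF JK] assms by (simp add: flip_theta)
qed

lemma flip_empty: "flip \<beta> {} = id"
  by (simp add: flip_def fun_eq_iff)

lemma flip_single: "i < 7 \<Longrightarrow> flip \<beta> {i} = refl (\<beta> i)"
  by (simp add: flip_def fun_eq_iff refl_norm2 frame_inner)

lemma flip_insert:
  assumes "J \<subseteq> {..<7}" "i < 7" "i \<notin> J"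
  shows "flip \<beta> (insert i J) = refl (\<beta> i) \<circ> flip \<beta> J"
proof
  fix x
  have "({i} - J) \<union> (J - {i}) = insert i J" using assms by auto
  then show "flip \<beta> (insert i J) x = (refl (\<beta> i) \<circ> flip \<beta> J) x"
    using flip_flip[of "{i}" J x] assms by (simp add: flip_single)
qed

lemma flip_in_Weyl:
  assumes "J \<subseteq> {..<7}"
  shows "flip \<beta> J \<in> Weyl_E7"
  using finite_subset[OF assms finite_lessThan] assms
proof (induction J rule: finite_induct)
  case empty
  then show ?case using Weyl_E7.id by (simp only: flip_empty)
next
  case (insert i J)
  then have "flip \<beta> (insert i J) = refl (\<beta> i) \<circ> flip \<beta> J" by (intro flip_insert) auto
  moreover have "refl (\<beta> i) \<circ> flip \<beta> J \<in> Weyl_E7"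
    using insert by (intro Weyl_E7.step) (auto simp: frame_root)
  ultimately show ?case by (simp only:)
qed

lemma flip_frame:
  assumes "J \<subseteq> {..<7}" "i < 7"
  shows "flip \<beta> J (\<beta> i) = (if i \<in> J then - \<beta> i else \<beta> i)"
proof (rule frame_eqI)
  show "flip \<beta> J (\<beta> i) \<bullet> \<beta> k = (if i \<in> J then - \<beta> i else \<beta> i) \<bullet> \<beta> k" if "k < 7" for k
    using assms that by (simp add: flip_inner frame_inner)
  show "flip \<beta> J (\<beta> i) \<bullet> theta = (if i \<in> J then - \<beta> i else \<beta> i) \<bullet> theta"
    using assms by (simp add: flip_theta frame_root E7_root_theta)
qed

lemma flip_eq_iff:
  assumes "J \<subseteq> {..<7}" "K \<subseteq> {..<7}"
  shows "flip \<beta> J = flip \<beta> K \<longleftrightarrow> J = K"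
proof
  assume eq: "flip \<beta> J = flip \<beta> K"
  have "i \<in> J \<longleftrightarrow> i \<in> K" if "i < 7" for i
  proof -
    have "\<beta> i \<bullet> \<beta> i = 2" using that by (simp add: frame_inner)
    then have "\<beta> i \<noteq> - \<beta> i" by (metis inner_minus_left neg_equal_iff_equal neg_numeral_neq_numeral)
    then show ?thesis using flip_frame[OF assms(1) that] flip_frame[OF assms(2) that] eq
      by (auto split: if_splits)
  qed
  then show "J = K" using assms by blast
qed simp

end

definition frame_group :: "(nat \<Rightarrow> real^8) \<Rightarrow> (real^8 \<Rightarrow> real^8) set" where
  "frame_group \<beta> = flip \<beta> ` Pow {..<7}"

definition abelian_subgroup :: "(real^8 \<Rightarrow> real^8) set \<Rightarrow> bool" where
  "abelian_subgroup M \<longleftrightarrow> subgroup M WE7 \<and> (\<forall>x\<in>M. \<forall>y\<in>M. x \<circ> y = y \<circ> x)"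

definition max_abelian :: "(real^8 \<Rightarrow> real^8) set \<Rightarrow> bool" where
  "max_abelian M \<longleftrightarrow> abelian_subgroup M \<and> (\<forall>M'. abelian_subgroup M' \<longrightarrow> card M' \<le> card M)"

lemma abelian_subgroupI:
  assumes "M \<subseteq> Weyl_E7" "M \<noteq> {}" "\<And>x y. x \<in> M \<Longrightarrow> y \<in> M \<Longrightarrow> x \<circ> y \<in> M"
    and "\<And>x y v. x \<in> M \<Longrightarrow> y \<in> M \<Longrightarrow> x (y v) = y (x v)"
    and "\<And>x. x \<in> M \<Longrightarrow> \<exists>y\<in>M. \<forall>v. y (x v) = v"
  shows "abelian_subgroup M"
proof -
  have "subgroup M WE7"
  proof (rule group.subgroupI[OF group_WE7])
    fix x assume x: "x \<in> M"
    then obtain y where y: "y \<in> M" "\<forall>v. y (x v) = v" using assms(5) by blast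
    have "inv\<^bsub>WE7\<^esub> x = y"
      using x y assms(1) by (intro group.inv_equality[OF group_WE7]) (auto simp: fun_eq_iff)
    with y show "inv\<^bsub>WE7\<^esub> x \<in> M" by simp
  qed (use assms in auto)
  then show ?thesis using assms(4) by (auto simp: abelian_subgroup_def fun_eq_iff)
qed

lemma abelian_subgroupD:
  assumes "abelian_subgroup M"
  shows "M \<subseteq> Weyl_E7" "id \<in> M" "\<And>x y. x \<in> M \<Longrightarrow> y \<in> M \<Longrightarrow> x \<circ> y \<in> M"
    "\<And>x y v. x \<in> M \<Longrightarrow> y \<in> M \<Longrightarrow> x (y v) = y (x v)"
    "\<And>x. x \<in> M \<Longrightarrow> \<exists>y\<in>M. \<forall>v. y (x v) = v" "finite M"
proof -
  from assms have sub: "subgroup M WE7" and com: "\<And>x y. x \<in> M \<Longrightarrow> y \<in> M \<Longrightarrow> x \<circ> y = y \<circ> x"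
    by (auto simp: abelian_subgroup_def)
  show 1: "M \<subseteq> Weyl_E7" using subgroup.subset[OF sub] by simp
  show "id \<in> M" using subgroup.one_closed[OF sub] by simp
  show "x \<circ> y \<in> M" if "x \<in> M" "y \<in> M" for x y
    using subgroup.m_closed[OF sub that] by simp
  show "x (y v) = y (x v)" if "x \<in> M" "y \<in> M" for x y v
    using com[OF that] by (metis comp_apply)
  show "\<exists>y\<in>M. \<forall>v. y (x v) = v" if "x \<in> M" for x
    using subgroup.m_inv_closed[OF sub that] inv_WE7(2) that 1 by blast
  show "finite M" using 1 finite_Weyl by (rule finite_subset)
qed

lemma abelian_subgroup_isometries:
  assumes "abelian_subgroup M"
  shows "abelian_isometries M"
proof -
  note D = abelian_subgroupD[OF assms]
  have "linear b \<and> (\<forall>x y. b x \<bullet> b y = x \<bullet> y)" if "b \<in> M" for b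
    using that D(1) Weyl_linear Weyl_inner by blast
  then show ?thesis
    unfolding abelian_isometries_def using D(2-6) by blast
qed

text \<open>The fixed vector \<open>theta\<close> takes one factor 2 from 2^8.\<close>

lemma card_abelian_subgroup:
  assumes "abelian_subgroup M"
  shows "card M \<le> 128"
proof -
  note D = abelian_subgroupD[OF assms]
  have "card M * 2 ^ card {theta} \<le> 2 ^ DIM(real^8)"
  proof (rule card_abelian_isometries[OF abelian_subgroup_isometries[OF assms] finite_wts nonobtuse_wts])
    show "b x \<in> wts" if "b \<in> M" "x \<in> wts" for b x using that D(1) Weyl_wts by blast
    show "b = id" if "b \<in> M" "\<And>x. x \<in> wts \<Longrightarrow> b x = x" for b
      using that D(1) Weyl_E7.id by (intro Weyl_eqI) auto
    show "b d = d" if "b \<in> M" "d \<in> {theta}" for b d using that D(1) Weyl_theta by blast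
    show "0 \<notin> {theta}" using theta_nonzero by simp
  qed auto
  then show ?thesis by simp
qed

lemma abelian_frame_group:
  assumes "frame \<beta>"
  shows "abelian_subgroup (frame_group \<beta>)"
proof (rule abelian_subgroupI)
  show "frame_group \<beta> \<subseteq> Weyl_E7" using flip_in_Weyl[OF assms] by (auto simp: frame_group_def)
  show "x \<circ> y \<in> frame_group \<beta>" if xy: "x \<in> frame_group \<beta>" "y \<in> frame_group \<beta>" for x y
  proof -
    obtain J K where JK: "J \<subseteq> {..<7}" "x = flip \<beta> J" "K \<subseteq> {..<7}" "y = flip \<beta> K"
      using xy by (auto simp: frame_group_def)
    then have "x \<circ> y = flip \<beta> ((J - K) \<union> (K - J))" by (simp add: fun_eq_iff flip_flip[OF assms])
    moreover have "(J - K) \<union> (K - J) \<subseteq> {..<7}" using JK by auto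
    ultimately show ?thesis by (auto simp: frame_group_def)
  qed
  show "x (y v) = y (x v)" if "x \<in> frame_group \<beta>" "y \<in> frame_group \<beta>" for x y v
    using that by (auto simp: frame_group_def flip_flip[OF assms] Un_commute)
  show "\<exists>y\<in>frame_group \<beta>. \<forall>v. y (x v) = v" if "x \<in> frame_group \<beta>" for x
    using that by (intro bexI[of _ x]) (auto simp: frame_group_def flip_flip[OF assms] flip_empty[OF assms])
qed (auto simp: frame_group_def)

lemma card_frame_group:
  assumes "frame \<beta>"
  shows "card (frame_group \<beta>) = 128"
proof -
  have "inj_on (flip \<beta>) (Pow {..<7})"
    by (rule inj_onI) (use flip_eq_iff[OF assms] in auto)
  then show ?thesis by (simp add: frame_group_def card_image card_Pow)
qed

text \<open>Coordinates 0 to 6 stand for the elements of \<open>F_7\<close> and 7 for infinity; 3, 5, 6 are the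
  non-residues modulo 7.\<close>
definition blk :: "nat \<Rightarrow> nat list" where
  "blk j = [7, (j + 3) mod 7, (j + 5) mod 7, (j + 6) mod 7]"

definition fano_root :: "nat \<Rightarrow> real^8" where
  "fano_root j = root_of (of_nat ` set (blk j))"

lemma less_7_cases:
  assumes "(i::nat) < 7"
  obtains "i = 0" | "i = 1" | "i = 2" | "i = 3" | "i = 4" | "i = 5" | "i = 6"
proof -
  have "i = 0 \<or> i = 1 \<or> i = 2 \<or> i = 3 \<or> i = 4 \<or> i = 5 \<or> i = 6" using assms by linarith
  then show ?thesis using that by blast
qed

text \<open>The non-residues 3, 5, 6 form a perfect difference set modulo 7. So two distinct blocks
  share infinity and exactly one further point, and a common part of size 2 means orthogonal
  roots.\<close>

lemma frame_fano_root: "frame fano_root"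
  unfolding frame_def
proof (intro conjI allI impI)
  have card: "card (of_nat ` set (blk i) :: 8 set) = 4" if "i < 7" for i
    using that by (rule less_7_cases) (simp_all add: blk_def)
  then show "fano_root i \<in> E7_roots" if "i < 7" for i
    using that by (simp add: fano_root_def root_in_E7)
  have "card (of_nat ` set (blk i) \<inter> of_nat ` set (blk j) :: 8 set) = 2"
    if ij: "i < 7" "j < 7" "i \<noteq> j" for i j
    by (rule less_7_cases[OF ij(1)]; rule less_7_cases[OF ij(2)])
      (use ij(3) in \<open>simp_all add: blk_def\<close>)
  then show "fano_root i \<bullet> fano_root j = 0" if "i < 7" "j < 7" "i \<noteq> j" for i j
    using that card by (simp add: fano_root_def root_inner_root)
qed

text \<open>The bound 128 is attained by the group of the explicit frame
  \<open>fano_root\<close>.\<close>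

lemma max_abelianD:
  assumes "max_abelian M"
  shows "abelian_subgroup M" "card M = 128"
proof -
  show ab: "abelian_subgroup M" using assms by (simp add: max_abelian_def)
  have "card (frame_group fano_root) \<le> card M"
    using assms abelian_frame_group[OF frame_fano_root] by (simp add: max_abelian_def)
  with card_abelian_subgroup[OF ab] show "card M = 128"
    by (simp add: card_frame_group frame_fano_root)
qed

lemma max_abelian_iff: "max_abelian M \<longleftrightarrow> abelian_subgroup M \<and> card M = 128"
  using max_abelianD[of M] card_abelian_subgroup by (metis max_abelian_def)

section \<open>Adjoining a commuting element\<close>

text \<open>As \<open>g\<close> commutes with \<open>B\<close> and its square lies in
  \<open>B\<close>, the two cosets of \<open>B\<close> already form a group. Where the bound is
  attained, the doubled order is a contradiction unless \<open>g\<close> lies in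
  \<open>B\<close>.\<close>

lemma abelian_isometries_adjoin:
  assumes B: "abelian_isometries B" and g: "linear g" "\<And>x y. g x \<bullet> g y = x \<bullet> y"
    and com: "\<And>b x. b \<in> B \<Longrightarrow> g (b x) = b (g x)" and sq: "g \<circ> g \<in> B"
  shows "abelian_isometries (B \<union> (\<circ>) g ` B)" "g \<notin> B \<Longrightarrow> card (B \<union> (\<circ>) g ` B) = 2 * card B"
proof -
  note D = abelian_isometriesD[OF B]
  have gg: "g \<circ> (g \<circ> b) \<in> B" if "b \<in> B" for b
    using D(3)[OF sq that] by (simp add: comp_assoc)
  have ggx: "g (g x) = (g \<circ> g) x" for x by simp
  have inj_g: "g x = g y \<Longrightarrow> x = y" for x y
  proof -
    assume "g x = g y"
    then have "g (x - y) = 0" by (simp add: linear_diff[OF g(1)])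
    then have "(x - y) \<bullet> (x - y) = 0" using g(2)[of "x - y" "x - y"] by simp
    then show "x = y" by simp
  qed
  obtain h where h: "h \<in> B" "\<And>x. h (g (g x)) = x" using D(5)[OF sq] by auto
  show "abelian_isometries (B \<union> (\<circ>) g ` B)"
    unfolding abelian_isometries_def
  proof (intro conjI ballI allI)
    show "finite (B \<union> (\<circ>) g ` B)" using D(1) by simp
    show "id \<in> B \<union> (\<circ>) g ` B" using D(2) by simp
    show "a \<circ> b \<in> B \<union> (\<circ>) g ` B" if ab: "a \<in> B \<union> (\<circ>) g ` B" "b \<in> B \<union> (\<circ>) g ` B" for a b
    proof -
      have *: "c \<circ> (g \<circ> d) = g \<circ> (c \<circ> d)" if "c \<in> B" for c d
        using com[OF that] by (auto simp: fun_eq_iff)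
      from ab show ?thesis
      proof (elim UnE imageE)
        assume "a \<in> B" "b \<in> B" then show ?thesis using D(3) by blast
      next
        fix d assume "a \<in> B" "b = g \<circ> d" "d \<in> B"
        then show ?thesis using D(3) * by blast
      next
        fix c assume "a = g \<circ> c" "c \<in> B" "b \<in> B"
        then show ?thesis using D(3) by (simp add: comp_assoc)
      next
        fix c d assume "a = g \<circ> c" "c \<in> B" "b = g \<circ> d" "d \<in> B"
        moreover from this have "a \<circ> b = g \<circ> (g \<circ> (c \<circ> d))"
          using *[of c d] by (simp only: comp_assoc)
        ultimately show ?thesis using gg D(3) by simp
      qed
    qed
    show "a (b x) = b (a x)" if "a \<in> B \<union> (\<circ>) g ` B" "b \<in> B \<union> (\<circ>) g ` B" for a b x
      using that
    proof (elim UnE imageE)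
      assume "a \<in> B" "b \<in> B" then show ?thesis by (rule D(4))
    next
      fix d assume "a \<in> B" "b = g \<circ> d" "d \<in> B"
      then show ?thesis by (simp add: com[of a, symmetric] D(4)[of a d])
    next
      fix c assume "a = g \<circ> c" "c \<in> B" "b \<in> B"
      then show ?thesis by (simp add: com[of b, symmetric] D(4)[of c b])
    next
      fix c d assume "a = g \<circ> c" "c \<in> B" "b = g \<circ> d" "d \<in> B"
      then show ?thesis by (simp add: com[of c, symmetric] com[of d, symmetric] D(4)[of c d])
    qed
    show "\<exists>c\<in>B \<union> (\<circ>) g ` B. \<forall>x. c (b x) = x" if b: "b \<in> B \<union> (\<circ>) g ` B" for b
      using b
    proof
      assume "b \<in> B" then show ?thesis using D(5) by blast
    next
      assume "b \<in> (\<circ>) g ` B"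
      then obtain d where d: "d \<in> B" "b = g \<circ> d" by auto
      obtain e where e: "e \<in> B" "\<And>x. e (d x) = x" using D(5)[OF d(1)] by auto
      \<comment> \<open>Since \<open>h\<close> inverts the square of \<open>g\<close>, the inverse
        of \<open>g\<close> is \<open>g\<close> composed with \<open>h\<close>, which stays in the
        second coset.\<close>
      have "g (e (h (g (d x)))) = x" for x
      proof -
        have "g (e (h (g (d x)))) = e (h (g (g (d x))))"
          using com[OF e(1)] com[OF h(1)] by simp
        then show ?thesis using h(2) e(2) by simp
      qed
      then show ?thesis using d(2) D(3)[OF e(1) h(1)]
        by (intro bexI[of _ "g \<circ> (e \<circ> h)"]) auto
    qed
    show "linear b" if "b \<in> B \<union> (\<circ>) g ` B" for b
      using that
    proof (elim UnE imageE)
      fix c assume "b = g \<circ> c" "c \<in> B"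
      then show ?thesis using linear_compose[OF D(6)[of c] g(1)] by simp
    qed (rule D(6))
    show "b x \<bullet> b y = x \<bullet> y" if "b \<in> B \<union> (\<circ>) g ` B" for b x y
      using that by (elim UnE imageE) (simp_all add: D(7) g(2))
  qed
  show "card (B \<union> (\<circ>) g ` B) = 2 * card B" if "g \<notin> B"
  proof -
    have "inj_on ((\<circ>) g) B"
      by (rule inj_onI) (auto simp: fun_eq_iff dest: inj_g)
    moreover have "B \<inter> (\<circ>) g ` B = {}"
    proof (rule ccontr)
      assume "B \<inter> (\<circ>) g ` B \<noteq> {}"
      then obtain b where b: "b \<in> B" "g \<circ> b \<in> B" by auto
      obtain c where c: "c \<in> B" "\<And>x. c (b x) = x" using D(5)[OF b(1)] by auto
      have "g = (g \<circ> b) \<circ> c"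
        using c(2) D(4)[OF b(1) c(1)] by (simp add: fun_eq_iff)
      then show False using D(3)[OF b(2) c(1)] that by simp
    qed
    ultimately show ?thesis using D(1) by (simp add: card_Un_disjoint card_image)
  qed
qed

text \<open>Otherwise adjoining \<open>g\<close> would give an abelian subgroup of order
  256.\<close>

lemma max_abelian_involution:
  assumes M: "max_abelian M" and g: "g \<in> Weyl_E7" "\<And>x. g (g x) = x"
    and com: "\<And>m x. m \<in> M \<Longrightarrow> g (m x) = m (g x)"
  shows "g \<in> M"
proof (rule ccontr)
  assume "g \<notin> M"
  note ab = max_abelianD(1)[OF M] and D = abelian_subgroupD[OF max_abelianD(1)[OF M]]
  let ?M = "M \<union> (\<circ>) g ` M"
  have "g \<circ> g = id" using g(2) by (simp add: fun_eq_iff)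
  then have "g \<circ> g \<in> M" using D(2) by argo
  note adj = abelian_isometries_adjoin[OF abelian_subgroup_isometries[OF ab] Weyl_linear[OF g(1)]
      Weyl_inner[OF g(1)] com this]
  note D' = abelian_isometriesD[OF adj(1)]
  have "?M \<subseteq> Weyl_E7" using D(1) g(1) Weyl_comp by blast
  then have "abelian_subgroup ?M"
  proof (rule abelian_subgroupI)
    show "?M \<noteq> {}" using D(2) by auto
  qed (rule D'(3) D'(4) D'(5); assumption)+
  then have "card ?M \<le> 128" by (rule card_abelian_subgroup)
  then show False using adj(2)[OF _ \<open>g \<notin> M\<close>] max_abelianD(2)[OF M] by simp
qed

lemma ind_inj: "ind S = ind T \<longleftrightarrow> S = T"
proof
  assume eq: "ind S = ind T"
  have "i \<in> S \<longleftrightarrow> i \<in> T" for i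
    using arg_cong[OF eq, of "\<lambda>x. x $ i"] by (simp split: if_splits)
  then show "S = T" by blast
qed simp

lemma root_inj: "root_of S = root_of T \<longleftrightarrow> S = T"
  by (simp add: root_of_def ind_inj)

lemma weight_inj: "weight S = weight T \<longleftrightarrow> S = T"
  by (simp add: weight_def ind_inj)

lemma card_E7_roots: "card E7_roots = 126"
proof -
  let ?A = "(\<lambda>(i, j). ind {i} - ind {j}) ` (UNIV - Id)"
  let ?B = "root_of ` {S. S \<subseteq> UNIV \<and> card S = 4}"
  have "inj_on (\<lambda>(i, j). ind {i} - ind {j}) (UNIV - Id)"
  proof (rule inj_onI, unfold split_paired_all prod.case prod.inject)
    fix i j k l :: 8
    assume "(i, j) \<in> UNIV - Id" "(k, l) \<in> UNIV - Id" and eq: "ind {i} - ind {j} = ind {k} - ind {l}"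
    then have ne: "i \<noteq> j" "k \<noteq> l" by auto
    from eq have "(ind {i} - ind {j}) $ m = (ind {k} - ind {l}) $ m" for m by simp
    from this[of i] this[of j] ne show "i = k \<and> j = l" by (auto split: if_splits)
  qed
  moreover have "card (UNIV - Id :: (8 \<times> 8) set) = 56"
  proof -
    have "(Id :: (8 \<times> 8) set) = (\<lambda>i. (i, i)) ` UNIV" by auto
    moreover have "card ((\<lambda>i::8. (i, i)) ` UNIV) = card (UNIV :: 8 set)"
      by (intro card_image inj_onI) simp
    ultimately have Id: "card (Id :: (8 \<times> 8) set) = 8" by simp
    have "card (UNIV :: (8 \<times> 8) set) = 64" by (simp add: card_prod)
    with Id show ?thesis by (simp add: card_Diff_subset)
  qed
  ultimately have A: "card ?A = 56" by (simp add: card_image)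
  have "card {S. S \<subseteq> (UNIV :: 8 set) \<and> card S = 4} = 8 choose 4"
    by (subst n_subsets) auto
  also have "(8::nat) choose 4 = 70" by (simp add: binomial_fact' fact_numeral eval_nat_numeral)
  finally have "card {S. S \<subseteq> (UNIV :: 8 set) \<and> card S = 4} = 70" .
  moreover have "inj_on root_of {S. S \<subseteq> UNIV \<and> card S = 4}" by (auto simp: inj_on_def root_inj)
  ultimately have B: "card ?B = 70" by (simp add: card_image)
  have "?A \<inter> ?B = {}"
  proof -
    have "ind {i} - ind {j} \<noteq> root_of S" for i j S
    proof
      assume "ind {i} - ind {j} = root_of S"
      then have "(ind {i} - ind {j}) $ i = root_of S $ i" by simp
      then show False by (auto simp: root_of_def split: if_splits)
    qed
    then show ?thesis by auto
  qed
  moreover have "E7_roots = ?A \<union> ?B" by (auto simp: E7_roots_eq)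
  ultimately show ?thesis using A B card_Un_disjoint[of ?A ?B] by simp
qed

section \<open>The central involution and a stable pair of roots\<close>

text \<open>Multiplication by -1 on the span of the roots, extended so that \<open>theta\<close> is
  fixed, as it must be in the Weyl group: the coefficient is right because theta \<bullet> theta =
  2.\<close>

definition neg :: "real^8 \<Rightarrow> real^8" where
  "neg x = (x \<bullet> theta) *\<^sub>R theta - x"

text \<open>The product of the seven reflections of a frame negates the whole complement of
  \<open>theta\<close>; this is what puts \<open>neg\<close> into the Weyl group.\<close>

lemma neg_eq_flip: "neg = flip fano_root {..<7}"
proof
  fix x
  show "neg x = flip fano_root {..<7} x"
  proof (rule frame_eqI[OF frame_fano_root])
    show "neg x \<bullet> fano_root i = flip fano_root {..<7} x \<bullet> fano_root i" if "i < 7" for i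
    proof -
      have "theta \<bullet> fano_root i = 0"
        using frame_root[OF frame_fano_root that] by (metis E7_root_theta inner_commute)
      then show ?thesis
        using that by (simp add: flip_inner[OF frame_fano_root] neg_def inner_diff_left)
    qed
    show "neg x \<bullet> theta = flip fano_root {..<7} x \<bullet> theta"
      by (simp add: flip_theta[OF frame_fano_root] neg_def inner_diff_left)
  qed
qed

lemma neg_in_Weyl: "neg \<in> Weyl_E7"
  by (simp add: neg_eq_flip flip_in_Weyl frame_fano_root)

lemma neg_orthogonal: "x \<bullet> theta = 0 \<Longrightarrow> neg x = - x"
  by (simp add: neg_def)

lemma neg_neg: "neg (neg x) = x"
  by (simp add: neg_def inner_diff_left)

lemma neg_commute:
  assumes "w \<in> Weyl_E7"
  shows "neg (w x) = w (neg x)"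
proof -
  have "w x \<bullet> theta = x \<bullet> theta"
    using Weyl_inner[OF assms, of x theta] Weyl_theta[OF assms] by simp
  then show ?thesis
    using assms by (simp add: neg_def linear_diff linear_cmul Weyl_linear Weyl_theta)
qed

lemma neg_in_max_abelian:
  assumes "max_abelian M"
  shows "neg \<in> M"
proof (rule max_abelian_involution[OF assms neg_in_Weyl neg_neg])
  fix m x assume "m \<in> M"
  then show "neg (m x) = m (neg x)"
    using abelian_subgroupD(1)[OF max_abelianD(1)[OF assms]] by (intro neg_commute) blast
qed

lemma E7_root_nonzero: "a \<in> E7_roots \<Longrightarrow> a \<noteq> - a"
  using E7_root_norm[of a] by (metis inner_minus_left neg_equal_iff_equal neg_numeral_neq_numeral)

text \<open>There are 126 roots, and 126 is 2 modulo 4: not all orbits of the 2-group \<open>M\<close> can be longer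
  than \<open>{\<beta>, -\<beta>}\<close>.\<close>
lemma max_abelian_stable_root:
  assumes M: "max_abelian M"
  shows "\<exists>\<beta>\<in>E7_roots. \<forall>m\<in>M. m \<beta> = \<beta> \<or> m \<beta> = - \<beta>"
proof (rule ccontr)
  assume no: "\<not> ?thesis"
  note D = abelian_subgroupD[OF max_abelianD(1)[OF M]]
  define orb where "orb = (\<lambda>a::real^8. (\<lambda>m. m a) ` M)"
  have "4 dvd card (orb a)" if a: "a \<in> E7_roots" for a
  proof -
    \<comment> \<open>The image under \<open>m\<close> is a third element beside \<open>a\<close>
      and \<open>- a\<close>. An orbit size is a power of 2, so being at least 3 makes it divisible
      by 4.\<close>
    obtain m where m: "m \<in> M" "m a \<noteq> a" "m a \<noteq> - a" using no a by blast
    have "a \<in> orb a" unfolding orb_def using D(2) by (metis id_apply image_iff)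
    moreover have "- a \<in> orb a"
      unfolding orb_def using neg_in_max_abelian[OF M] neg_orthogonal[OF E7_root_theta[OF a]]
      by (metis image_iff)
    ultimately have "{a, - a, m a} \<subseteq> orb a" using m(1) by (auto simp: orb_def)
    moreover have fin: "finite (orb a)" using D(6) by (simp add: orb_def)
    ultimately have "card {a, - a, m a} \<le> card (orb a)" by (intro card_mono)
    moreover have "card {a, - a, m a} = 3" using m E7_root_nonzero[OF a] by auto
    ultimately have "3 \<le> card (orb a)" by simp
    moreover have "2 ^ 7 = card (orb a) * card {m \<in> M. m a = a}"
      using card_orbit_stabilizer[OF abelian_subgroup_isometries[OF max_abelianD(1)[OF M]], of a]
        max_abelianD(2)[OF M] by (simp add: orb_def)
    then have "card (orb a) dvd 2 ^ 7" by (rule dvdI)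
    then obtain k where k: "card (orb a) = 2 ^ k"
      using divides_primepow_nat[of 2 "card (orb a)" 7] two_is_prime_nat by blast
    ultimately have "2 \<le> k" by (cases k; cases "k - 1") auto
    then show ?thesis unfolding k using le_imp_power_dvd[of 2 k "2::nat"] by simp
  qed
  then have "4 dvd card (\<Union>(orb ` E7_roots))"
  proof (intro dvd_partition)
    have "finite E7_roots" using card_E7_roots by (intro card_ge_0_finite) simp
    then show "finite (\<Union>(orb ` E7_roots))" using D(6) by (simp add: orb_def)
    show "\<forall>c1\<in>orb ` E7_roots. \<forall>c2\<in>orb ` E7_roots. c1 \<noteq> c2 \<longrightarrow> c1 \<inter> c2 = {}"
    proof -
      have "orb a \<subseteq> orb b" if x: "x \<in> orb a" "x \<in> orb b" for a b x
      proof -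
        obtain m n where mn: "m \<in> M" "x = m a" "n \<in> M" "x = n b" using x unfolding orb_def by blast
        obtain m' where m': "m' \<in> M" "\<And>v. m' (m v) = v" using D(5)[OF mn(1)] by auto
        have "a = m' (n b)" using mn m'(2) by metis
        then have "p a = (p \<circ> (m' \<circ> n)) b" for p by simp
        moreover have "p \<circ> (m' \<circ> n) \<in> M" if "p \<in> M" for p using that mn m' D(3) by blast
        ultimately show ?thesis unfolding orb_def by blast
      qed
      then show ?thesis by blast
    qed
  qed auto
  moreover have "\<Union>(orb ` E7_roots) = E7_roots"
  proof (intro equalityI subsetI)
    fix x assume "x \<in> \<Union>(orb ` E7_roots)"
    then show "x \<in> E7_roots" using D(1) Weyl_roots by (auto simp: orb_def)
  next
    fix x assume "x \<in> E7_roots"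
    moreover have "x \<in> orb x" unfolding orb_def using D(2) by (metis id_apply image_iff)
    ultimately show "x \<in> \<Union>(orb ` E7_roots)" by blast
  qed
  ultimately show False by (simp add: card_E7_roots)
qed

lemma refl_diff_root:
  assumes "a \<in> E7_roots" "b \<in> E7_roots" "a \<bullet> b = 1"
  shows "a - b \<in> E7_roots" "refl (a - b) a = b"
proof -
  have "refl b a = a - b" using assms by (simp add: refl_norm2 E7_root_norm)
  then show ab: "a - b \<in> E7_roots"
    using Weyl_roots[OF refl_in_Weyl[OF assms(2)] assms(1)] by simp
  have "a \<bullet> (a - b) = 1" using assms by (simp add: inner_diff_right E7_root_norm)
  then show "refl (a - b) a = b" by (simp add: refl_norm2 E7_root_norm ab)
qed

text \<open>Coordinate permutations join the half-integral roots. An integral root is first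
  exchanged with a half-integral one at inner product 1, by the reflection in their
  difference.\<close>

lemma Weyl_transitive_roots:
  assumes "a \<in> E7_roots" "card S = 4"
  shows "\<exists>w\<in>Weyl_E7. w a = root_of S"
proof -
  have half: "\<exists>w\<in>Weyl_E7. w (root_of T) = root_of S" if T: "card T = 4" for T
  proof -
    obtain p where "bij p" "p ` T = S" using ex_bij_image_eq[of T S] T assms(2) by auto
    then show ?thesis using permc_in_Weyl permc_root by metis
  qed
  from assms(1) consider i j where "i \<noteq> j" "a = ind {i} - ind {j}" | T where "card T = 4" "a = root_of T"
    by (auto simp: E7_roots_eq)
  then show ?thesis
  proof cases
    case (1 i j)
    have "4 \<le> card (UNIV - {j})" by (simp add: card_Diff_singleton)
    \<comment> \<open>The 4-set obtained by adding \<open>i\<close> contains \<open>i\<close> but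
      not \<open>j\<close>, which makes the inner product 1.\<close>
    then obtain T' where "T' \<subseteq> UNIV - {i, j}" "card T' = 3"
      using obtain_subset_with_card_n[of 3 "UNIV - {i, j}"] 1(1) by (auto simp: card_Diff_subset)
    then have T: "card (insert i T') = 4" "j \<notin> insert i T'" using 1(1)
      by (auto simp: card_insert_if subset_iff)
    then have ip: "a \<bullet> root_of (insert i T') = 1"
      by (auto simp: 1 root_of_def inner_diff_left inner_diff_right)
    note r = refl_diff_root[OF assms(1) root_in_E7[OF T(1)] ip]
    obtain w where w: "w \<in> Weyl_E7" "w (root_of (insert i T')) = root_of S" using half[OF T(1)] by auto
    then have "(w \<circ> refl (a - root_of (insert i T'))) a = root_of S" by (simp add: r(2))
    then show ?thesis using Weyl_comp[OF w(1) refl_in_Weyl[OF r(1)]] by blast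
  next
    case 2
    then show ?thesis using half by simp
  qed
qed

definition conj_group :: "(real^8 \<Rightarrow> real^8) \<Rightarrow> (real^8 \<Rightarrow> real^8) set \<Rightarrow> (real^8 \<Rightarrow> real^8) set" where
  "conj_group w M = (\<lambda>m. w \<circ> m \<circ> (inv\<^bsub>WE7\<^esub> w)) ` M"

lemma max_abelian_conj:
  assumes M: "max_abelian M" and w: "w \<in> Weyl_E7"
  shows "max_abelian (conj_group w M)"
proof -
  note D = abelian_subgroupD[OF max_abelianD(1)[OF M]] and iw = inv_WE7[OF w]
  have "abelian_subgroup (conj_group w M)"
  proof (rule abelian_subgroupI)
    show "conj_group w M \<subseteq> Weyl_E7"
      using D(1) w iw(1) unfolding conj_group_def by (auto intro!: Weyl_comp)
    show "conj_group w M \<noteq> {}" using D(2) by (auto simp: conj_group_def)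
    show "x \<circ> y \<in> conj_group w M" if xy: "x \<in> conj_group w M" "y \<in> conj_group w M" for x y
    proof -
      obtain m n where mn: "m \<in> M" "n \<in> M" "x = w \<circ> m \<circ> (inv\<^bsub>WE7\<^esub> w)" "y = w \<circ> n \<circ> (inv\<^bsub>WE7\<^esub> w)"
        using xy by (auto simp: conj_group_def)
      then have "x \<circ> y = w \<circ> (m \<circ> n) \<circ> (inv\<^bsub>WE7\<^esub> w)" by (simp add: fun_eq_iff iw(2))
      then show ?thesis using D(3)[OF mn(1,2)] unfolding conj_group_def by (intro image_eqI)
    qed
    show "x (y v) = y (x v)" if xy: "x \<in> conj_group w M" "y \<in> conj_group w M" for x y v
    proof -
      obtain m n where mn: "m \<in> M" "n \<in> M" "x = w \<circ> m \<circ> (inv\<^bsub>WE7\<^esub> w)" "y = w \<circ> n \<circ> (inv\<^bsub>WE7\<^esub> w)"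
        using xy by (auto simp: conj_group_def)
      then show ?thesis using D(4)[OF mn(1,2)] by (simp add: iw(2))
    qed
    show "\<exists>y\<in>conj_group w M. \<forall>v. y (x v) = v" if x: "x \<in> conj_group w M" for x
    proof -
      obtain m where m: "m \<in> M" "x = w \<circ> m \<circ> (inv\<^bsub>WE7\<^esub> w)" using x by (auto simp: conj_group_def)
      obtain n where n: "n \<in> M" "\<And>v. n (m v) = v" using D(5)[OF m(1)] by auto
      show ?thesis
        by (rule bexI[of _ "w \<circ> n \<circ> (inv\<^bsub>WE7\<^esub> w)"])
          (use m n iw in \<open>auto simp: conj_group_def\<close>)
    qed
  qed
  moreover have "inj_on (\<lambda>m. w \<circ> m \<circ> (inv\<^bsub>WE7\<^esub> w)) M"
  proof (rule inj_onI)
    fix m n assume eq: "w \<circ> m \<circ> (inv\<^bsub>WE7\<^esub> w) = w \<circ> n \<circ> (inv\<^bsub>WE7\<^esub> w)"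
    have "m v = n v" for v
      using fun_cong[OF eq, of "w v"] by (simp add: iw(2)) (metis iw(2))
    then show "m = n" by blast
  qed
  then have "card (conj_group w M) = card M" by (simp add: conj_group_def card_image)
  ultimately show ?thesis using max_abelianD(2)[OF M] by (simp add: max_abelian_iff)
qed

section \<open>The cross polytope at a root\<close>

text \<open>Every root is conjugate to a half-integral one, and for these the weights of inner
  product 1 can be listed as pairs inside \<open>S\<close> and negated pairs outside it.\<close>

locale half_root =
  fixes S :: "8 set"
  assumes card_S: "card S = 4"
begin

definition \<beta> :: "real^8" where "\<beta> = root_of S"

text \<open>Subtracting half the root centres the cross polytope at the origin: the inner products
  3/2, 1/2, -1/2 become 1, 0, -1, so \<open>F\<close> consists of an orthonormal basis of the
  complement of \<beta> and \<open>theta\<close> and its negatives.\<close>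

definition F :: "(real^8) set" where
  "F = {x - (1/2) *\<^sub>R \<beta> | x. x \<in> wts \<and> x \<bullet> \<beta> = 1}"

lemma beta_root: "\<beta> \<in> E7_roots"
  by (simp add: \<beta>_def root_in_E7 card_S)

lemma beta_norm: "\<beta> \<bullet> \<beta> = 2"
  by (rule E7_root_norm[OF beta_root])

lemma FE:
  assumes "f \<in> F"
  obtains x where "x \<in> wts" "x \<bullet> \<beta> = 1" "f = x - (1/2) *\<^sub>R \<beta>"
  using assms unfolding F_def by blast

lemma F_beta: "f \<in> F \<Longrightarrow> f \<bullet> \<beta> = 0"
  by (erule FE) (simp add: inner_diff_left beta_norm)

lemma F_theta: "f \<in> F \<Longrightarrow> f \<bullet> theta = 0"
  by (erule FE) (simp add: inner_diff_left wts_theta E7_root_theta beta_root)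

lemma F_inner_eq:
  assumes "x \<bullet> \<beta> = 1" "y \<bullet> \<beta> = 1"
  shows "(x - (1/2) *\<^sub>R \<beta>) \<bullet> (y - (1/2) *\<^sub>R \<beta>) = x \<bullet> y - 1/2"
  using assms inner_commute[of \<beta> y] by (simp add: inner_diff_left inner_diff_right beta_norm)

lemma F_norm: "f \<in> F \<Longrightarrow> f \<bullet> f = 1"
  by (erule FE) (simp add: F_inner_eq wts_norm)

lemma F_nonzero: "f \<in> F \<Longrightarrow> f \<noteq> 0" and F_neq_uminus: "f \<in> F \<Longrightarrow> f \<noteq> - f"
  using F_norm by fastforce (metis F_norm inner_minus_left neg_equal_iff_equal one_neq_neg_one)

lemma F_cases:
  assumes "f \<in> F" "g \<in> F"
  shows "f = g \<or> f = - g \<or> f \<bullet> g = 0"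
proof -
  obtain x where x: "x \<in> wts" "x \<bullet> \<beta> = 1" "f = x - (1/2) *\<^sub>R \<beta>" using assms(1) by (rule FE)
  obtain y where y: "y \<in> wts" "y \<bullet> \<beta> = 1" "g = y - (1/2) *\<^sub>R \<beta>" using assms(2) by (rule FE)
  have fg: "f \<bullet> g = x \<bullet> y - 1/2" using x y by (simp add: F_inner_eq)
  have "x \<noteq> - y" using x(2) y(2) by auto
  then consider "x = y" | "x \<bullet> y = 1/2" | "x \<bullet> y = -1/2" using wts_inner[OF x(1) y(1)] by blast
  then show ?thesis
  proof cases
    case 3
    \<comment> \<open>Here the two unit vectors have inner product -1, so their sum has length
      0.\<close>
    then have "(f + g) \<bullet> (f + g) = 0"
      using fg F_norm assms inner_commute[of g f] by (simp add: inner_add_left inner_add_right)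
    then have "f + g = 0" by simp
    then show ?thesis by (simp add: add_eq_0_iff2)
  qed (use x y fg in auto)
qed

lemma F_perm:
  assumes "w \<in> Weyl_E7" "w \<beta> = \<beta>" "f \<in> F"
  shows "w f \<in> F"
proof -
  obtain x where x: "x \<in> wts" "x \<bullet> \<beta> = 1" "f = x - (1/2) *\<^sub>R \<beta>" using assms(3) by (rule FE)
  have "w x \<bullet> \<beta> = 1" using Weyl_inner[OF assms(1), of x \<beta>] assms(2) x(2) by simp
  moreover have "w f = w x - (1/2) *\<^sub>R \<beta>"
    using assms(1,2) by (simp add: x(3) linear_diff linear_cmul Weyl_linear)
  ultimately show ?thesis using Weyl_wts[OF assms(1) x(1)] by (auto simp: F_def)
qed

text \<open>The antipodal map of the cross polytope, realized by an element of the Weyl group that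
  fixes \<beta>.\<close>

definition neg_beta :: "real^8 \<Rightarrow> real^8" where
  "neg_beta = neg \<circ> refl \<beta>"

lemma neg_beta_Weyl: "neg_beta \<in> Weyl_E7"
  unfolding neg_beta_def by (intro Weyl_comp neg_in_Weyl refl_in_Weyl beta_root)

lemma neg_beta_beta: "neg_beta \<beta> = \<beta>"
proof -
  have "- \<beta> \<bullet> theta = 0" using E7_root_theta[OF beta_root] by simp
  then show ?thesis by (simp add: neg_beta_def refl_self neg_orthogonal)
qed

lemma neg_beta_F: "f \<in> F \<Longrightarrow> neg_beta f = - f"
  by (simp add: neg_beta_def refl_fixes F_beta neg_orthogonal F_theta)

lemma F_uminus: "f \<in> F \<Longrightarrow> - f \<in> F"
  using F_perm[OF neg_beta_Weyl neg_beta_beta] neg_beta_F by force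

text \<open>As \<open>F\<close> is closed under negation, the sum is a root as well: these are the
  roots of the D6 orthogonal to \<beta>.\<close>

lemma F_diff_root:
  assumes "f \<in> F" "g \<in> F" "f \<bullet> g = 0"
  shows "f - g \<in> E7_roots"
proof -
  obtain x where x: "x \<in> wts" "x \<bullet> \<beta> = 1" "f = x - (1/2) *\<^sub>R \<beta>" using assms(1) by (rule FE)
  obtain y where y: "y \<in> wts" "y \<bullet> \<beta> = 1" "g = y - (1/2) *\<^sub>R \<beta>" using assms(2) by (rule FE)
  have "x \<bullet> y = 1/2" using F_inner_eq[OF x(2) y(2)] assms(3) x(3) y(3) by simp
  moreover have "f - g = x - y" using x y by simp
  ultimately show ?thesis using x(1) y(1) by (auto simp: E7_roots_eq_diff)
qed

lemma nonobtuse_F: "nonobtuse F"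
  unfolding nonobtuse_def
proof (intro ballI)
  fix a b c assume "a \<in> F" "b \<in> F" "c \<in> F"
  then obtain x y z where "x \<in> wts" "y \<in> wts" "z \<in> wts"
    "a = x - (1/2) *\<^sub>R \<beta>" "b = y - (1/2) *\<^sub>R \<beta>" "c = z - (1/2) *\<^sub>R \<beta>"
    by (metis FE)
  then show "0 \<le> (a - b) \<bullet> (c - b)" using nonobtuse_wts by (simp add: nonobtuse_def)
qed

lemma F_eq:
  "F = (\<lambda>P. weight P - (1/2) *\<^sub>R \<beta>) ` {P. P \<subseteq> S \<and> card P = 2}
     \<union> (\<lambda>P. - weight P - (1/2) *\<^sub>R \<beta>) ` {P. P \<subseteq> - S \<and> card P = 2}"
proof -
  have ip: "weight P \<bullet> \<beta> = real (card (P \<inter> S)) - 1" if "card P = 2" for P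
    using that card_S by (simp add: \<beta>_def weight_inner_root)
  have 1: "weight P \<bullet> \<beta> = 1 \<longleftrightarrow> P \<subseteq> S" if "card P = 2" for P
  proof
    assume "weight P \<bullet> \<beta> = 1"
    then have "card (P \<inter> S) = card P" using ip[OF that] that by simp
    then have "P \<inter> S = P" by (intro card_subset_eq) auto
    then show "P \<subseteq> S" by blast
  next
    assume "P \<subseteq> S"
    then show "weight P \<bullet> \<beta> = 1" using ip[OF that] that by (simp add: Int_absorb2)
  qed
  have 2: "- weight P \<bullet> \<beta> = 1 \<longleftrightarrow> P \<subseteq> - S" if "card P = 2" for P
    using ip[OF that] by (auto simp: disjoint_eq_subset_Compl[symmetric])
  show ?thesis
  proof (intro equalityI subsetI)
    fix f assume "f \<in> F"
    then obtain x where x: "x \<in> wts" "x \<bullet> \<beta> = 1" "f = x - (1/2) *\<^sub>R \<beta>" by (rule FE)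
    from x(1) show "f \<in> (\<lambda>P. weight P - (1/2) *\<^sub>R \<beta>) ` {P. P \<subseteq> S \<and> card P = 2}
     \<union> (\<lambda>P. - weight P - (1/2) *\<^sub>R \<beta>) ` {P. P \<subseteq> - S \<and> card P = 2}"
    proof (rule wtsE)
      fix P assume P: "card P = 2" "x = weight P"
      then show ?thesis using x(2,3) 1[OF P(1)] by blast
    next
      fix P assume P: "card P = 2" "x = - weight P"
      then show ?thesis using x(2,3) 2[OF P(1)] by blast
    qed
  next
    fix f assume "f \<in> (\<lambda>P. weight P - (1/2) *\<^sub>R \<beta>) ` {P. P \<subseteq> S \<and> card P = 2}
     \<union> (\<lambda>P. - weight P - (1/2) *\<^sub>R \<beta>) ` {P. P \<subseteq> - S \<and> card P = 2}"
    then show "f \<in> F"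
    proof (elim UnE imageE CollectE conjE)
      fix P assume P: "f = weight P - (1/2) *\<^sub>R \<beta>" "P \<subseteq> S" "card P = 2"
      then show ?thesis unfolding F_def using 1[OF P(3)] weight_in_wts[OF P(3)] by blast
    next
      fix P assume P: "f = - weight P - (1/2) *\<^sub>R \<beta>" "P \<subseteq> - S" "card P = 2"
      then show ?thesis unfolding F_def using 2[OF P(3)] minus_in_wts[OF weight_in_wts[OF P(3)]] by blast
    qed
  qed
qed

lemma finite_F: "finite F"
  unfolding F_eq by simp

lemma card_F: "card F = 12"
proof -
  let ?A = "(\<lambda>P. weight P - (1/2) *\<^sub>R \<beta>) ` {P. P \<subseteq> S \<and> card P = 2}"
  let ?B = "(\<lambda>P. - weight P - (1/2) *\<^sub>R \<beta>) ` {P. P \<subseteq> - S \<and> card P = 2}"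
  have "(4::nat) choose 2 = 6" by (simp add: eval_nat_numeral)
  moreover have "card (- S) = 4" unfolding card_Compl_8 card_S by simp
  ultimately have c: "card {P. P \<subseteq> S \<and> card P = 2} = 6" "card {P. P \<subseteq> - S \<and> card P = 2} = 6"
    by (simp_all add: n_subsets card_S)
  have A: "card ?A = 6" using c(1) by (subst card_image) (auto simp: inj_on_def weight_inj)
  have B: "card ?B = 6" using c(2) by (subst card_image) (auto simp: inj_on_def weight_inj)
  have "weight P \<noteq> - weight Q" if "card P = 2" "card Q = 2" for P Q
  proof
    assume eq: "weight P = - weight Q"
    then have "weight P \<bullet> weight Q = - (3/2)" using that by (simp add: weight_inner_weight)
    then show False using that by (simp add: weight_inner_weight)
  qed
  then have "?A \<inter> ?B = {}" by auto
  then show ?thesis unfolding F_eq using A B card_Un_disjoint[of ?A ?B] by simp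
qed

text \<open>In a cross polytope only \<open>v\<close> and \<open>- v\<close> fail to be orthogonal
  to \<open>v\<close>, so \<open>V\<close> excludes at most twice its number of vertices.\<close>

lemma ex_orthogonal:
  assumes "A \<subseteq> F" "V \<subseteq> F" "2 * card V < card A"
  shows "\<exists>u\<in>A. \<forall>v\<in>V. u \<bullet> v = 0"
proof (rule ccontr)
  assume no: "\<not> ?thesis"
  have "finite V" using assms(2) finite_F by (rule finite_subset)
  have "A \<subseteq> V \<union> uminus ` V"
  proof
    fix u assume "u \<in> A"
    then obtain v where "v \<in> V" "u \<bullet> v \<noteq> 0" using no by blast
    then have "u = v \<or> u = - v" using F_cases[of u v] assms \<open>u \<in> A\<close> by blast
    then show "u \<in> V \<union> uminus ` V" using \<open>v \<in> V\<close> by blast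
  qed
  then have "card A \<le> card (V \<union> uminus ` V)" using \<open>finite V\<close> by (intro card_mono) auto
  also have "\<dots> \<le> card V + card (uminus ` V)" by (rule card_Un_le)
  also have "\<dots> \<le> 2 * card V" using card_image_le[OF \<open>finite V\<close>, of uminus] by simp
  finally show False using assms(3) by simp
qed

text \<open>Greedy choice: the inequality says that the n - 1 earlier vectors and their negatives do
  not exhaust \<open>A\<close>.\<close>

lemma orthogonal_subset:
  assumes "A \<subseteq> F" "2 * n < card A + 2"
  shows "\<exists>V\<subseteq>A. card V = n \<and> pairwise orthogonal V"
  using assms(2)
proof (induction n)
  case 0
  show ?case by (intro exI[of _ "{}"]) simp
next
  case (Suc n)
  then obtain V where V: "V \<subseteq> A" "card V = n" "pairwise orthogonal V" by auto
  then obtain u where u: "u \<in> A" "\<forall>v\<in>V. u \<bullet> v = 0"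
    using ex_orthogonal[of A V] assms(1) Suc.prems by auto
  have "finite V" using V(1) assms(1) finite_F by (meson finite_subset subset_trans)
  moreover have "u \<notin> V" using u F_norm[of u] assms(1) by force
  moreover have "pairwise orthogonal (insert u V)"
    using V(3) u(2) by (auto simp: pairwise_insert orthogonal_def inner_commute)
  ultimately show ?case using V u by (intro exI[of _ "insert u V"]) auto
qed

lemma orthogonal_insert:
  assumes "V \<subseteq> F" "pairwise orthogonal V"
  defines "D \<equiv> insert theta (insert \<beta> V)"
  shows "finite D" "pairwise orthogonal D" "0 \<notin> D" "card D = card V + 2"
proof -
  have bt: "\<beta> \<bullet> theta = 0" by (rule E7_root_theta[OF beta_root])
  have fin: "finite V" using assms(1) finite_F by (rule finite_subset)
  then show "finite D" by (simp add: D_def)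
  have "\<beta> \<noteq> theta" using bt theta_inner_theta by auto
  moreover have "\<beta> \<notin> V" using F_beta beta_norm assms(1) by force
  moreover have "theta \<notin> V" using F_theta theta_inner_theta assms(1) by force
  ultimately show "card D = card V + 2" using fin by (simp add: D_def)
  show "0 \<notin> D" using theta_nonzero beta_norm F_nonzero assms(1) by (auto simp: D_def)
  have "v \<bullet> \<beta> = 0" "v \<bullet> theta = 0" if "v \<in> V" for v
    using that assms(1) F_beta F_theta by auto
  then show "pairwise orthogonal D"
    using assms(2) bt by (auto simp: D_def pairwise_insert orthogonal_def inner_commute)
qed

lemma F_separates:
  assumes "\<And>x y. b x \<bullet> b y = x \<bullet> y" "b theta = theta" "b \<beta> = \<beta>"
    and "\<And>f. f \<in> F \<Longrightarrow> b f = f"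
  shows "b = id"
proof
  fix x
  obtain V where V: "V \<subseteq> F" "card V = 6" "pairwise orthogonal V"
    using orthogonal_subset[of F 6] card_F by auto
  note D = orthogonal_insert[OF V(1,3)]
  show "b x = id x"
  proof (rule eq_if_inner_orthogonal_eq[OF D(1-3)])
    show "card (insert theta (insert \<beta> V)) = DIM(real^8)" using D(4) V(2) by simp
    fix d assume "d \<in> insert theta (insert \<beta> V)"
    then have "b d = d" using assms(2-4) V(1) by auto
    then show "b x \<bullet> d = id x \<bullet> d" using assms(1)[of x d] by simp
  qed
qed

text \<open>\<open>theta\<close> and \<beta> are two further fixed directions, whence the 2 in the
  exponent; 256 is 2^8.\<close>

lemma card_le_if_fixes:
  assumes C: "abelian_isometries C"
    and fix_C: "\<And>c. c \<in> C \<Longrightarrow> c theta = theta" "\<And>c. c \<in> C \<Longrightarrow> c \<beta> = \<beta>"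
    and perm: "\<And>c f. c \<in> C \<Longrightarrow> f \<in> F \<Longrightarrow> c f \<in> F"
    and V: "V \<subseteq> F" "pairwise orthogonal V" "\<And>c v. c \<in> C \<Longrightarrow> v \<in> V \<Longrightarrow> c v = v"
  shows "card C * 2 ^ (card V + 2) \<le> 256"
proof -
  note D = orthogonal_insert[OF V(1,2)]
  have "card C * 2 ^ card (insert theta (insert \<beta> V)) \<le> 2 ^ DIM(real^8)"
  proof (rule card_abelian_isometries[OF C finite_F nonobtuse_F _ _ D(1-3)])
    fix b x assume "b \<in> C" "x \<in> F"
    then show "b x \<in> F" by (rule perm)
  next
    fix b assume b: "b \<in> C" "\<And>x. x \<in> F \<Longrightarrow> b x = x"
    show "b = id"
      by (rule F_separates) (use b fix_C abelian_isometriesD(7)[OF C] in auto)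
  next
    fix b d assume "b \<in> C" "d \<in> insert theta (insert \<beta> V)"
    then show "b d = d" using fix_C V(3) by auto
  qed
  then show ?thesis by (simp add: D(4))
qed

lemma ex_wt_orthogonal_beta: "\<exists>x\<in>wts. x \<bullet> \<beta> = 0"
proof -
  obtain i where i: "i \<in> S" using card_S by (metis all_not_in_conv card.empty zero_neq_numeral)
  have "card (- S) = 4" unfolding card_Compl_8 card_S by simp
  then obtain j where j: "j \<in> - S" by (metis all_not_in_conv card.empty zero_neq_numeral)
  have "i \<noteq> j" using i j by auto
  have "{i, j} \<inter> S = {i}" "card {i, j} = 2" using i j \<open>i \<noteq> j\<close> by auto
  then have "weight {i, j} \<bullet> \<beta> = 0" "weight {i, j} \<in> wts"
    using card_S by (simp_all add: \<beta>_def weight_inner_root weight_in_wts)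
  then show ?thesis by blast
qed

text \<open>A weight orthogonal to \<beta> has coordinates 1/2 or -1/2 on the cross polytope. It
  serves as the test vector that detects isometries outside the Weyl group.\<close>

lemma wt_inner_F:
  assumes "x \<in> wts" "x \<bullet> \<beta> = 0" "f \<in> F"
  shows "(x \<bullet> f)\<^sup>2 = 1/4"
proof -
  obtain y where y: "y \<in> wts" "y \<bullet> \<beta> = 1" "f = y - (1/2) *\<^sub>R \<beta>" using assms(3) by (rule FE)
  have "x \<bullet> f = x \<bullet> y" using assms(2) y(3) by (simp add: inner_diff_right)
  moreover have "x \<noteq> y" "x \<noteq> - y" using assms(2) y(2) by auto
  ultimately have "x \<bullet> f = 1/2 \<or> x \<bullet> f = - (1/2)" using wts_inner[OF assms(1) y(1)] by simp
  then show ?thesis by (elim disjE; simp only:) (simp_all add: power2_eq_square)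
qed

text \<open>Two weights have inner product 3/2, 1/2, -1/2 or -3/2, and the Weyl group permutes the
  weights.\<close>

lemma Weyl_wt_inner_neq_1:
  assumes "w \<in> Weyl_E7" "x \<in> wts"
  shows "x \<bullet> w x \<noteq> 1"
proof
  assume 1: "x \<bullet> w x = 1"
  have "x \<bullet> w x = x \<bullet> x" if "x = w x" using arg_cong[OF that, of "\<lambda>y. x \<bullet> y"] by simp
  moreover have "x \<bullet> w x = - (x \<bullet> x)" if "x = - w x"
    using arg_cong[OF that, of "\<lambda>y. x \<bullet> y"] by simp
  ultimately show False
    using 1 wts_inner[OF assms(2) Weyl_wts[OF assms]] wts_norm[OF assms(2)] by linarith
qed

text \<open>A single sign change moves the test weight x to inner product 3/2 - 2 * (1/4) = 1 with
  itself.\<close>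

lemma refl_F_notin_Weyl:
  assumes "f \<in> F"
  shows "refl f \<notin> Weyl_E7"
proof
  assume w: "refl f \<in> Weyl_E7"
  obtain x where x: "x \<in> wts" "x \<bullet> \<beta> = 0" using ex_wt_orthogonal_beta by auto
  have "x \<bullet> refl f x = x \<bullet> x - 2 * (x \<bullet> f)\<^sup>2"
    using assms by (simp add: refl_def F_norm inner_diff_right power2_eq_square)
  then have "x \<bullet> refl f x = 1" using wts_norm[OF x(1)] wt_inner_F[OF x assms] by simp
  then show False using Weyl_wt_inner_neq_1[OF w x(1)] by simp
qed

text \<open>For orthogonal unit vectors this is the quarter turn taking f to g and g to - f, the
  identity on their complement.\<close>

definition rot :: "real^8 \<Rightarrow> real^8 \<Rightarrow> real^8 \<Rightarrow> real^8" where
  "rot f g x = x - (x \<bullet> f) *\<^sub>R f - (x \<bullet> g) *\<^sub>R g + (x \<bullet> f) *\<^sub>R g - (x \<bullet> g) *\<^sub>R f"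

text \<open>The quarter turn removes both squares 1/4 from 3/2, so the same test weight gives the
  forbidden value 1.\<close>

lemma rot_notin_Weyl:
  assumes "f \<in> F" "g \<in> F"
  shows "rot f g \<notin> Weyl_E7"
proof
  assume w: "rot f g \<in> Weyl_E7"
  obtain x where x: "x \<in> wts" "x \<bullet> \<beta> = 0" using ex_wt_orthogonal_beta by auto
  have "x \<bullet> rot f g x = x \<bullet> x - (x \<bullet> f)\<^sup>2 - (x \<bullet> g)\<^sup>2"
    by (simp add: rot_def inner_diff_right inner_add_right power2_eq_square)
  then have "x \<bullet> rot f g x = 1"
    using wts_norm[OF x(1)] wt_inner_F[OF x assms(1)] wt_inner_F[OF x assms(2)] by simp
  then show False using Weyl_wt_inner_neq_1[OF w x(1)] by simp
qed

lemma refl_F_perm: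
  assumes "f \<in> F" "h \<in> F"
  shows "refl f h \<in> F"
proof -
  consider "h = f" | "h = - f" | "h \<bullet> f = 0" using F_cases[OF assms(2,1)] by blast
  then show ?thesis
    using assms F_uminus[OF assms(1)]
    by cases (simp_all add: refl_self refl_fixes linear_neg[OF linear_refl])
qed

text \<open>As a product of two reflections the quarter turn is visibly an isometry that permutes
  \<open>F\<close>.\<close>

lemma rot_eq:
  assumes "f \<in> F" "g \<in> F" "f \<bullet> g = 0"
  shows "rot f g = refl f \<circ> refl (f - g)"
proof
  fix x
  have gf: "g \<bullet> f = 0" using assms(3) by (simp add: inner_commute)
  have "(f - g) \<bullet> (f - g) = 2"
    by (rule E7_root_norm[OF F_diff_root[OF assms]])
  then have 1: "refl (f - g) x = x - (x \<bullet> f - x \<bullet> g) *\<^sub>R (f - g)"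
    by (simp add: refl_norm2 inner_diff_right)
  have "refl (f - g) x \<bullet> f = x \<bullet> g"
    unfolding 1 using gf F_norm[OF assms(1)] by (simp add: inner_diff_left)
  then have "refl f (refl (f - g) x) = refl (f - g) x - (x \<bullet> g + x \<bullet> g) *\<^sub>R f"
    using F_norm[OF assms(1)] by (simp add: refl_def[of f])
  then have "refl f (refl (f - g) x) = x - (x \<bullet> f - x \<bullet> g) *\<^sub>R (f - g) - (x \<bullet> g + x \<bullet> g) *\<^sub>R f"
    by (simp only: 1)
  moreover have "rot f g x = x - (x \<bullet> f - x \<bullet> g) *\<^sub>R (f - g) - (x \<bullet> g + x \<bullet> g) *\<^sub>R f"
    unfolding rot_def by (simp add: vec_eq_iff algebra_simps)
  ultimately show "rot f g x = (refl f \<circ> refl (f - g)) x" by simp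
qed

end

section \<open>The stabilizer of the root in M and its orbits on the cross polytope\<close>

locale stable_half_root = half_root +
  fixes M :: "(real^8 \<Rightarrow> real^8) set"
  assumes max_M: "max_abelian M"
    and stable: "\<And>m. m \<in> M \<Longrightarrow> m \<beta> = \<beta> \<or> m \<beta> = - \<beta>"
begin

lemmas ab_M = max_abelianD(1)[OF max_M]
lemmas M_D = abelian_subgroupD[OF ab_M]

lemma M_Weyl: "m \<in> M \<Longrightarrow> m \<in> Weyl_E7"
  using M_D(1) by blast

text \<open>Every element of \<open>M\<close> maps \<beta> to itself or its negative and so commutes
  with the reflection.\<close>

lemma refl_beta_in_M: "refl \<beta> \<in> M"
proof (rule max_abelian_involution[OF max_M refl_in_Weyl[OF beta_root] refl_refl])
  fix m x assume m: "m \<in> M"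
  have "refl (m \<beta>) = refl \<beta>" using stable[OF m] by (auto simp: refl_minus)
  then show "refl \<beta> (m x) = m (refl \<beta> x)"
    using refl_conj[OF Weyl_orthogonal[OF M_Weyl[OF m]], of \<beta> x] by simp
qed

definition B :: "(real^8 \<Rightarrow> real^8) set" where
  "B = {m \<in> M. m \<beta> = \<beta>}"

lemma B_isometries: "abelian_isometries B"
  unfolding B_def by (rule abelian_isometries_stabilizer[OF abelian_subgroup_isometries[OF ab_M]])

lemmas B_D = abelian_isometriesD[OF B_isometries]

lemma B_Weyl: "b \<in> B \<Longrightarrow> b \<in> Weyl_E7" and B_beta: "b \<in> B \<Longrightarrow> b \<beta> = \<beta>"
  and B_M: "b \<in> B \<Longrightarrow> b \<in> M"
  by (simp_all add: B_def M_Weyl)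

lemma B_theta: "b \<in> B \<Longrightarrow> b theta = theta"
  by (rule Weyl_theta[OF B_Weyl])

lemma B_orthogonal: "b \<in> B \<Longrightarrow> orthogonal_transformation b"
  by (simp add: B_Weyl Weyl_orthogonal)

lemma B_F: "b \<in> B \<Longrightarrow> f \<in> F \<Longrightarrow> b f \<in> F"
  by (simp add: F_perm B_Weyl B_beta)

text \<open>The reflection in \<beta> lies in \<open>M\<close>, so the orbit of \<beta> has two
  elements and the stabilizer has index 2.\<close>

lemma card_B: "card B = 64"
proof -
  have "(\<lambda>m. m \<beta>) ` M = {\<beta>, - \<beta>}"
  proof
    show "(\<lambda>m. m \<beta>) ` M \<subseteq> {\<beta>, - \<beta>}" using stable by auto
    have "id \<beta> \<in> (\<lambda>m. m \<beta>) ` M" using M_D(2) by (rule imageI)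
    moreover have "refl \<beta> \<beta> \<in> (\<lambda>m. m \<beta>) ` M" using refl_beta_in_M by (rule imageI)
    ultimately show "{\<beta>, - \<beta>} \<subseteq> (\<lambda>m. m \<beta>) ` M" by (simp add: refl_self)
  qed
  moreover have "card {\<beta>, - \<beta>} = 2" using E7_root_nonzero[OF beta_root] by simp
  ultimately show ?thesis
    using card_orbit_stabilizer[OF abelian_subgroup_isometries[OF ab_M], of \<beta>] max_abelianD(2)[OF max_M]
    by (simp add: B_def)
qed

lemma neg_beta_in_B: "neg_beta \<in> B"
proof -
  have "neg_beta \<in> M"
    unfolding neg_beta_def using neg_in_max_abelian[OF max_M] refl_beta_in_M by (rule M_D(3))
  then show ?thesis by (simp add: B_def neg_beta_beta)
qed

text \<open>\<open>B\<close> already has the largest order that the bound allows for a group acting on \<open>F\<close>.\<close>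
lemma in_B_if_commutes:
  assumes g: "linear g" "\<And>x y. g x \<bullet> g y = x \<bullet> y" "g theta = theta" "g \<beta> = \<beta>"
    and perm: "\<And>f. f \<in> F \<Longrightarrow> g f \<in> F" and com: "\<And>b x. b \<in> B \<Longrightarrow> g (b x) = b (g x)"
    and sq: "g \<circ> g \<in> B"
  shows "g \<in> B"
proof (rule ccontr)
  assume "g \<notin> B"
  let ?C = "B \<union> (\<circ>) g ` B"
  note adj = abelian_isometries_adjoin[OF B_isometries g(1,2) _ sq]
  have C: "abelian_isometries ?C" by (rule adj(1)[OF com])
  have card: "card ?C = 2 * card B" by (rule adj(2)[OF com \<open>g \<notin> B\<close>])
  have "card ?C * 2 ^ (card ({} :: (real^8) set) + 2) \<le> 256"
  proof (rule card_le_if_fixes[OF C])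
    fix c assume "c \<in> ?C"
    then obtain b where b: "b \<in> B" "c = b \<or> c = g \<circ> b" by blast
    show "c theta = theta" using b(2) g(3) B_theta[OF b(1)] by auto
    show "c \<beta> = \<beta>" using b(2) g(4) B_beta[OF b(1)] by auto
    show "c f \<in> F" if "f \<in> F" for f
      using b(2) B_F[OF b(1) that] perm[OF B_F[OF b(1) that]] by auto
  qed auto
  then show False using card card_B by simp
qed

lemma refl_F_fixes:
  assumes "f \<in> F"
  shows "refl f theta = theta" "refl f \<beta> = \<beta>"
  using F_theta[OF assms] F_beta[OF assms] by (auto intro!: refl_fixes simp: inner_commute)

definition orb :: "real^8 \<Rightarrow> (real^8) set" where
  "orb f = (\<lambda>b. b f) ` B"

lemma orb_F: "f \<in> F \<Longrightarrow> orb f \<subseteq> F"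
  by (auto simp: orb_def B_F)

lemma orb_self: "f \<in> orb f"
  unfolding orb_def using B_D(2) by (metis id_apply image_iff)

lemma orb_step: "b \<in> B \<Longrightarrow> x \<in> orb f \<Longrightarrow> b x \<in> orb f"
  unfolding orb_def using B_D(3) by (auto simp: image_iff) (metis comp_apply)

lemma orb_uminus: "f \<in> F \<Longrightarrow> x \<in> orb f \<Longrightarrow> - x \<in> orb f"
  using orb_step[OF neg_beta_in_B, of x f] orb_F[of f] neg_beta_F[of x] by auto

text \<open>A power of 2 that is at most 12 and at least 2, as orbits contain antipodes, is 2, 4 or
  8; the bound applied to a stabilizer excludes 8.\<close>

lemma card_orb:
  assumes f: "f \<in> F"
  shows "card (orb f) = 2 \<or> card (orb f) = 4"
proof -
  let ?C = "{b \<in> B. b f = f}"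
  have prod: "64 = card (orb f) * card ?C"
    using card_orbit_stabilizer[OF B_isometries, of f] by (simp add: orb_def card_B)
  have "card (orb f) \<le> 12" using card_mono[OF finite_F orb_F[OF f]] by (simp add: card_F)
  moreover have "2 ^ 6 = card (orb f) * card ?C" using prod by simp
  then have "card (orb f) dvd 2 ^ 6" by (rule dvdI)
  then obtain k where k: "card (orb f) = 2 ^ k"
    using divides_primepow_nat[of 2 "card (orb f)" 6] two_is_prime_nat by blast
  moreover have "k < 4"
  proof (rule ccontr)
    assume "\<not> k < 4"
    then have "(2::nat) ^ 4 \<le> 2 ^ k" by (intro power_increasing) auto
    then show False using calculation by simp
  qed
  moreover have "{f, - f} \<subseteq> orb f" using orb_self orb_uminus[OF f orb_self] by simp
  then have "card {f, - f} \<le> card (orb f)"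
    using finite_subset[OF orb_F[OF f] finite_F] by (intro card_mono)
  then have "2 \<le> card (orb f)" using F_neq_uminus[OF f] by simp
  moreover have "k \<noteq> 3"
  proof
    assume "k = 3"
    then have 8: "card (orb f) = 8" "card ?C = 8" using k prod by simp_all
    \<comment> \<open>The stabilizer of order 8 fixes the whole orbit, since \<open>B\<close> is
      abelian, and the orbit contains four orthogonal vectors; but 8 * 2^(4+2) exceeds 256.\<close>
    obtain V where V: "V \<subseteq> orb f" "card V = 4" "pairwise orthogonal V"
      using orthogonal_subset[OF orb_F[OF f], of 4] 8 by auto
    have "card ?C * 2 ^ (card V + 2) \<le> 256"
    proof (rule card_le_if_fixes)
      show "abelian_isometries ?C" by (rule abelian_isometries_stabilizer[OF B_isometries])
      show "c theta = theta" if "c \<in> ?C" for c using that B_theta[of c] by simp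
      show "c \<beta> = \<beta>" if "c \<in> ?C" for c using that B_beta[of c] by simp
      show "c h \<in> F" if "c \<in> ?C" "h \<in> F" for c h using that B_F[of c h] by simp
      show "V \<subseteq> F" using V(1) orb_F[OF f] by blast
      show "c v = v" if "c \<in> ?C" "v \<in> V" for c v
      proof -
        obtain b where "b \<in> B" "v = b f" using V(1) \<open>v \<in> V\<close> by (auto simp: orb_def)
        then show ?thesis using B_D(4)[of c b f] that(1) by simp
      qed
    qed (rule V(3))
    then show False by (simp add: 8 V(2))
  qed
  ultimately have "k = 1 \<or> k = 2" by (cases k) auto
  then show ?thesis using k by auto
qed

text \<open>If the orbit were an antipodal pair, the reflection in \<open>f\<close> would commute
  with \<open>B\<close> and hence lie in \<open>B\<close>, although it is not in the Weyl
  group.\<close>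

lemma card_orb_neq_2:
  assumes f: "f \<in> F"
  shows "card (orb f) \<noteq> 2"
proof
  assume 2: "card (orb f) = 2"
  have "{f, - f} \<subseteq> orb f" using orb_self orb_uminus[OF f orb_self] by simp
  then have orb: "orb f = {f, - f}"
    using 2 F_neq_uminus[OF f] finite_subset[OF orb_F[OF f] finite_F]
    by (intro card_seteq[symmetric]) auto
  have "refl f \<in> B"
  proof (rule in_B_if_commutes[OF linear_refl refl_inner refl_F_fixes[OF f]])
    show "refl f h \<in> F" if "h \<in> F" for h using refl_F_perm[OF f that] .
    show "refl f (b x) = b (refl f x)" if b: "b \<in> B" for b x
    proof -
      have "b f = f \<or> b f = - f" using orb orb_step[OF b orb_self] by blast
      then have "refl (b f) = refl f" by (auto simp: refl_minus)
      then show ?thesis using refl_conj[OF B_orthogonal[OF b], of f x] by simp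
    qed
    have "refl f \<circ> refl f = id" by (simp add: fun_eq_iff)
    then show "refl f \<circ> refl f \<in> B" using B_D(2) by argo
  qed
  then show False using refl_F_notin_Weyl[OF f] B_Weyl by blast
qed

text \<open>The abelian group acts on an orbit of size 4 as a cyclic group or as a Klein four-group.
  The first would force the quarter turn into \<open>B\<close>; the second preserves f - g and f + g
  up to sign, so their reflections commute with \<open>B\<close>.\<close>

lemma partner:
  assumes f: "f \<in> F"
  shows "\<exists>g\<in>F. f \<bullet> g = 0 \<and> orb f = {f, - f, g, - g} \<and> refl (f - g) \<in> B \<and> refl (f + g) \<in> B"
proof -
  have 4: "card (orb f) = 4" using card_orb[OF f] card_orb_neq_2[OF f] by blast
  have ff: "f \<in> orb f" "- f \<in> orb f" using orb_self orb_uminus[OF f orb_self] by auto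
  have fin: "finite (orb f)" using orb_F[OF f] finite_F by (rule finite_subset)
  have "\<not> orb f \<subseteq> {f, - f}"
  proof
    assume "orb f \<subseteq> {f, - f}"
    then have "card (orb f) \<le> card {f, - f}" by (intro card_mono) auto
    also have "\<dots> \<le> 2" by (simp add: card_insert_if)
    finally show False using 4 by simp
  qed
  then obtain g where g: "g \<in> orb f" "g \<noteq> f" "g \<noteq> - f" by auto
  have gF: "g \<in> F" using g(1) orb_F[OF f] by blast
  have "f \<noteq> - g" using g(3) by auto
  then have fg: "f \<bullet> g = 0" using F_cases[OF f gF] g by auto
  then have gf: "g \<bullet> f = 0" by (simp add: inner_commute)
  have "{f, - f, g, - g} \<subseteq> orb f" using ff g(1) orb_uminus[OF f g(1)] by auto
  moreover have "card {f, - f, g, - g} = 4"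
    using g F_neq_uminus[OF f] F_neq_uminus[OF gF] \<open>f \<noteq> - g\<close> by auto
  ultimately have orb: "orb f = {f, - f, g, - g}"
    using 4 fin by (intro card_seteq[symmetric]) auto
  \<comment> \<open>The action of any b in \<open>B\<close> on the plane is determined by
    \<open>b f\<close>, because \<open>b g = a (b f)\<close>. The two possible values of
    \<open>a g\<close> separate the Klein case from the cyclic one.\<close>
  obtain a where a: "a \<in> B" "g = a f" using g(1) by (auto simp: orb_def)
  note lin = linear_neg[OF B_D(6)]
  have "a g \<bullet> g = 0" using B_D(7)[OF a(1), of g f] gf a(2) by simp
  moreover have "a g \<in> {f, - f, g, - g}" using orb_step[OF a(1) g(1)] orb by simp
  ultimately have ag: "a g = f \<or> a g = - f" using F_norm[OF gF] by auto
  have "a g \<noteq> - f"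
  proof
    assume ag: "a g = - f"
    have bfg: "(b f = f \<and> b g = g) \<or> (b f = - f \<and> b g = - g) \<or> (b f = g \<and> b g = - f) \<or> (b f = - g \<and> b g = f)"
      if b: "b \<in> B" for b
    proof -
      have "b g = a (b f)" using B_D(4)[OF b a(1), of f] a(2) by simp
      moreover have "b f \<in> {f, - f, g, - g}" using orb_step[OF b orb_self, of f] orb by simp
      ultimately show ?thesis using a ag lin[OF a(1)] by auto
    qed
    \<comment> \<open>The half turn is the square of the quarter turn and must be shown to lie in
      \<open>B\<close> first, as adjoining an element requires its square in
      \<open>B\<close>.\<close>
    let ?s = "refl f \<circ> refl g"
    have swap: "refl f (refl g x) = refl g (refl f x)" for x
      using refl_conj[OF orthogonal_refl, of g f x] refl_fixes[OF fg] by simp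
    have sB: "?s \<in> B"
    proof (rule in_B_if_commutes)
      show "linear ?s" by (intro linear_compose linear_refl)
      show "?s h \<in> F" if "h \<in> F" for h using that refl_F_perm f gF by simp
      show "?s (b x) = b (?s x)" if b: "b \<in> B" for b x
      proof -
        have "b (?s x) = refl (b f) (refl (b g) (b x))"
          by (simp add: refl_conj[OF B_orthogonal[OF b]])
        also have "\<dots> = ?s (b x)" using bfg[OF b] by (auto simp: refl_minus swap)
        finally show ?thesis by simp
      qed
      have "?s \<circ> ?s = id" by (simp add: fun_eq_iff swap)
      then show "?s \<circ> ?s \<in> B" using B_D(2) by argo
    qed (simp_all add: refl_inner refl_F_fixes f gF)
    let ?r = "rot f g"
    note r = rot_eq[OF f gF fg]
    have fgW: "refl (f - g) \<in> Weyl_E7" by (intro refl_in_Weyl F_diff_root f gF fg)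
    have beta_fg: "refl (f - g) \<beta> = \<beta>"
      using F_beta[OF f] F_beta[OF gF] by (intro refl_fixes) (simp add: inner_diff_right inner_commute)
    have rf: "?r f = g" "?r g = - f"
      by (simp_all add: rot_def fg gf F_norm f gF)
    have "?r \<in> B"
    proof (rule in_B_if_commutes)
      show "linear ?r" unfolding r by (intro linear_compose linear_refl)
      show "?r x \<bullet> ?r y = x \<bullet> y" for x y unfolding r by (simp add: refl_inner)
      show "?r theta = theta" "?r \<beta> = \<beta>"
        unfolding r using Weyl_theta[OF fgW] beta_fg by (simp_all add: refl_F_fixes f)
      show "?r h \<in> F" if "h \<in> F" for h
        unfolding r using F_perm[OF fgW beta_fg that] refl_F_perm[OF f] by simp
      show "?r (b x) = b (?r x)" if b: "b \<in> B" for b x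
      proof -
        have ip: "x \<bullet> f = b x \<bullet> b f" "x \<bullet> g = b x \<bullet> b g" by (simp_all add: B_D(7)[OF b])
        have "b (?r x) = rot (b f) (b g) (b x)"
          unfolding rot_def by (simp add: linear_diff linear_add linear_cmul B_D(6)[OF b] B_D(7)[OF b])
        also have "\<dots> = ?r (b x)"
          using bfg[OF b] by (elim disjE conjE) (simp_all add: rot_def algebra_simps)
        finally show ?thesis by simp
      qed
      have "?r (?r x) = ?s x" for x
      proof -
        have "?r (?r x) = ?r x - (?r x \<bullet> f) *\<^sub>R f - (?r x \<bullet> g) *\<^sub>R g + (?r x \<bullet> f) *\<^sub>R g - (?r x \<bullet> g) *\<^sub>R f"
          by (simp add: rot_def[of f g "?r x"])
        moreover have "?r x \<bullet> f = - (x \<bullet> g)" "?r x \<bullet> g = x \<bullet> f"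
          by (simp_all add: rot_def inner_diff_left inner_add_left fg gf F_norm f gF)
        moreover have "?s x = x - (x \<bullet> f + x \<bullet> f) *\<^sub>R f - (x \<bullet> g + x \<bullet> g) *\<^sub>R g"
          using gf by (simp add: refl_def F_norm f gF inner_diff_left)
        ultimately show ?thesis
          by (simp only:) (simp add: rot_def[of f g x] vec_eq_iff algebra_simps)
      qed
      then have "?r \<circ> ?r = ?s" by (simp add: fun_eq_iff)
      then show "?r \<circ> ?r \<in> B" using sB by argo
    qed
    then show False using rot_notin_Weyl[OF f gF] B_Weyl by blast
  qed
  with ag have ag: "a g = f" by blast
  have bfg: "(b f = f \<and> b g = g) \<or> (b f = - f \<and> b g = - g) \<or> (b f = g \<and> b g = f) \<or> (b f = - g \<and> b g = - f)"
    if b: "b \<in> B" for b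
  proof -
    have "b g = a (b f)" using B_D(4)[OF b a(1), of f] a(2) by simp
    moreover have "b f \<in> {f, - f, g, - g}" using orb_step[OF b orb_self, of f] orb by simp
    ultimately show ?thesis using a ag lin[OF a(1)] by auto
  qed
  \<comment> \<open>For roots orthogonal to \<beta> the reflection permutes \<open>F\<close>, so
    commuting with \<open>B\<close> is all that remains to be checked.\<close>
  have reflB: "refl c \<in> B" if c: "c \<in> E7_roots" "c \<bullet> \<beta> = 0" and bc: "\<And>b. b \<in> B \<Longrightarrow> b c = c \<or> b c = - c" for c
  proof (rule in_B_if_commutes[OF linear_refl refl_inner])
    note cW = refl_in_Weyl[OF c(1)]
    show "refl c theta = theta" by (rule Weyl_theta[OF cW])
    show cb: "refl c \<beta> = \<beta>" using c(2) by (simp add: refl_fixes inner_commute)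
    show "refl c h \<in> F" if "h \<in> F" for h by (rule F_perm[OF cW cb that])
    show "refl c (b x) = b (refl c x)" if b: "b \<in> B" for b x
    proof -
      have "refl (b c) = refl c" using bc[OF b] by (auto simp: refl_minus)
      then show ?thesis using refl_conj[OF B_orthogonal[OF b], of c x] by simp
    qed
    have "refl c \<circ> refl c = id" by (simp add: fun_eq_iff)
    then show "refl c \<circ> refl c \<in> B" using B_D(2) by argo
  qed
  have "refl (f - g) \<in> B"
  proof (rule reflB)
    show "f - g \<in> E7_roots" by (rule F_diff_root[OF f gF fg])
    show "(f - g) \<bullet> \<beta> = 0" by (simp add: inner_diff_left F_beta f gF)
    show "b (f - g) = f - g \<or> b (f - g) = - (f - g)" if "b \<in> B" for b
      using bfg[OF that] by (auto simp: linear_diff[OF B_D(6)[OF that]])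
  qed
  moreover have "refl (f + g) \<in> B"
  proof (rule reflB)
    show "f + g \<in> E7_roots" using F_diff_root[OF f F_uminus[OF gF]] fg by simp
    show "(f + g) \<bullet> \<beta> = 0" by (simp add: inner_add_left F_beta f gF)
    show "b (f + g) = f + g \<or> b (f + g) = - (f + g)" if "b \<in> B" for b
      using bfg[OF that] by (auto simp: linear_add[OF B_D(6)[OF that]])
  qed
  ultimately show ?thesis using gF fg orb by blast
qed

text \<open>Apply the inverse of the element that moves \<open>h\<close> to \<open>y\<close>: the
  inner product becomes that of \<open>h\<close> with a point of the orbit of
  \<open>f\<close>.\<close>

lemma orb_orthogonal:
  assumes "f \<in> F" "\<And>x. x \<in> orb f \<Longrightarrow> h \<bullet> x = 0" "y \<in> orb h"
  shows "y \<bullet> f = 0"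
proof -
  obtain b where b: "b \<in> B" "y = b h" using assms(3) by (auto simp: orb_def)
  obtain c where c: "c \<in> B" "\<And>x. c (b x) = x" using B_D(5)[OF b(1)] by auto
  have "y \<bullet> f = h \<bullet> c f" using B_D(7)[OF c(1), of y f] by (simp add: b(2) c(2))
  then show ?thesis using assms(2) orb_step[OF c(1) orb_self, of f] by simp
qed

text \<open>The cross polytope splits into three squares in orthogonal planes, one orbit each; the
  indices 2k and 2k+1 name the two axes of a square.\<close>

lemma ex_matching:
  "\<exists>h::nat \<Rightarrow> real^8. (\<forall>i<6. h i \<in> F) \<and> (\<forall>i<6. \<forall>j<6. i \<noteq> j \<longrightarrow> h i \<bullet> h j = 0) \<and>
    (\<forall>k<3. refl (h (2*k) - h (2*k+1)) \<in> M \<and> refl (h (2*k) + h (2*k+1)) \<in> M)"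
proof -
  \<comment> \<open>At most four vectors have been chosen when a new one is needed, and these
    exclude at most 8 of the 12 vertices.\<close>
  have ex: "\<exists>u\<in>F. \<forall>v\<in>V. u \<bullet> v = 0" if "V \<subseteq> F" "card V \<le> 4" for V
    using ex_orthogonal[OF order.refl that(1)] that(2) by (simp add: card_F)
  obtain f0 where f0: "f0 \<in> F" using ex[of "{}"] by auto
  obtain f1 where f1: "f1 \<in> F" "f0 \<bullet> f1 = 0" "orb f0 = {f0, - f0, f1, - f1}"
    "refl (f0 - f1) \<in> B" "refl (f0 + f1) \<in> B" using partner[OF f0] by blast
  have "card {f0, f1} \<le> 4" by (simp add: card_insert_if)
  then obtain f2 where f2: "f2 \<in> F" "f2 \<bullet> f0 = 0" "f2 \<bullet> f1 = 0" using ex[of "{f0, f1}"] f0 f1(1) by auto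
  obtain f3 where f3: "f3 \<in> F" "f2 \<bullet> f3 = 0" "orb f2 = {f2, - f2, f3, - f3}"
    "refl (f2 - f3) \<in> B" "refl (f2 + f3) \<in> B" using partner[OF f2(1)] by blast
  have o1: "orb f1 \<subseteq> orb f0"
  proof
    fix x assume "x \<in> orb f1"
    then obtain b where "b \<in> B" "x = b f1" by (auto simp: orb_def)
    then show "x \<in> orb f0" using orb_step[of b f1 f0] f1(3) by simp
  qed
  have 2: "f2 \<bullet> x = 0" if "x \<in> orb f0" for x using that f2 f1(3) by auto
  \<comment> \<open>The partner of \<open>f2\<close> lies in the orbit of \<open>f2\<close> and
    therefore inherits orthogonality to the first square.\<close>
  have 3: "f3 \<bullet> f0 = 0" "f3 \<bullet> f1 = 0"
    using orb_orthogonal[OF f0 2, of f3] orb_orthogonal[OF f1(1) 2, of f3] o1 f3(3) by auto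
  have "card {f0, f1, f2, f3} \<le> 4" by (simp add: card_insert_if)
  then obtain f4 where f4: "f4 \<in> F" "f4 \<bullet> f0 = 0" "f4 \<bullet> f1 = 0" "f4 \<bullet> f2 = 0" "f4 \<bullet> f3 = 0"
    using ex[of "{f0, f1, f2, f3}"] f0 f1(1) f2(1) f3(1) by auto
  obtain f5 where f5: "f5 \<in> F" "f4 \<bullet> f5 = 0" "orb f4 = {f4, - f4, f5, - f5}"
    "refl (f4 - f5) \<in> B" "refl (f4 + f5) \<in> B" using partner[OF f4(1)] by blast
  have o3: "orb f3 \<subseteq> orb f2"
  proof
    fix x assume "x \<in> orb f3"
    then obtain b where "b \<in> B" "x = b f3" by (auto simp: orb_def)
    then show "x \<in> orb f2" using orb_step[of b f3 f2] f3(3) by simp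
  qed
  have 4: "f4 \<bullet> x = 0" if "x \<in> orb f0 \<union> orb f2" for x using that f4 f1(3) f3(3) by auto
  have 5: "f5 \<bullet> f0 = 0" "f5 \<bullet> f1 = 0" "f5 \<bullet> f2 = 0" "f5 \<bullet> f3 = 0"
    using orb_orthogonal[OF f0 4, of f5] orb_orthogonal[OF f1(1) 4, of f5]
      orb_orthogonal[OF f2(1) 4, of f5] orb_orthogonal[OF f3(1) 4, of f5] o1 o3 f5(3) by auto
  have ips: "f0 \<bullet> f2 = 0" "f0 \<bullet> f3 = 0" "f0 \<bullet> f4 = 0" "f0 \<bullet> f5 = 0" "f1 \<bullet> f2 = 0" "f1 \<bullet> f3 = 0"
    "f1 \<bullet> f4 = 0" "f1 \<bullet> f5 = 0" "f2 \<bullet> f4 = 0" "f2 \<bullet> f5 = 0" "f3 \<bullet> f4 = 0" "f3 \<bullet> f5 = 0"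
    by (subst inner_commute, fact)+
  let ?l = "[f0, f1, f2, f3, f4, f5]"
  have six: "i = 0 \<or> i = 1 \<or> i = 2 \<or> i = 3 \<or> i = 4 \<or> i = 5" if "i < 6" for i :: nat
    using that by linarith
  have "?l ! i \<in> F" if "i < 6" for i
    using six[OF that] f0 f1(1) f2(1) f3(1) f4(1) f5(1) by (elim disjE) simp_all
  moreover have lt: "?l ! i \<bullet> ?l ! j = 0" if "j < 6" "i < j" for i j
    using six[OF that(1)] six[OF less_trans[OF that(2,1)]] that(2) ips f1(2) f3(2) f5(2)
    by (elim disjE) simp_all
  moreover have "?l ! i \<bullet> ?l ! j = 0" if "i < 6" "j < 6" "i \<noteq> j" for i j
    using lt[of j i] lt[of i j] that by (cases "i < j") (simp_all add: inner_commute)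
  moreover have "refl (?l ! (2*k) - ?l ! (2*k+1)) \<in> M \<and> refl (?l ! (2*k) + ?l ! (2*k+1)) \<in> M"
    if "k < 3" for k
  proof -
    have "k = 0 \<or> k = 1 \<or> k = 2" using that by linarith
    then show ?thesis using f1(4,5) f3(4,5) f5(4,5) B_M by (elim disjE) simp_all
  qed
  ultimately show ?thesis by (intro exI[of _ "\<lambda>i. ?l ! i"]) blast
qed

end

context half_root
begin

text \<open>Signs are left open because the stabilizer of \<beta> changes evenly many signs on the
  cross polytope, so the sign of a sixth vector is not free. The reflections in f - g and f + g,
  taken together, do not see the signs.\<close>

lemma Weyl_transitive_orthogonal_sequences:
  fixes h g :: "nat \<Rightarrow> real^8"
  assumes h: "\<And>i. i < n \<Longrightarrow> h i \<in> F" "\<And>i j. i < n \<Longrightarrow> j < n \<Longrightarrow> i \<noteq> j \<Longrightarrow> h i \<bullet> h j = 0"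
    and g: "\<And>i. i < n \<Longrightarrow> g i \<in> F" "\<And>i j. i < n \<Longrightarrow> j < n \<Longrightarrow> i \<noteq> j \<Longrightarrow> g i \<bullet> g j = 0"
  shows "\<exists>w\<in>Weyl_E7. w \<beta> = \<beta> \<and> (\<forall>i<n. w (h i) = g i \<or> w (h i) = - g i)"
  using assms
proof (induction n)
  case 0
  show ?case by (intro bexI[of _ id]) (simp_all add: Weyl_E7.id)
next
  case (Suc n)
  have "\<exists>w\<in>Weyl_E7. w \<beta> = \<beta> \<and> (\<forall>i<n. w (h i) = g i \<or> w (h i) = - g i)"
    by (rule Suc.IH) (use Suc.prems in auto)
  then obtain w where w: "w \<in> Weyl_E7" "w \<beta> = \<beta>" "\<And>i. i < n \<Longrightarrow> w (h i) = g i \<or> w (h i) = - g i"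
    by blast
  define k where "k = w (h n)"
  have kF: "k \<in> F" using F_perm[OF w(1,2)] Suc.prems(1)[of n] by (simp add: k_def)
  have gF: "g n \<in> F" using Suc.prems(3)[of n] by simp
  have kg: "k \<bullet> g i = 0" if "i < n" for i
  proof -
    have "k \<bullet> w (h i) = 0"
      using Weyl_inner[OF w(1), of "h n" "h i"] Suc.prems(2)[of n i] that by (simp add: k_def)
    then show ?thesis using w(3)[OF that] by auto
  qed
  show ?case
  proof (cases "k = g n \<or> k = - g n")
    case True
    then show ?thesis using w by (intro bexI[of _ w]) (auto simp: less_Suc_eq k_def)
  next
    case False
    then have 0: "k \<bullet> g n = 0" using F_cases[OF kF gF] by blast
    \<comment> \<open>This reflection exchanges \<open>k\<close> and \<open>g n\<close> and fixes
      the vectors already placed, which are orthogonal to both.\<close>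
    let ?r = "refl (k - g n)"
    have rW: "?r \<in> Weyl_E7" by (intro refl_in_Weyl F_diff_root kF gF 0)
    have "(k - g n) \<bullet> (k - g n) = 2" by (rule E7_root_norm[OF F_diff_root[OF kF gF 0]])
    then have "?r k = g n"
      using 0 F_norm[OF kF] by (simp add: refl_norm2 inner_diff_right)
    moreover have "?r (g i) = g i" if "i < n" for i
      using kg[OF that] Suc.prems(4)[of i n] that
      by (intro refl_fixes) (simp add: inner_diff_right inner_commute[of "g i" k])
    moreover have "?r \<beta> = \<beta>"
      using F_beta[OF kF] F_beta[OF gF] by (intro refl_fixes) (simp add: inner_diff_right inner_commute)
    moreover have "?r (w (h i)) = g i \<or> ?r (w (h i)) = - g i" if "i < n" for i
      using w(3)[OF that] calculation(2)[OF that] linear_neg[OF linear_refl, of "k - g n" "g i"]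
      by auto
    ultimately show ?thesis
      using w(2) Weyl_comp[OF rW w(1)]
      by (intro bexI[of _ "?r \<circ> w"]) (auto simp: less_Suc_eq k_def)
  qed
qed

end

section \<open>Conjugacy of the maximal abelian subgroups\<close>

lemma conj_group_comp:
  assumes "v \<in> Weyl_E7" "w \<in> Weyl_E7"
  shows "conj_group v (conj_group w M) = conj_group (v \<circ> w) M"
proof -
  have "inv\<^bsub>WE7\<^esub> (v \<circ> w) = (inv\<^bsub>WE7\<^esub> w) \<circ> (inv\<^bsub>WE7\<^esub> v)"
    using group.inv_mult_group[OF group_WE7, of v w] assms by simp
  then show ?thesis by (simp add: conj_group_def image_image comp_assoc)
qed

lemma conj_group_inv:
  assumes "w \<in> Weyl_E7"
  shows "conj_group (inv\<^bsub>WE7\<^esub> w) (conj_group w M) = M"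
proof -
  have "(inv\<^bsub>WE7\<^esub> w) \<circ> w = id" using inv_WE7(2)[OF assms] by (simp add: fun_eq_iff)
  moreover have "conj_group id M = M"
  proof -
    have "inv\<^bsub>WE7\<^esub> id = id" using monoid.inv_one[OF group.is_monoid[OF group_WE7]] by simp
    then show ?thesis by (simp add: conj_group_def)
  qed
  ultimately show ?thesis by (simp only: conj_group_comp[OF inv_WE7(1)[OF assms] assms])
qed

lemma conj_group_refl:
  assumes "w \<in> Weyl_E7" "refl a \<in> M"
  shows "refl (w a) \<in> conj_group w M"
proof -
  have eq: "w \<circ> refl a \<circ> (inv\<^bsub>WE7\<^esub> w) = refl (w a)"
    using assms(1) by (simp add: fun_eq_iff refl_conj[OF Weyl_orthogonal] inv_WE7)
  have "w \<circ> refl a \<circ> (inv\<^bsub>WE7\<^esub> w) \<in> conj_group w M"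
    unfolding conj_group_def using assms(2) by (rule imageI)
  then show ?thesis by (simp only: eq)
qed

lemma frame_comp:
  assumes "frame \<beta>" "g \<in> Weyl_E7"
  shows "frame (g \<circ> \<beta>)"
  using assms by (simp add: frame_def Weyl_roots Weyl_inner)

lemma flip_comp:
  assumes "g \<in> Weyl_E7"
  shows "flip (g \<circ> \<beta>) J (g x) = g (flip \<beta> J x)"
  using assms
  by (simp add: flip_def linear_diff linear_sum linear_cmul Weyl_linear Weyl_inner o_def)

lemma conj_frame_group:
  assumes g: "g \<in> Weyl_E7"
  shows "conj_group g (frame_group \<beta>) = frame_group (g \<circ> \<beta>)"
proof -
  have "g \<circ> flip \<beta> J \<circ> (inv\<^bsub>WE7\<^esub> g) = flip (g \<circ> \<beta>) J" for J
    using flip_comp[OF g, of \<beta> J] by (simp add: fun_eq_iff inv_WE7[OF g]) (metis inv_WE7(3)[OF g])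
  then show ?thesis by (simp add: conj_group_def frame_group_def image_image)
qed

lemma frame_group_subset:
  assumes fr: "frame \<beta>" and M: "abelian_subgroup M" and r: "\<And>i. i < 7 \<Longrightarrow> refl (\<beta> i) \<in> M"
  shows "frame_group \<beta> \<subseteq> M"
proof -
  note D = abelian_subgroupD[OF M]
  have "flip \<beta> J \<in> M" if "J \<subseteq> {..<7}" for J
    using finite_subset[OF that finite_lessThan] that
  proof (induction J rule: finite_induct)
    case empty
    then show ?case using D(2) flip_empty[OF fr] by argo
  next
    case (insert i J)
    then have "flip \<beta> (insert i J) = refl (\<beta> i) \<circ> flip \<beta> J" by (intro flip_insert fr) auto
    moreover have "refl (\<beta> i) \<circ> flip \<beta> J \<in> M" using insert by (intro D(3) r) auto
    ultimately show ?case by (simp only:)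
  qed
  then show ?thesis by (auto simp: frame_group_def)
qed

lemma max_abelian_eq_frame_group:
  assumes fr: "frame \<beta>" and M: "max_abelian M" and r: "\<And>i. i < 7 \<Longrightarrow> refl (\<beta> i) \<in> M"
  shows "M = frame_group \<beta>"
proof -
  have "frame_group \<beta> \<subseteq> M" by (rule frame_group_subset[OF fr max_abelianD(1)[OF M] r])
  then show ?thesis
    using abelian_subgroupD(6)[OF max_abelianD(1)[OF M]] card_frame_group[OF fr] max_abelianD(2)[OF M]
    by (metis card_subset_eq)
qed

lemma ex_of_nat_8: "\<exists>k<8. i = (of_nat k :: 8)"
proof (cases i)
  case (of_int z)
  then have "nat z < 8" "i = of_nat (nat z)" by simp_all
  then show ?thesis by blast
qed

lemma all_8: "(\<forall>i::8. P i) \<longleftrightarrow> P 0 \<and> P 1 \<and> P 2 \<and> P 3 \<and> P 4 \<and> P 5 \<and> P 6 \<and> P 7"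
proof
  assume *: "P 0 \<and> P 1 \<and> P 2 \<and> P 3 \<and> P 4 \<and> P 5 \<and> P 6 \<and> P 7"
  show "\<forall>i. P i"
  proof
    fix i :: 8
    obtain k where k: "k < 8" "i = of_nat k" using ex_of_nat_8 by blast
    then have "k = 0 \<or> k = 1 \<or> k = 2 \<or> k = 3 \<or> k = 4 \<or> k = 5 \<or> k = 6 \<or> k = 7" by linarith
    then show "P i" using * k(2) by (elim disjE) simp_all
  qed
qed blast

lemma card_blk: "i < 7 \<Longrightarrow> card (of_nat ` set (blk i) :: 8 set) = 4"
  by (erule less_7_cases) (simp_all add: blk_def)

interpretation fano: half_root "of_nat ` set (blk 0)"
  by unfold_locales (simp add: card_blk)

lemma fano_beta: "fano.\<beta> = fano_root 0"
  by (simp add: fano.\<beta>_def fano_root_def)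

section \<open>Matching the explicit frame with the cross polytope\<close>

text \<open>The lines through the point 0 are {0, 1, 3}, {0, 4, 5} and {0, 2, 6}. On each, half the
  sum and half the difference of the other two roots are the two axes of a square of the cross
  polytope at \<open>fano_root 0\<close>.\<close>

definition fano_vec :: "nat \<Rightarrow> real^8" where
  "fano_vec i = (1/2) *\<^sub>R
    ([fano_root 1 + fano_root 3, fano_root 1 - fano_root 3, fano_root 4 + fano_root 5,
      fano_root 4 - fano_root 5, fano_root 2 + fano_root 6, fano_root 2 - fano_root 6] ! i)"

lemma less_6_cases: "(i::nat) < 6 \<Longrightarrow> i = 0 \<or> i = 1 \<or> i = 2 \<or> i = 3 \<or> i = 4 \<or> i = 5"
  by linarith

lemma fano_vec_F:
  assumes "i < 6"
  shows "fano_vec i \<in> fano.F"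
proof -
  \<comment> \<open>Half the sum of the three roots on a line, with any signs, is a weight; these
    are the resulting pairs for the three lines through 0 with \<open>fano_root 0\<close> taken
    positively.\<close>
  let ?l = "[weight {6, 7}, - weight {1, 2}, weight {3, 7}, - weight {1, 4}, weight {5, 7}, - weight {2, 4}]"
  have "fano_vec i + (1/2) *\<^sub>R fano_root 0 = ?l ! i"
    using less_6_cases[OF assms]
    by (elim disjE) (simp_all add: fano_vec_def fano_root_def blk_def weight_def root_of_def vec_eq_iff all_8)
  then have eq: "fano_vec i = ?l ! i - (1/2) *\<^sub>R fano_root 0" by (simp add: eq_diff_eq)
  have "?l ! i \<in> wts"
    using less_6_cases[OF assms] by (elim disjE) (simp_all add: weight_in_wts minus_in_wts)
  moreover have "?l ! i \<bullet> fano_root 0 = 1"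
  proof -
    have "fano_vec i \<bullet> fano_root 0 = 0"
      using less_6_cases[OF assms]
      by (elim disjE) (simp_all add: fano_vec_def inner_add_left inner_diff_left frame_inner[OF frame_fano_root])
    then show ?thesis
      unfolding eq by (simp add: inner_diff_left frame_inner[OF frame_fano_root])
  qed
  ultimately show ?thesis unfolding fano.F_def fano_beta using eq by blast
qed

lemma fano_vec_orthogonal:
  assumes "i < 6" "j < 6" "i \<noteq> j"
  shows "fano_vec i \<bullet> fano_vec j = 0"
  using less_6_cases[OF assms(1)] less_6_cases[OF assms(2)] assms(3)
  by (elim disjE) (simp_all add: fano_vec_def inner_add_left inner_diff_left inner_add_right
      inner_diff_right frame_inner[OF frame_fano_root])

lemma half_sum_diff:
  fixes a b :: "real^8"
  shows "(1/2) *\<^sub>R (a + b) + (1/2) *\<^sub>R (a - b) = a" "(1/2) *\<^sub>R (a + b) - (1/2) *\<^sub>R (a - b) = b"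
  by (simp_all add: vec_eq_iff field_simps)

lemma fano_roots_from_vecs:
  assumes "1 \<le> j" "j < 7"
  shows "\<exists>k<3. fano_root j = fano_vec (2*k) - fano_vec (2*k+1) \<or> fano_root j = fano_vec (2*k) + fano_vec (2*k+1)"
proof -
  have "j = 1 \<or> j = 3 \<or> j = 4 \<or> j = 5 \<or> j = 2 \<or> j = 6" using assms by linarith
  moreover have "fano_root 1 = fano_vec 0 + fano_vec 1" "fano_root 3 = fano_vec 0 - fano_vec 1"
    "fano_root 4 = fano_vec 2 + fano_vec 3" "fano_root 5 = fano_vec 2 - fano_vec 3"
    "fano_root 2 = fano_vec 4 + fano_vec 5" "fano_root 6 = fano_vec 4 - fano_vec 5"
    by (simp_all add: fano_vec_def half_sum_diff)
  ultimately show ?thesis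
    using exI[of "\<lambda>k. k < 3 \<and> (fano_root j = fano_vec (2*k) - fano_vec (2*k+1) \<or> fano_root j = fano_vec (2*k) + fano_vec (2*k+1))" 0]
      exI[of "\<lambda>k. k < 3 \<and> (fano_root j = fano_vec (2*k) - fano_vec (2*k+1) \<or> fano_root j = fano_vec (2*k) + fano_vec (2*k+1))" 1]
      exI[of "\<lambda>k. k < 3 \<and> (fano_root j = fano_vec (2*k) - fano_vec (2*k+1) \<or> fano_root j = fano_vec (2*k) + fano_vec (2*k+1))" 2]
    by (elim disjE) simp_all
qed

text \<open>Two conjugations suffice: one carries the stable root to \<open>fano_root 0\<close>, the
  other carries the matching to the vectors \<open>fano_vec\<close> up to sign. Then all seven
  reflections of the explicit frame lie in the conjugated group, and both groups have order
  128.\<close>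

theorem max_abelian_conj_fano:
  assumes M: "max_abelian M"
  shows "\<exists>g\<in>Weyl_E7. M = frame_group (g \<circ> fano_root)"
proof -
  obtain a where a: "a \<in> E7_roots" "\<And>m. m \<in> M \<Longrightarrow> m a = a \<or> m a = - a"
    using max_abelian_stable_root[OF M] by blast
  obtain u where u: "u \<in> Weyl_E7" "u a = fano_root 0"
    using Weyl_transitive_roots[OF a(1) card_blk[of 0]] by (auto simp: fano_root_def)
  define N where "N = conj_group u M"
  have N: "max_abelian N" unfolding N_def by (rule max_abelian_conj[OF M u(1)])
  interpret stable: stable_half_root "of_nat ` set (blk 0)" N
  proof unfold_locales
    show "max_abelian N" by (rule N)
    fix n assume "n \<in> N"
    then obtain m where m: "m \<in> M" "n = u \<circ> m \<circ> (inv\<^bsub>WE7\<^esub> u)" by (auto simp: N_def conj_group_def)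
    have "n (u a) = u (m a)" using m(2) by (simp add: inv_WE7[OF u(1)])
    then have "n (u a) = u a \<or> n (u a) = - u a"
      using a(2)[OF m(1)] linear_neg[OF Weyl_linear[OF u(1)], of a] by auto
    then show "n fano.\<beta> = fano.\<beta> \<or> n fano.\<beta> = - fano.\<beta>" by (simp add: fano_beta u(2))
  qed
  from stable.ex_matching obtain h :: "nat \<Rightarrow> real^8"
    where hF: "\<forall>i<6. h i \<in> fano.F" and h0: "\<forall>i<6. \<forall>j<6. i \<noteq> j \<longrightarrow> h i \<bullet> h j = 0"
      and hN: "\<forall>k<3. refl (h (2*k) - h (2*k+1)) \<in> N \<and> refl (h (2*k) + h (2*k+1)) \<in> N"
    by (elim exE conjE)
  have h: "\<And>i. i < 6 \<Longrightarrow> h i \<in> fano.F"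
      "\<And>i j. i < 6 \<Longrightarrow> j < 6 \<Longrightarrow> i \<noteq> j \<Longrightarrow> h i \<bullet> h j = 0"
      "\<And>k. k < 3 \<Longrightarrow> refl (h (2*k) - h (2*k+1)) \<in> N" "\<And>k. k < 3 \<Longrightarrow> refl (h (2*k) + h (2*k+1)) \<in> N"
    using hF h0 hN by blast+
  have "\<exists>w\<in>Weyl_E7. w fano.\<beta> = fano.\<beta> \<and> (\<forall>i<6. w (h i) = fano_vec i \<or> w (h i) = - fano_vec i)"
    by (rule fano.Weyl_transitive_orthogonal_sequences) (use h(1,2) fano_vec_F fano_vec_orthogonal in auto)
  then obtain w where w: "w \<in> Weyl_E7" "w fano.\<beta> = fano.\<beta>"
      "\<And>i. i < 6 \<Longrightarrow> w (h i) = fano_vec i \<or> w (h i) = - fano_vec i" by blast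
  define N' where "N' = conj_group w N"
  have "refl (fano_root j) \<in> N'" if "j < 7" for j
  proof (cases "j = 0")
    case True
    then show ?thesis
      using conj_group_refl[OF w(1) stable.refl_beta_in_M] by (simp add: N'_def w(2)) (simp add: fano_beta)
  next
    case False
    have in_N': "refl (fano_vec (2*k) - fano_vec (2*k+1)) \<in> N'" "refl (fano_vec (2*k) + fano_vec (2*k+1)) \<in> N'"
      if k: "k < 3" for k
    proof -
      let ?p = "2 * k" and ?q = "2 * k + 1"
      have lin: "w (h ?p - h ?q) = w (h ?p) - w (h ?q)" "w (h ?p + h ?q) = w (h ?p) + w (h ?q)"
        using w(1) by (simp_all add: linear_diff linear_add Weyl_linear)
      have r: "refl (w (h ?p) - w (h ?q)) \<in> N'" "refl (w (h ?p) + w (h ?q)) \<in> N'"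
        unfolding N'_def lin[symmetric] by (intro conj_group_refl w(1) h(3,4) k)+
      \<comment> \<open>The unknown signs at most exchange the difference and the sum, up to an
        overall sign that a reflection ignores.\<close>
      have signs: "x - - y = x + y" "x + - y = x - y" "- x - y = - (x + y)" "- x + y = - (x - y)"
        for x y :: "real^8" by simp_all
      have "w (h ?p) = fano_vec ?p \<or> w (h ?p) = - fano_vec ?p" "w (h ?q) = fano_vec ?q \<or> w (h ?q) = - fano_vec ?q"
        using w(3)[of ?p] w(3)[of ?q] k by simp_all
      then have "refl (fano_vec ?p - fano_vec ?q) \<in> N' \<and> refl (fano_vec ?p + fano_vec ?q) \<in> N'"
        using r by (elim disjE) (simp_all only: signs refl_minus simp_thms)
      then show "refl (fano_vec ?p - fano_vec ?q) \<in> N'" "refl (fano_vec ?p + fano_vec ?q) \<in> N'" by blast+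
    qed
    show ?thesis using fano_roots_from_vecs[of j] False that in_N' by auto
  qed
  then have N': "N' = frame_group fano_root"
    using max_abelian_eq_frame_group[OF frame_fano_root] max_abelian_conj[OF N w(1)]
    by (simp add: N'_def)
  have wu: "w \<circ> u \<in> Weyl_E7" using Weyl_comp w(1) u(1) by blast
  have "conj_group (w \<circ> u) M = frame_group fano_root"
    using N' conj_group_comp[OF w(1) u(1)] by (simp add: N'_def N_def)
  then have "M = conj_group (inv\<^bsub>WE7\<^esub> (w \<circ> u)) (frame_group fano_root)"
    using conj_group_inv[OF wu, of M] by simp
  then have "M = frame_group ((inv\<^bsub>WE7\<^esub> (w \<circ> u)) \<circ> fano_root)"
    using conj_frame_group[OF inv_WE7(1)[OF wu]] by simp
  then show ?thesis using inv_WE7(1)[OF wu] by blast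
qed

section \<open>Orbits on the weights\<close>

text \<open>{0, 1, 3} is a perfect difference set modulo 7, so its seven translates are the lines of
  a Fano plane.\<close>

definition line :: "nat \<Rightarrow> nat set" where
  "line t = {t, (t + 1) mod 7, (t + 3) mod 7}"

lemma line_subset: "t < 7 \<Longrightarrow> line t \<subseteq> {..<7}"
  by (auto simp: line_def)

lemma card_line: "t < 7 \<Longrightarrow> card (line t) = 3"
  by (erule less_7_cases) (simp_all add: line_def)

lemma lessThan_7: "{..<7} = {0, 1, 2, 3, 4, 5, 6::nat}"
  by auto

lemma line_eq_set: "line t = set [t, (t + 1) mod 7, (t + 3) mod 7]"
  by (simp add: line_def)

text \<open>Lines are spelled out as sets of lists so that the statements can be evaluated.\<close>

lemma line_table:
  "\<forall>s\<in>set [0..<7]. \<forall>t\<in>set [0..<7].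
    set [s, (s + 1) mod 7, (s + 3) mod 7] = set [t, (t + 1) mod 7, (t + 3) mod 7] \<longrightarrow> s = t"
  "\<forall>i\<in>set [0..<7]. length (filter (\<lambda>t. i \<in> set [t, (t + 1) mod 7, (t + 3) mod 7]) [0..<7]) = 3"
  by code_simp+

lemma inj_line: "inj_on line {..<7}"
proof (rule inj_onI)
  fix s t assume "s \<in> {..<7}" "t \<in> {..<7}" "line s = line t"
  then show "s = t" using line_table(1)[rule_format, of s t] by (simp only: line_eq_set) simp
qed

lemma card_lines_through:
  assumes "i < 7"
  shows "card {t\<in>{..<7}. i \<in> line t} = 3"
proof -
  let ?l = "filter (\<lambda>t. i \<in> set [t, (t + 1) mod 7, (t + 3) mod 7]) [0..<7]"
  have "{t\<in>{..<7}. i \<in> line t} = set ?l" by (auto simp: line_def)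
  moreover have "card (set ?l) = length ?l" by (intro distinct_card distinct_filter) simp
  moreover have "length ?l = 3" by (rule line_table(2)[rule_format]) (use assms in simp)
  ultimately show ?thesis by argo
qed

lemma ex1_line:
  assumes "i < 7" "j < 7" "i \<noteq> j"
  shows "\<exists>!t. t < 7 \<and> i \<in> line t \<and> j \<in> line t"
proof -
  have ex: "\<exists>t\<in>{0,1,2,3,4,5,6}. i \<in> line t \<and> j \<in> line t"
    by (rule less_7_cases[OF assms(1)]; rule less_7_cases[OF assms(2)])
      (use assms(3) in \<open>simp_all add: line_def\<close>)
  have un: "\<forall>s\<in>{0,1,2,3,4,5,6}. \<forall>t\<in>{0,1,2,3,4,5,6}. i \<in> line s \<and> j \<in> line s \<and> i \<in> line t \<and> j \<in> line t \<longrightarrow> s = t"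
    by (rule less_7_cases[OF assms(1)]; rule less_7_cases[OF assms(2)])
      (use assms(3) in \<open>simp_all add: line_def\<close>)
  from ex obtain t where t: "t \<in> {..<7}" "i \<in> line t" "j \<in> line t" unfolding lessThan_7 by blast
  show ?thesis
  proof (rule ex1I)
    show "t < 7 \<and> i \<in> line t \<and> j \<in> line t" using t by simp
    fix s assume "s < 7 \<and> i \<in> line s \<and> j \<in> line s"
    then show "s = t" using un t unfolding lessThan_7[symmetric] by blast
  qed
qed

lemma omega7_eq: "omega7 = weight {1, 2}"
  by (simp add: omega7_def weight_def vec_eq_iff)

text \<open>Coordinate permutations carry \<open>omega7\<close> to the weight of any pair, and
  \<open>neg\<close> supplies the negatives.\<close>

lemma weights56_eq: "weights56 = wts"
proof
  have "omega7 \<in> wts" by (simp add: omega7_eq weight_in_wts)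
  then show "weights56 \<subseteq> wts" using Weyl_wts by (auto simp: weights56_def)
  have pos: "\<exists>w\<in>Weyl_E7. w omega7 = weight P" if P: "card P = 2" for P
  proof -
    have "card {1, 2 :: 8} = card P" using P by simp
    from ex_bij_image_eq[OF this] obtain p where p: "bij p" "p ` {1, 2 :: 8} = P" by (elim exE conjE)
    have "permc p omega7 = weight P" unfolding omega7_eq permc_weight[OF p(1)] p(2) ..
    then show ?thesis using permc_in_Weyl[OF p(1)] by blast
  qed
  have memI: "x \<in> weights56" if "w \<in> Weyl_E7" "w omega7 = x" for w x
    unfolding weights56_def using imageI[OF that(1), of "\<lambda>w. w omega7"] that(2) by simp
  show "wts \<subseteq> weights56"
  proof
    fix x assume "x \<in> wts"
    then show "x \<in> weights56"
    proof (rule wtsE)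
      fix P assume "card P = 2" "x = weight P"
      then show ?thesis using pos[of P] memI by metis
    next
      fix P assume P: "card P = 2" "x = - weight P"
      obtain w where w: "w \<in> Weyl_E7" "w omega7 = weight P" using pos[OF P(1)] by auto
      have "(neg \<circ> w) omega7 = x" using w P by (simp add: neg_orthogonal weight_inner_theta)
      then show ?thesis by (rule memI[OF Weyl_comp[OF neg_in_Weyl w(1)]])
    qed
  qed
qed

section \<open>Supports of weights in a frame\<close>

text \<open>The indices occurring in the expansion of \<open>v\<close> by the frame. For the frames
  used here the supports of the weights are exactly the lines.\<close>

definition supp :: "(nat \<Rightarrow> real^8) \<Rightarrow> real^8 \<Rightarrow> nat set" where
  "supp \<beta> v = {i. i < 7 \<and> \<beta> i \<bullet> v \<noteq> 0}"

lemma root_inner_weight_pair: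
  assumes "card S = 4" "k \<noteq> l"
  shows "root_of S \<bullet> weight {k, l} = (if k \<in> S then 1 else 0) + (if l \<in> S then 1 else 0) - 1"
  using weight_inner_root[of "{k,l}" S] assms by (simp add: inner_commute Int_insert_left)

lemma of_nat_8_eq_iff: "k < 8 \<Longrightarrow> l < 8 \<Longrightarrow> (of_nat k :: 8) = of_nat l \<longleftrightarrow> k = l"
proof -
  assume kl: "k < 8" "l < 8"
  have "inj_on (of_nat :: nat \<Rightarrow> 8) {..<8}"
  proof (rule eq_card_imp_inj_on)
    have "(of_nat :: nat \<Rightarrow> 8) ` {..<8} = UNIV" using ex_of_nat_8 by blast
    then show "card ((of_nat :: nat \<Rightarrow> 8) ` {..<8}) = card {..<8::nat}" by simp
  qed simp
  then show ?thesis using kl by (auto simp: inj_on_def)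
qed

lemma blk_less: "i < 7 \<Longrightarrow> p \<in> set (blk i) \<Longrightarrow> p < 8"
  by (auto simp: blk_def intro: less_trans[OF mod_less_divisor])

lemma of_nat_in_blk: "k < 8 \<Longrightarrow> i < 7 \<Longrightarrow> (of_nat k :: 8) \<in> of_nat ` set (blk i) \<longleftrightarrow> k \<in> set (blk i)"
  using blk_less of_nat_8_eq_iff by auto

text \<open>The inner product counts how many of \<open>k\<close> and \<open>l\<close> lie in the
  block, minus 1; so it vanishes exactly when the block separates them.\<close>

lemma supp_fano_weight:
  assumes "k < 8" "l < 8" "k \<noteq> l"
  shows "supp fano_root (weight {of_nat k, of_nat l}) = {i. i < 7 \<and> (k \<in> set (blk i) \<longleftrightarrow> l \<in> set (blk i))}"
proof -
  have "(of_nat k :: 8) \<noteq> of_nat l" using assms by (simp add: of_nat_8_eq_iff)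
  then have "fano_root i \<bullet> weight {of_nat k, of_nat l} \<noteq> 0 \<longleftrightarrow> (k \<in> set (blk i) \<longleftrightarrow> l \<in> set (blk i))"
    if "i < 7" for i
    using that assms by (simp add: fano_root_def root_inner_weight_pair card_blk of_nat_in_blk)
  then show ?thesis by (auto simp: supp_def)
qed

text \<open>A finite check: for each of the 28 pairs of coordinates, the blocks that do not separate
  the pair form a line. The companion table shows that every line occurs.\<close>

lemma blk_agreement:
  "\<forall>k\<in>set [0..<8]. \<forall>l\<in>set [0..<8]. k \<noteq> l \<longrightarrow>
    (\<exists>t\<in>set [0..<7]. set (filter (\<lambda>i. k \<in> set (blk i) \<longleftrightarrow> l \<in> set (blk i)) [0..<7]) = set [t, (t + 1) mod 7, (t + 3) mod 7])"
  by code_simp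

lemma blk_agreement':
  "\<forall>t\<in>set [0..<7]. \<exists>k\<in>set [0..<8]. \<exists>l\<in>set [0..<8]. k \<noteq> l \<and>
    set (filter (\<lambda>i. k \<in> set (blk i) \<longleftrightarrow> l \<in> set (blk i)) [0..<7]) = set [t, (t + 1) mod 7, (t + 3) mod 7]"
  by code_simp

lemma supp_minus: "supp \<beta> (- v) = supp \<beta> v"
  by (simp add: supp_def)

lemma supp_fano: "supp fano_root ` wts = line ` {..<7}"
proof (intro equalityI subsetI)
  have filter: "set (filter (\<lambda>i. k \<in> set (blk i) \<longleftrightarrow> l \<in> set (blk i)) [0..<7])
      = supp fano_root (weight {of_nat k, of_nat l})" if "k < 8" "l < 8" "k \<noteq> l" for k l
    unfolding supp_fano_weight[OF that] by auto
  have line: "set [t, (t + 1) mod 7, (t + 3) mod 7] = line t" for t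
    by (simp add: line_def)
  {
    fix L assume "L \<in> supp fano_root ` wts"
    then obtain P where P: "card P = 2" "L = supp fano_root (weight P)"
      by (auto elim!: wtsE simp: supp_minus)
    obtain i j where ij: "P = {i, j}" "i \<noteq> j" using P(1) by (auto simp: card_2_iff)
    obtain k l where kl: "k < 8" "i = of_nat k" "l < 8" "j = of_nat l" using ex_of_nat_8 by metis
    then have "k \<noteq> l" using ij(2) by auto
    then have "\<exists>t\<in>set [0..<7]. supp fano_root (weight {of_nat k, of_nat l}) = line t"
      using blk_agreement[rule_format, of k l] kl(1,3) by (simp only: filter line) simp
    then show "L \<in> line ` {..<7}" using P(2) ij kl by auto
  }
  fix L assume "L \<in> line ` {..<7}"
  then obtain t where t: "t < 7" "L = line t" by auto
  then obtain k l where kl: "k < 8" "l < 8" "k \<noteq> l"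
    "set (filter (\<lambda>i. k \<in> set (blk i) \<longleftrightarrow> l \<in> set (blk i)) [0..<7]) = set [t, (t + 1) mod 7, (t + 3) mod 7]"
    using blk_agreement'[rule_format, of t] by auto
  then have "supp fano_root (weight {of_nat k, of_nat l}) = set [t, (t + 1) mod 7, (t + 3) mod 7]"
    using filter[OF kl(1-3)] by (simp only:)
  then have "supp fano_root (weight {of_nat k, of_nat l}) = L" by (simp only: line t(2))
  moreover have "weight {of_nat k, of_nat l} \<in> wts" using kl by (simp add: weight_in_wts of_nat_8_eq_iff)
  ultimately show "L \<in> supp fano_root ` wts" by blast
qed

text \<open>The second clause keeps what is needed from the explicit frame in a form invariant under
  the Weyl group, so the orbits can be studied directly in every conjugate.\<close>

definition fano_frame :: "(nat \<Rightarrow> real^8) \<Rightarrow> bool" where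
  "fano_frame \<beta> \<longleftrightarrow> frame \<beta> \<and> supp \<beta> ` wts = line ` {..<7}"

lemma fano_frame_comp:
  assumes g: "g \<in> Weyl_E7"
  shows "fano_frame (g \<circ> fano_root)"
proof -
  have "supp (g \<circ> fano_root) (g v) = supp fano_root v" for v
    by (simp add: supp_def Weyl_inner[OF g])
  moreover have "wts = g ` wts"
  proof
    show "g ` wts \<subseteq> wts" using Weyl_wts[OF g] by auto
    show "wts \<subseteq> g ` wts"
      using Weyl_wts[OF inv_WE7(1)[OF g]] inv_WE7(3)[OF g] by (metis image_eqI subsetI)
  qed
  ultimately have "supp (g \<circ> fano_root) ` wts = supp fano_root ` wts"
    by (metis (no_types, lifting) image_cong image_image)
  then show ?thesis
    using frame_comp[OF frame_fano_root g] supp_fano by (simp add: fano_frame_def)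
qed

lemma wts_inner_root:
  assumes "v \<in> wts" "a \<in> E7_roots"
  shows "v \<bullet> a = 0 \<or> v \<bullet> a = 1 \<or> v \<bullet> a = -1"
proof -
  have pos: "weight P \<bullet> a = 0 \<or> weight P \<bullet> a = 1 \<or> weight P \<bullet> a = -1" if P: "card P = 2" for P
  proof -
    from assms(2) consider i j where "a = ind {i} - ind {j}" | S where "card S = 4" "a = root_of S"
      by (auto simp: E7_roots_eq)
    then show ?thesis
    proof cases
      case (1 i j)
      then show ?thesis
        by (cases "i \<in> P"; cases "j \<in> P") (simp_all add: weight_def inner_diff_left inner_diff_right)
    next
      case (2 S)
      have "card (P \<inter> S) \<le> 2" using card_mono[of P "P \<inter> S"] P by simp
      then have "card (P \<inter> S) = 0 \<or> card (P \<inter> S) = 1 \<or> card (P \<inter> S) = 2" by linarith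
      then show ?thesis using weight_inner_root[OF P 2(1)] 2(2) by (elim disjE) simp_all
    qed
  qed
  from assms(1) show ?thesis
  proof (rule wtsE)
    fix P assume "card P = 2" "v = - weight P"
    then show ?thesis using pos[of P] by auto
  qed (use pos in blast)
qed

definition orbit_of :: "(nat \<Rightarrow> real^8) \<Rightarrow> nat set \<Rightarrow> (real^8) set" where
  "orbit_of \<beta> L = {v \<in> wts. supp \<beta> v = L}"

context
  fixes \<beta> :: "nat \<Rightarrow> real^8"
  assumes ff: "fano_frame \<beta>"
begin

lemma fano_frame_frame: "frame \<beta>"
  using ff by (simp add: fano_frame_def)

text \<open>Coefficients of weights are 0, 1 or -1, so two weights of the same support differ only
  in signs, and a flip relates them.\<close>

lemma orbit_eq_flips:
  assumes v: "v \<in> wts"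
  shows "orbit_of \<beta> (supp \<beta> v) = (\<lambda>J. flip \<beta> J v) ` Pow (supp \<beta> v)"
    and "orbit_of \<beta> (supp \<beta> v) = (\<lambda>w. w v) ` frame_group \<beta>"
proof -
  note fr = fano_frame_frame
  have sub: "supp \<beta> v \<subseteq> {..<7}" by (auto simp: supp_def)
  have 1: "orbit_of \<beta> (supp \<beta> v) \<subseteq> (\<lambda>J. flip \<beta> J v) ` Pow (supp \<beta> v)"
  proof
    fix u assume "u \<in> orbit_of \<beta> (supp \<beta> v)"
    then have u: "u \<in> wts" "supp \<beta> u = supp \<beta> v" by (auto simp: orbit_of_def)
    \<comment> \<open>The indices at which the signs of \<open>u\<close> and \<open>v\<close>
      differ.\<close>
    define J where "J = {i \<in> supp \<beta> v. u \<bullet> \<beta> i \<noteq> v \<bullet> \<beta> i}"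
    have J: "J \<subseteq> {..<7}" "J \<subseteq> supp \<beta> v" using sub by (auto simp: J_def)
    have "flip \<beta> J v = u"
    proof (rule frame_eqI[OF fr])
      fix i :: nat assume i: "i < 7"
      have "i \<in> supp \<beta> u \<longleftrightarrow> i \<in> supp \<beta> v" using u(2) by simp
      then have 0: "u \<bullet> \<beta> i = 0 \<longleftrightarrow> v \<bullet> \<beta> i = 0"
        using i by (simp add: supp_def inner_commute)
      have "i \<in> J \<longleftrightarrow> v \<bullet> \<beta> i \<noteq> 0 \<and> u \<bullet> \<beta> i \<noteq> v \<bullet> \<beta> i"
        using i by (simp add: J_def supp_def inner_commute)
      then show "flip \<beta> J v \<bullet> \<beta> i = u \<bullet> \<beta> i"
        using 0 flip_inner[OF fr J(1) i, of v] wts_inner_root[OF u(1) frame_root[OF fr i]]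
          wts_inner_root[OF v frame_root[OF fr i]]
        by auto
    next
      show "flip \<beta> J v \<bullet> theta = u \<bullet> theta"
        by (simp add: flip_theta[OF fr J(1)] wts_theta u v)
    qed
    then show "u \<in> (\<lambda>J. flip \<beta> J v) ` Pow (supp \<beta> v)" using J(2) by blast
  qed
  have 2: "(\<lambda>J. flip \<beta> J v) ` Pow (supp \<beta> v) \<subseteq> (\<lambda>w. w v) ` frame_group \<beta>"
    using sub by (auto simp: frame_group_def)
  have 3: "(\<lambda>w. w v) ` frame_group \<beta> \<subseteq> orbit_of \<beta> (supp \<beta> v)"
  proof
    fix u assume "u \<in> (\<lambda>w. w v) ` frame_group \<beta>"
    then obtain J where J: "J \<subseteq> {..<7}" "u = flip \<beta> J v" by (auto simp: frame_group_def)
    have "u \<bullet> \<beta> i = 0 \<longleftrightarrow> v \<bullet> \<beta> i = 0" if "i < 7" for i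
      using flip_inner[OF fr J(1) that, of v] J(2) by (simp split: if_splits)
    then have "supp \<beta> u = supp \<beta> v" by (auto simp: supp_def inner_commute)
    moreover have "u \<in> wts" using Weyl_wts[OF flip_in_Weyl[OF fr J(1)] v] J(2) by simp
    ultimately show "u \<in> orbit_of \<beta> (supp \<beta> v)" by (simp add: orbit_of_def)
  qed
  show "orbit_of \<beta> (supp \<beta> v) = (\<lambda>J. flip \<beta> J v) ` Pow (supp \<beta> v)" using 1 2 3 by blast
  show "orbit_of \<beta> (supp \<beta> v) = (\<lambda>w. w v) ` frame_group \<beta>" using 1 2 3 by blast
qed

lemma orbits_eq:
  "{(\<lambda>w. w v) ` frame_group \<beta> | v. v \<in> weights56} = (\<lambda>t. orbit_of \<beta> (line t)) ` {..<7}"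
proof -
  have "{(\<lambda>w. w v) ` frame_group \<beta> | v. v \<in> weights56} = (\<lambda>v. orbit_of \<beta> (supp \<beta> v)) ` wts"
    unfolding weights56_eq using orbit_eq_flips(2) by auto
  also have "\<dots> = orbit_of \<beta> ` supp \<beta> ` wts" by (simp add: image_image)
  also have "\<dots> = (\<lambda>t. orbit_of \<beta> (line t)) ` {..<7}"
    using ff by (simp add: fano_frame_def image_image)
  finally show ?thesis .
qed

lemma ex_wt_supp_line: "t < 7 \<Longrightarrow> \<exists>v\<in>wts. supp \<beta> v = line t"
  using ff unfolding fano_frame_def by (metis image_iff lessThan_iff)

lemma card_orbit_of:
  assumes "t < 7"
  shows "card (orbit_of \<beta> (line t)) = 8"
proof -
  note fr = fano_frame_frame
  obtain v where v: "v \<in> wts" "supp \<beta> v = line t" using ex_wt_supp_line[OF assms] by blast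
  have "inj_on (\<lambda>J. flip \<beta> J v) (Pow (line t))"
  proof (rule inj_onI)
    fix J K assume JK: "J \<in> Pow (line t)" "K \<in> Pow (line t)" "flip \<beta> J v = flip \<beta> K v"
    then have sub: "J \<subseteq> {..<7}" "K \<subseteq> {..<7}" using line_subset[OF assms] by auto
    have "i \<in> J \<longleftrightarrow> i \<in> K" if "i \<in> line t" for i
    proof -
      have i: "i < 7" "v \<bullet> \<beta> i \<noteq> 0" using that unfolding v(2)[symmetric] by (auto simp: supp_def inner_commute)
      show ?thesis
        using flip_inner[OF fr sub(1) i(1), of v] flip_inner[OF fr sub(2) i(1), of v] JK(3) i(2)
        by (simp split: if_splits)
    qed
    then show "J = K" using JK by auto
  qed
  then have "card (orbit_of \<beta> (line t)) = card (Pow (line t))"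
    using orbit_eq_flips(1)[OF v(1)] v(2) by (simp add: card_image)
  also have "\<dots> = 8" using card_line[OF assms] by (subst card_Pow) (simp_all add: line_def)
  finally show ?thesis .
qed

lemma inj_orbit_of: "inj_on (\<lambda>t. orbit_of \<beta> (line t)) {..<7}"
proof (rule inj_onI)
  fix s t assume st: "s \<in> {..<7}" "t \<in> {..<7}" and eq: "orbit_of \<beta> (line s) = orbit_of \<beta> (line t)"
  obtain v where v: "v \<in> wts" "supp \<beta> v = line s" using ex_wt_supp_line st(1) by auto
  then have "v \<in> orbit_of \<beta> (line t)" using eq by (auto simp: orbit_of_def)
  then have "line s = line t" using v(2) by (simp add: orbit_of_def)
  then show "s = t" using inj_line st by (auto simp: inj_on_def)
qed

lemma refl_frame_eq_iff:
  assumes "i < 7" "j < 7"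
  shows "refl (\<beta> i) = refl (\<beta> j) \<longleftrightarrow> i = j"
  using flip_eq_iff[OF fano_frame_frame, of "{i}" "{j}"] flip_single[OF fano_frame_frame] assms by simp

text \<open>A point is a reflection and does not remember its root, so incidence asks for some index
  with that reflection; injectivity of i \<mapsto> refl (\<beta> i) identifies it as
  \<open>j\<close>.\<close>

lemma incidence_iff:
  assumes "j < 7" "t < 7"
  shows "(\<exists>i<7. refl (\<beta> j) = refl (\<beta> i) \<and> (\<forall>v\<in>orbit_of \<beta> (line t). \<beta> i \<bullet> v \<noteq> 0)) \<longleftrightarrow> j \<in> line t"
proof -
  have "(\<forall>v\<in>orbit_of \<beta> (line t). \<beta> j \<bullet> v \<noteq> 0) \<longleftrightarrow> j \<in> line t"
  proof
    assume *: "\<forall>v\<in>orbit_of \<beta> (line t). \<beta> j \<bullet> v \<noteq> 0"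
    obtain v where v: "v \<in> wts" "supp \<beta> v = line t" using ex_wt_supp_line[OF assms(2)] by blast
    then have "\<beta> j \<bullet> v \<noteq> 0" using * by (simp add: orbit_of_def)
    then show "j \<in> line t" using v(2) assms(1) by (auto simp: supp_def)
  qed (auto simp: orbit_of_def supp_def)
  moreover have "i = j" if "i < 7" "refl (\<beta> j) = refl (\<beta> i)" for i
    using that refl_frame_eq_iff assms by metis
  ultimately show ?thesis using assms(1) by blast
qed

lemma fano_plane_orbits:
  "fano_plane ((\<lambda>i. refl (\<beta> i)) ` {..<7}) ((\<lambda>t. orbit_of \<beta> (line t)) ` {..<7})
     (\<lambda>s L. \<exists>i<7. s = refl (\<beta> i) \<and> (\<forall>v\<in>L. \<beta> i \<bullet> v \<noteq> 0))"
proof -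
  let ?r = "\<lambda>i. refl (\<beta> i)" and ?O = "\<lambda>t. orbit_of \<beta> (line t)"
  let ?inc = "\<lambda>s L. \<exists>i<7. s = ?r i \<and> (\<forall>v\<in>L. \<beta> i \<bullet> v \<noteq> 0)"
  have inj_r: "inj_on ?r {..<7}" by (rule inj_onI) (simp add: refl_frame_eq_iff)
  have points: "card {p \<in> ?r ` {..<7}. ?inc p (?O t)} = 3" if t: "t < 7" for t
  proof -
    have "{p \<in> ?r ` {..<7}. ?inc p (?O t)} = ?r ` line t"
    proof (intro equalityI subsetI)
      fix p assume "p \<in> {p \<in> ?r ` {..<7}. ?inc p (?O t)}"
      then obtain j where j: "j < 7" "p = ?r j" "?inc p (?O t)" by auto
      have "?inc (?r j) (?O t)" using j(3) unfolding j(2) .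
      then have "j \<in> line t" by (simp only: incidence_iff[OF j(1) t])
      then show "p \<in> ?r ` line t" using j(2) by blast
    next
      fix p assume "p \<in> ?r ` line t"
      then obtain j where j: "j \<in> line t" "p = ?r j" by auto
      then have j7: "j < 7" using line_subset[OF t] by auto
      have "?inc (?r j) (?O t)" using j(1) by (simp only: incidence_iff[OF j7 t])
      then show "p \<in> {p \<in> ?r ` {..<7}. ?inc p (?O t)}" unfolding j(2) using j7 by blast
    qed
    then show ?thesis
      using card_image[OF inj_on_subset[OF inj_r line_subset[OF t]]] card_line[OF t] by simp
  qed
  have lines: "card {L \<in> ?O ` {..<7}. ?inc (?r j) L} = 3" if j: "j < 7" for j
  proof -
    have "{L \<in> ?O ` {..<7}. ?inc (?r j) L} = ?O ` {t \<in> {..<7}. ?inc (?r j) (?O t)}" by blast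
    also have "{t \<in> {..<7}. ?inc (?r j) (?O t)} = {t \<in> {..<7}. j \<in> line t}"
      by (rule Collect_cong) (metis incidence_iff[OF j] lessThan_iff)
    finally have eq: "{L \<in> ?O ` {..<7}. ?inc (?r j) L} = ?O ` {t \<in> {..<7}. j \<in> line t}" .
    have "{t \<in> {..<7}. j \<in> line t} \<subseteq> {..<7}" by blast
    from card_image[OF inj_on_subset[OF inj_orbit_of this]] show ?thesis
      unfolding eq using card_lines_through[OF j] by (simp only:)
  qed
  have unique: "\<exists>!L. L \<in> ?O ` {..<7} \<and> ?inc (?r i) L \<and> ?inc (?r j) L" if ij: "i < 7" "j < 7" "i \<noteq> j" for i j
  proof -
    obtain t where t: "t < 7" "i \<in> line t" "j \<in> line t"
      and un: "\<And>s. s < 7 \<Longrightarrow> i \<in> line s \<Longrightarrow> j \<in> line s \<Longrightarrow> s = t"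
      using ex1_line[OF ij] by blast
    show ?thesis
    proof (rule ex1I)
      show "?O t \<in> ?O ` {..<7} \<and> ?inc (?r i) (?O t) \<and> ?inc (?r j) (?O t)"
        using t by (simp only: incidence_iff[OF ij(1) t(1)] incidence_iff[OF ij(2) t(1)]) simp
      fix L assume L: "L \<in> ?O ` {..<7} \<and> ?inc (?r i) L \<and> ?inc (?r j) L"
      then obtain s where s: "s < 7" "L = ?O s" by auto
      have "?inc (?r i) (?O s)" "?inc (?r j) (?O s)" using L unfolding s(2) by blast+
      then have "i \<in> line s" "j \<in> line s"
        by (simp_all only: incidence_iff[OF ij(1) s(1)] incidence_iff[OF ij(2) s(1)])
      then show "L = ?O t" using un[OF s(1)] s(2) by simp
    qed
  qed
  show ?thesis
    unfolding fano_plane_def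
  proof (intro conjI ballI impI)
    show "card (?r ` {..<7}) = 7" using card_image[OF inj_r] by simp
    show "card (?O ` {..<7}) = 7" using card_image[OF inj_orbit_of] by simp
    show "card {p \<in> ?r ` {..<7}. ?inc p L} = 3" if L: "L \<in> ?O ` {..<7}" for L
    proof -
      obtain t where "t < 7" "L = ?O t" using L by auto
      then show ?thesis using points[of t] by simp
    qed
    show "card {L \<in> ?O ` {..<7}. ?inc p L} = 3" if p: "p \<in> ?r ` {..<7}" for p
    proof -
      obtain j where "j < 7" "p = ?r j" using p by auto
      then show ?thesis using lines[of j] by simp
    qed
    show "\<exists>!L. L \<in> ?O ` {..<7} \<and> ?inc p L \<and> ?inc q L"
      if pq: "p \<in> ?r ` {..<7}" "q \<in> ?r ` {..<7}" "p \<noteq> q" for p q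
    proof -
      obtain i j where ij: "i < 7" "p = ?r i" "j < 7" "q = ?r j" using pq(1,2) by auto
      with pq(3) have "i \<noteq> j" by blast
      then show ?thesis using unique[of i j] ij by simp
    qed
  qed simp_all
qed

lemma frame_group_generate: "frame_group \<beta> = generate WE7 ((\<lambda>i. refl (\<beta> i)) ` {..<7})"
proof
  note fr = fano_frame_frame
  let ?R = "(\<lambda>i. refl (\<beta> i)) ` {..<7}"
  have "flip \<beta> J \<in> generate WE7 ?R" if "J \<subseteq> {..<7}" for J
    using finite_subset[OF that finite_lessThan] that
  proof (induction J rule: finite_induct)
    case empty
    then show ?case using generate.one[of WE7 ?R] flip_empty[OF fr] by (metis WE7_simps(3))
  next
    case (insert i J)
    then have "flip \<beta> (insert i J) = refl (\<beta> i) \<circ> flip \<beta> J" by (intro flip_insert fr) auto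
    moreover have "refl (\<beta> i) \<in> generate WE7 ?R" using insert.prems by (intro generate.incl) auto
    then have "refl (\<beta> i) \<circ> flip \<beta> J \<in> generate WE7 ?R"
      using generate.eng[of "refl (\<beta> i)" WE7 ?R "flip \<beta> J"] insert by simp
    ultimately show ?case by (simp only:)
  qed
  then show "frame_group \<beta> \<subseteq> generate WE7 ?R" by (auto simp: frame_group_def)
  have "?R \<subseteq> frame_group \<beta>"
  proof
    fix s assume "s \<in> ?R"
    then obtain i where "i < 7" "s = flip \<beta> {i}" using flip_single[OF fr] by auto
    then show "s \<in> frame_group \<beta>" by (auto simp: frame_group_def)
  qed
  moreover have "subgroup (frame_group \<beta>) WE7"
    using abelian_frame_group[OF fr] by (simp add: abelian_subgroup_def)
  ultimately show "generate WE7 ?R \<subseteq> frame_group \<beta>"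
    by (rule group.generate_subgroup_incl[OF group_WE7])
qed

text \<open>A flip of \<open>J\<close> negates every \<beta> j with j in \<open>J\<close>, while a
  reflection in \<open>a\<close> negates only multiples of \<open>a\<close>. Two orthogonal roots
  cannot both be multiples of \<open>a\<close>, so \<open>J\<close> is a singleton.\<close>

lemma reflections_in_frame_group:
  "{s \<in> frame_group \<beta>. \<exists>a\<in>E7_roots. s = refl a} = (\<lambda>i. refl (\<beta> i)) ` {..<7}"
proof (intro equalityI subsetI)
  note fr = fano_frame_frame
  fix s assume "s \<in> {s \<in> frame_group \<beta>. \<exists>a\<in>E7_roots. s = refl a}"
  then obtain J a where J: "J \<subseteq> {..<7}" "s = flip \<beta> J" and a: "a \<in> E7_roots" "s = refl a"
    by (auto simp: frame_group_def)
  have na: "a \<bullet> a = 2" using a(1) by (rule E7_root_norm)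
  have "J \<noteq> {}"
  proof
    assume "J = {}"
    then have "refl a a = a" using J(2) a(2) flip_empty[OF fr] by simp
    then show False using E7_root_nonzero[OF a(1)] by (simp add: refl_self)
  qed
  then obtain i where i: "i \<in> J" by blast
  \<comment> \<open>The equation refl a (\<beta> j) = - \<beta> j, written out, says that \<beta> j
    is a multiple of \<open>a\<close>.\<close>
  have par: "2 *\<^sub>R \<beta> j = (\<beta> j \<bullet> a) *\<^sub>R a" if "j \<in> J" for j
  proof -
    have "j < 7" using that J(1) by auto
    then have "refl a (\<beta> j) = - \<beta> j" using flip_frame[OF fr J(1), of j] that J(2) a(2) by simp
    then have "\<beta> j - (\<beta> j \<bullet> a) *\<^sub>R a = - \<beta> j" by (simp add: refl_norm2[OF na])
    then show ?thesis by (simp add: scaleR_2 algebra_simps)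
  qed
  have "j = i" if "j \<in> J" for j
  proof (rule ccontr)
    assume "j \<noteq> i"
    then have ij: "\<beta> j \<bullet> \<beta> i = 0" using frame_inner[OF fr, of j i] that i J(1) by auto
    have "(2 *\<^sub>R \<beta> j) \<bullet> (2 *\<^sub>R \<beta> i) = (\<beta> j \<bullet> a) * (\<beta> i \<bullet> a) * (a \<bullet> a)"
      unfolding par[OF that] par[OF i] by simp
    then have "\<beta> j \<bullet> a = 0 \<or> \<beta> i \<bullet> a = 0" using ij na by simp
    then have "\<beta> j = 0 \<or> \<beta> i = 0" using par[OF that] par[OF i] by auto
    moreover have "\<beta> j \<bullet> \<beta> j = 2" "\<beta> i \<bullet> \<beta> i = 2" using frame_inner[OF fr] that i J(1) by auto
    ultimately show False by auto
  qed
  then have "J = {i}" using i by blast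
  then show "s \<in> (\<lambda>i. refl (\<beta> i)) ` {..<7}" using J flip_single[OF fr, of i] by auto
next
  note fr = fano_frame_frame
  fix s assume "s \<in> (\<lambda>i. refl (\<beta> i)) ` {..<7}"
  then obtain i where i: "i < 7" "s = refl (\<beta> i)" by auto
  then have "s = flip \<beta> {i}" by (simp add: flip_single[OF fr])
  then have "s \<in> frame_group \<beta>" using i(1) by (auto simp: frame_group_def)
  then show "s \<in> {s \<in> frame_group \<beta>. \<exists>a\<in>E7_roots. s = refl a}"
    using i frame_root[OF fr, of i] by blast
qed

text \<open>A vector over Z/2 is read as the set of its indices with value 1; addition modulo 2 is
  symmetric difference, hence composition of flips.\<close>

lemma frame_group_iso:
  "WE7\<lparr>carrier := frame_group \<beta>\<rparr> \<cong> product_group {..<(7::nat)} (\<lambda>_. integer_mod_group 2)"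
proof -
  note fr = fano_frame_frame
  let ?P = "product_group {..<(7::nat)} (\<lambda>_. integer_mod_group 2)"
  let ?h = "\<lambda>f :: nat \<Rightarrow> int. flip \<beta> {i. i < 7 \<and> f i = 1}"
  have car: "carrier ?P = (\<Pi>\<^sub>E i\<in>{..<7}. {0, 1})"
  proof -
    have "{0..<2::int} = {0, 1}" by auto
    then show ?thesis by (simp add: carrier_integer_mod_group)
  qed
  have "?h \<in> iso ?P (WE7\<lparr>carrier := frame_group \<beta>\<rparr>)"
  proof (rule isoI)
    show "?h \<in> hom ?P (WE7\<lparr>carrier := frame_group \<beta>\<rparr>)"
    proof (rule homI)
      show "?h x \<in> carrier (WE7\<lparr>carrier := frame_group \<beta>\<rparr>)" for x
        by (auto simp: frame_group_def)
      fix x y assume xy: "x \<in> carrier ?P" "y \<in> carrier ?P"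
      let ?J = "\<lambda>f :: nat \<Rightarrow> int. {i. i < 7 \<and> f i = 1}"
      have v: "x i = 0 \<or> x i = 1" "y i = 0 \<or> y i = 1" if "i < 7" for i
        using xy that unfolding car by (auto simp: PiE_iff)
      have "?J (x \<otimes>\<^bsub>?P\<^esub> y) = (?J x - ?J y) \<union> (?J y - ?J x)"
        using v by fastforce
      moreover have "flip \<beta> (?J x) (flip \<beta> (?J y) z) = flip \<beta> ((?J x - ?J y) \<union> (?J y - ?J x)) z" for z
        by (rule flip_flip[OF fr]) auto
      ultimately have "?h (x \<otimes>\<^bsub>?P\<^esub> y) = ?h x \<circ> ?h y" by (simp only: fun_eq_iff o_apply) simp
      then show "?h (x \<otimes>\<^bsub>?P\<^esub> y) = ?h x \<otimes>\<^bsub>WE7\<lparr>carrier := frame_group \<beta>\<rparr>\<^esub> ?h y" by simp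
    qed
    show "bij_betw ?h (carrier ?P) (carrier (WE7\<lparr>carrier := frame_group \<beta>\<rparr>))"
      unfolding bij_betw_def
    proof
      show "inj_on ?h (carrier ?P)"
      proof (rule inj_onI)
        fix x y assume xy: "x \<in> carrier ?P" "y \<in> carrier ?P" and "?h x = ?h y"
        then have "{i. i < 7 \<and> x i = 1} = {i. i < 7 \<and> y i = 1}"
          by (subst (asm) flip_eq_iff[OF fr]) auto
        then have *: "x i = 1 \<longleftrightarrow> y i = 1" if "i < 7" for i using that by blast
        show "x = y"
        proof (rule PiE_ext)
          show "x \<in> (\<Pi>\<^sub>E i\<in>{..<7}. {0, 1})" "y \<in> (\<Pi>\<^sub>E i\<in>{..<7}. {0, 1})" using xy unfolding car .
        next
          fix i :: nat assume i: "i \<in> {..<7}"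
          then have "x i = 0 \<or> x i = 1" "y i = 0 \<or> y i = 1"
            using xy unfolding car by (auto simp: PiE_iff)
          then show "x i = y i" using *[of i] i by auto
        qed
      qed
      show "?h ` carrier ?P = carrier (WE7\<lparr>carrier := frame_group \<beta>\<rparr>)"
      proof
        show "?h ` carrier ?P \<subseteq> carrier (WE7\<lparr>carrier := frame_group \<beta>\<rparr>)" by (auto simp: frame_group_def)
        show "carrier (WE7\<lparr>carrier := frame_group \<beta>\<rparr>) \<subseteq> ?h ` carrier ?P"
        proof
          fix m assume "m \<in> carrier (WE7\<lparr>carrier := frame_group \<beta>\<rparr>)"
          then obtain J where J: "J \<subseteq> {..<7}" "m = flip \<beta> J" by (auto simp: frame_group_def)
          let ?f = "\<lambda>i\<in>{..<7}. if i \<in> J then 1 else (0::int)"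
          have "{i. i < 7 \<and> ?f i = 1} = J" using J(1) by auto
          then have "m = ?h ?f" using J(2) by simp
          moreover have "?f \<in> carrier ?P" unfolding car by auto
          ultimately show "m \<in> ?h ` carrier ?P" by blast
        qed
      qed
    qed
  qed
  then have "?P \<cong> WE7\<lparr>carrier := frame_group \<beta>\<rparr>" by (auto simp: is_iso_def)
  moreover have "group ?P" by (intro product_group) simp
  ultimately show ?thesis by (rule group.iso_sym[rotated])
qed

end

section \<open>The action of \<open>SL(2,7)\<close> on the coordinates\<close>

text \<open>The point \<open>u / v\<close> of the projective line over \<open>F_7\<close>, where \<open>v ^ 5\<close> is the inverse of \<open>v\<close>
  and 7 is the point at infinity.\<close>
definition pt :: "int \<Rightarrow> int \<Rightarrow> nat" where
  "pt u v = (if v mod 7 = 0 then 7 else nat ((u * v ^ 5) mod 7))"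

definition rep :: "nat \<Rightarrow> int \<times> int" where
  "rep p = (if p = 7 then (1, 0) else (int p, 1))"

definition moebius :: "int \<times> int \<times> int \<times> int \<Rightarrow> nat \<Rightarrow> nat" where
  "moebius X p = (case X of (a, b, c, d) \<Rightarrow> case rep p of (u, v) \<Rightarrow> pt (a * u + b * v) (c * u + d * v))"

text \<open>A nonzero vector is a scalar multiple of the normalized representative of its point;
  checked on residues, as \<open>pt\<close> depends only on these.\<close>

lemma pt_rep_table:
  "\<forall>u\<in>set [0..6]. \<forall>v\<in>set [0..6]. u \<noteq> 0 \<or> v \<noteq> 0 \<longrightarrow>
    (\<exists>l\<in>set [1..6]. (l * fst (rep (pt u v))) mod 7 = u \<and> (l * snd (rep (pt u v))) mod 7 = v)"
  by code_simp

lemma pt_scale_table: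
  "\<forall>l\<in>set [1..6]. \<forall>u\<in>set [0..6]. \<forall>v\<in>set [0..6]. pt (l * u) (l * v) = pt u v"
  by code_simp

lemma pt_cong:
  assumes "u mod 7 = u' mod 7" "v mod 7 = v' mod 7"
  shows "pt u v = pt u' v'"
proof -
  have "(u * v ^ 5) mod 7 = (u' * v' ^ 5) mod 7"
    using assms by (metis mod_mult_cong power_mod)
  then show ?thesis using assms(2) by (simp add: pt_def)
qed

lemma pt_less: "pt u v < 8"
  by (auto simp: pt_def nat_less_iff intro: less_trans[OF pos_mod_bound])

lemma pt_rep:
  assumes "u mod 7 \<noteq> 0 \<or> v mod 7 \<noteq> 0" "rep (pt u v) = (x, y)"
  obtains l where "l \<in> {1..6}" "(l * x) mod 7 = u mod 7" "(l * y) mod 7 = v mod 7"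
proof -
  have eq: "pt (u mod 7) (v mod 7) = pt u v" by (rule pt_cong) simp_all
  have "u mod 7 \<in> set [0..6]" "v mod 7 \<in> set [0..6]" by (auto simp: zle_diff1_eq[of _ 7, simplified])
  with pt_rep_table assms(1) obtain l where "l \<in> set [1..6]"
      "(l * fst (rep (pt (u mod 7) (v mod 7)))) mod 7 = u mod 7"
      "(l * snd (rep (pt (u mod 7) (v mod 7)))) mod 7 = v mod 7"
    by blast
  then show ?thesis using that[of l] unfolding eq assms(2) by simp
qed

lemma pt_scale:
  assumes "l \<in> {1..6}"
  shows "pt (l * u) (l * v) = pt u v"
proof -
  have "pt (l * u) (l * v) = pt (l * (u mod 7)) (l * (v mod 7))"
    by (rule pt_cong) (simp_all add: mod_mult_right_eq)
  also have "\<dots> = pt (u mod 7) (v mod 7)"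
    by (rule pt_scale_table[rule_format]) (use assms in \<open>auto simp: zle_diff1_eq[of _ 7, simplified]\<close>)
  also have "\<dots> = pt u v" by (rule pt_cong) simp_all
  finally show ?thesis .
qed

lemma SL27_carrier:
  "(a, b, c, d) \<in> carrier SL27 \<longleftrightarrow> a \<in> {0..<7} \<and> b \<in> {0..<7} \<and> c \<in> {0..<7} \<and> d \<in> {0..<7}
     \<and> (a * d - b * c) mod 7 = 1"
  by (simp add: SL27_def)

lemma SL27_mult: "(a, b, c, d) \<otimes>\<^bsub>SL27\<^esub> (e, f, g, h) =
   ((a*e + b*g) mod 7, (a*f + b*h) mod 7, (c*e + d*g) mod 7, (c*f + d*h) mod 7)"
  by (simp add: SL27_def)

lemma SL27_one: "\<one>\<^bsub>SL27\<^esub> = (1, 0, 0, 1)"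
  by (simp add: SL27_def)

lemma mod_lin:
  fixes p q r s x m :: int
  shows "((p mod m) * r + (q mod m) * s) mod m = (p * r + q * s) mod m"
    "(r * (p mod m) + s * (q mod m)) mod m = (r * p + s * q) mod m"
    "((p mod m) * r + x) mod m = (p * r + x) mod m" "(x + (p mod m) * r) mod m = (x + p * r) mod m"
  by (intro mod_add_cong mod_mult_cong mod_mod_trivial refl)+

lemma group_SL27: "group SL27"
proof (rule groupI)
  fix X Y assume XY: "X \<in> carrier SL27" "Y \<in> carrier SL27"
  obtain a b c d where X: "X = (a, b, c, d)" by (metis prod.collapse)
  obtain e f g h where Y: "Y = (e, f, g, h)" by (metis prod.collapse)
  have det: "(a * d - b * c) mod 7 = 1" "(e * h - f * g) mod 7 = 1"
    using XY by (simp_all add: X Y SL27_carrier)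
  have "((a*e + b*g) mod 7 * ((c*f + d*h) mod 7) - (a*f + b*h) mod 7 * ((c*e + d*g) mod 7)) mod 7
      = ((a*e + b*g) * (c*f + d*h) - (a*f + b*h) * (c*e + d*g)) mod 7"
    by (intro mod_diff_cong mod_mult_cong mod_mod_trivial)
  also have "(a*e + b*g) * (c*f + d*h) - (a*f + b*h) * (c*e + d*g) = (a*d - b*c) * (e*h - f*g)"
    by (simp add: algebra_simps)
  also have "\<dots> mod 7 = 1"
    using mod_mult_eq[of "a*d - b*c" 7 "e*h - f*g"] by (simp add: det)
  finally show "X \<otimes>\<^bsub>SL27\<^esub> Y \<in> carrier SL27"
    by (simp add: X Y SL27_mult SL27_carrier)
next
  fix X Y Z :: "int \<times> int \<times> int \<times> int"
  obtain a b c d where X: "X = (a, b, c, d)" by (metis prod.collapse)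
  obtain e f g h where Y: "Y = (e, f, g, h)" by (metis prod.collapse)
  obtain i j k l where Z: "Z = (i, j, k, l)" by (metis prod.collapse)
  show "X \<otimes>\<^bsub>SL27\<^esub> Y \<otimes>\<^bsub>SL27\<^esub> Z = X \<otimes>\<^bsub>SL27\<^esub> (Y \<otimes>\<^bsub>SL27\<^esub> Z)"
    unfolding X Y Z SL27_mult mod_lin(1,2) by (simp add: algebra_simps)
next
  show "\<one>\<^bsub>SL27\<^esub> \<in> carrier SL27" by (simp add: SL27_one SL27_carrier)
next
  fix X assume "X \<in> carrier SL27"
  then show "\<one>\<^bsub>SL27\<^esub> \<otimes>\<^bsub>SL27\<^esub> X = X"
    by (cases X) (simp add: SL27_one SL27_mult SL27_carrier)
next
  fix X assume X: "X \<in> carrier SL27"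
  obtain a b c d where Xe: "X = (a, b, c, d)" by (metis prod.collapse)
  have det: "(a * d - b * c) mod 7 = 1" using X by (simp add: Xe SL27_carrier)
  let ?Y = "(d, (- b) mod 7, (- c) mod 7, a)"
  have "(d * a - ((- b) mod 7) * ((- c) mod 7)) mod 7 = (d * a - (- b) * (- c)) mod 7"
    by (intro mod_diff_cong mod_mult_cong mod_mod_trivial refl)
  then have "?Y \<in> carrier SL27" using X det by (simp add: Xe SL27_carrier mult.commute)
  moreover have "?Y \<otimes>\<^bsub>SL27\<^esub> X = \<one>\<^bsub>SL27\<^esub>"
  proof -
    have "d * a + - b * c = a * d - b * c" "d * b + - b * d = 0" "- c * a + a * c = 0"
      "- c * b + a * d = a * d - b * c"
      by (simp_all add: mult.commute)
    then have "(d * a + ((- b) mod 7) * c) mod 7 = 1" "(d * b + ((- b) mod 7) * d) mod 7 = 0"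
      "(((- c) mod 7) * a + a * c) mod 7 = 0" "(((- c) mod 7) * b + a * d) mod 7 = 1"
      unfolding mod_lin(3,4) by (simp_all only: det mod_0)
    then show ?thesis unfolding Xe SL27_mult SL27_one by (simp only:)
  qed
  ultimately show "\<exists>Y\<in>carrier SL27. Y \<otimes>\<^bsub>SL27\<^esub> X = \<one>\<^bsub>SL27\<^esub>" by blast
qed

lemma moebius_less: "moebius X p < 8"
  by (auto simp: moebius_def pt_less split: prod.split)

lemma moebius_cong:
  assumes "a mod 7 = a' mod 7" "b mod 7 = b' mod 7" "c mod 7 = c' mod 7" "d mod 7 = d' mod 7"
  shows "moebius (a, b, c, d) = moebius (a', b', c', d')"
proof
  fix p
  obtain u v where uv: "rep p = (u, v)" by (metis prod.collapse)
  have "(a * u + b * v) mod 7 = (a' * u + b' * v) mod 7" "(c * u + d * v) mod 7 = (c' * u + d' * v) mod 7"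
    by (rule mod_add_cong mod_mult_cong refl assms)+
  from pt_cong[OF this] show "moebius (a, b, c, d) p = moebius (a', b', c', d') p"
    unfolding moebius_def by (simp add: uv)
qed

text \<open>After the first transformation the vector is replaced by its normalized representative.
  The two differ by a nonzero scalar \<open>l\<close>, which the second transformation carries along
  and \<open>pt\<close> forgets.\<close>

lemma moebius_mult:
  assumes Y: "Y \<in> carrier SL27" and p: "p < 8"
  shows "moebius (X \<otimes>\<^bsub>SL27\<^esub> Y) p = moebius X (moebius Y p)"
proof -
  obtain a b c d where X: "X = (a, b, c, d)" by (metis prod.collapse)
  obtain e f g h where Ye: "Y = (e, f, g, h)" by (metis prod.collapse)
  have det: "(e * h - f * g) mod 7 = 1" using Y by (simp add: Ye SL27_carrier)
  obtain u v where uv: "rep p = (u, v)" by (metis prod.collapse)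
  define u' v' where "u' = e * u + f * v" and "v' = g * u + h * v"
  obtain x y where xy: "rep (pt u' v') = (x, y)" by (metis prod.collapse)
  \<comment> \<open>The adjugate matrix recovers (u, v) from (u', v') because the determinant is 1,
    and a representative is never 0 modulo 7.\<close>
  have "u' mod 7 \<noteq> 0 \<or> v' mod 7 \<noteq> 0"
  proof (rule ccontr)
    assume "\<not> ?thesis"
    then have 0: "7 dvd u'" "7 dvd v'" by auto
    have "(e * h - f * g) * u = h * u' - f * v'" "(e * h - f * g) * v = e * v' - g * u'"
      by (simp_all add: u'_def v'_def algebra_simps)
    then have "7 dvd (e * h - f * g) * u" "7 dvd (e * h - f * g) * v" using 0 by (simp_all add: dvd_diff)
    then have "((e * h - f * g) mod 7 * u) mod 7 = 0" "((e * h - f * g) mod 7 * v) mod 7 = 0"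
      by (simp_all add: mod_mult_left_eq)
    then have "u mod 7 = 0" "v mod 7 = 0" by (simp_all add: det)
    then show False using uv by (auto simp: rep_def split: if_splits)
  qed
  then obtain l where l: "l \<in> {1..6}" "(l * x) mod 7 = u' mod 7" "(l * y) mod 7 = v' mod 7"
    using xy by (rule pt_rep)
  have "moebius X (moebius Y p) = pt (a * x + b * y) (c * x + d * y)"
    unfolding moebius_def by (simp add: X Ye uv xy u'_def[symmetric] v'_def[symmetric])
  also have "\<dots> = pt (l * (a * x + b * y)) (l * (c * x + d * y))" using pt_scale[OF l(1)] by simp
  also have "\<dots> = pt (a * (l * x) + b * (l * y)) (c * (l * x) + d * (l * y))"
    by (simp add: algebra_simps)
  also have "\<dots> = pt (a * u' + b * v') (c * u' + d * v')"
    by (intro pt_cong mod_add_cong mod_mult_cong refl l(2,3))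
  also have "\<dots> = pt ((a*e + b*g) * u + (a*f + b*h) * v) ((c*e + d*g) * u + (c*f + d*h) * v)"
    by (simp add: u'_def v'_def algebra_simps)
  also have "\<dots> = pt (((a*e + b*g) mod 7) * u + ((a*f + b*h) mod 7) * v)
      (((c*e + d*g) mod 7) * u + ((c*f + d*h) mod 7) * v)"
    by (rule pt_cong; rule mod_lin(1)[symmetric])
  also have "\<dots> = moebius (X \<otimes>\<^bsub>SL27\<^esub> Y) p"
    unfolding moebius_def by (simp add: X Ye uv SL27_mult)
  finally show ?thesis ..
qed

lemma moebius_one: "p < 8 \<Longrightarrow> moebius (1, 0, 0, 1) p = p"
  by (auto simp: moebius_def rep_def pt_def)

section \<open>From the projective line to coordinate permutations\<close>

text \<open>The arithmetic takes place on natural numbers and the coordinates have type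
  \<open>8\<close>; this inverts \<open>of_nat\<close> on the labels 0 to 7.\<close>

definition idx :: "8 \<Rightarrow> nat" where
  "idx i = (SOME k. k < 8 \<and> of_nat k = i)"

lemma idx: "idx i < 8" "of_nat (idx i) = i"
proof -
  have "\<exists>k. k < 8 \<and> of_nat k = i" using ex_of_nat_8[of i] by auto
  from someI_ex[OF this] show "idx i < 8" "of_nat (idx i) = i" by (simp_all add: idx_def)
qed

lemma idx_of_nat: "k < 8 \<Longrightarrow> idx (of_nat k) = k"
  using idx of_nat_8_eq_iff by blast

definition mob :: "int \<times> int \<times> int \<times> int \<Rightarrow> 8 \<Rightarrow> 8" where
  "mob X i = of_nat (moebius X (idx i))"

lemma mob_of_nat: "k < 8 \<Longrightarrow> mob X (of_nat k) = of_nat (moebius X k)"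
  by (simp add: mob_def idx_of_nat)

lemma mob_mult: "Y \<in> carrier SL27 \<Longrightarrow> mob (X \<otimes>\<^bsub>SL27\<^esub> Y) = mob X \<circ> mob Y"
  by (simp add: fun_eq_iff mob_def moebius_mult idx idx_of_nat moebius_less)

lemma mob_one: "mob (1, 0, 0, 1) = id"
  by (simp add: fun_eq_iff mob_def moebius_one idx)

lemma bij_mob:
  assumes X: "X \<in> carrier SL27"
  shows "bij (mob X)"
proof -
  let ?Y = "inv\<^bsub>SL27\<^esub> X"
  have Y: "?Y \<in> carrier SL27" using group.inv_closed[OF group_SL27 X] .
  have "mob X \<circ> mob ?Y = id"
    using mob_mult[OF Y, of X] group.r_inv[OF group_SL27 X] by (simp add: SL27_one mob_one)
  moreover have "mob ?Y \<circ> mob X = id"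
    using mob_mult[OF X, of ?Y] group.l_inv[OF group_SL27 X] by (simp add: SL27_one mob_one)
  ultimately show ?thesis using o_bij by blast
qed

definition lift_SL :: "int \<times> int \<times> int \<times> int \<Rightarrow> real^8 \<Rightarrow> real^8" where
  "lift_SL X = permc (mob X)"

lemma lift_SL_Weyl: "X \<in> carrier SL27 \<Longrightarrow> lift_SL X \<in> Weyl_E7"
  by (simp add: lift_SL_def permc_in_Weyl bij_mob)

lemma lift_SL_mult:
  "X \<in> carrier SL27 \<Longrightarrow> Y \<in> carrier SL27 \<Longrightarrow> lift_SL (X \<otimes>\<^bsub>SL27\<^esub> Y) = lift_SL X \<circ> lift_SL Y"
  by (simp add: lift_SL_def mob_mult permc_comp bij_mob)

text \<open>For two sets of four points out of eight this means equal or complementary, that is,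
  roots equal up to sign. Lists make it executable.\<close>

definition agrees :: "nat list \<Rightarrow> nat list \<Rightarrow> bool" where
  "agrees xs ys \<longleftrightarrow> (\<forall>p\<in>set xs. p \<in> set ys) \<or> (\<forall>p\<in>set xs. p \<notin> set ys)"

definition matches :: "int \<times> int \<times> int \<times> int \<Rightarrow> nat \<Rightarrow> nat \<Rightarrow> bool" where
  "matches X i j \<longleftrightarrow> agrees (map (moebius X) (blk i)) (blk j)"

lemma root_Compl: "root_of (- S) = - root_of S"
  by (simp add: root_of_def vec_eq_iff)

text \<open>The image of a block is again a 4-set, so inclusion in another block or in its
  complement is already equality.\<close>

lemma lift_SL_fano_iff:
  assumes X: "X \<in> carrier SL27" and i: "i < 7" and j: "j < 7"
  shows "lift_SL X (fano_root i) = fano_root j \<or> lift_SL X (fano_root i) = - fano_root j \<longleftrightarrow> matches X i j"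
proof -
  let ?S = "\<lambda>i. of_nat ` set (blk i) :: 8 set"
  let ?T = "mob X ` ?S i"
  have lift: "lift_SL X (fano_root i) = root_of ?T"
    by (simp add: lift_SL_def fano_root_def permc_root bij_mob[OF X])
  have "inj_on (mob X) (?S i)" using bij_mob[OF X] by (meson bij_is_inj inj_on_subset subset_UNIV)
  then have cT: "card ?T = 4" using card_blk[OF i] by (simp add: card_image)
  have cS: "card (?S j) = 4" "card (- ?S j) = 4"
    using card_blk[OF j] by (simp_all add: card_Compl_8)
  have T: "?T = of_nat ` moebius X ` set (blk i)"
    using blk_less[OF i] by (auto simp: mob_of_nat image_iff)
  have mem: "(of_nat (moebius X p) :: 8) \<in> ?S j \<longleftrightarrow> moebius X p \<in> set (blk j)" for p
    by (rule of_nat_in_blk[OF moebius_less j])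
  have "root_of ?T = fano_root j \<longleftrightarrow> ?T = ?S j" by (simp only: fano_root_def root_inj)
  also have "\<dots> \<longleftrightarrow> ?T \<subseteq> ?S j" using cT cS(1) by (metis card_subset_eq finite order.refl)
  also have "\<dots> \<longleftrightarrow> (\<forall>p\<in>set (blk i). moebius X p \<in> set (blk j))"
    unfolding T unfolding image_image image_subset_iff by (simp only: mem)
  finally have 1: "root_of ?T = fano_root j \<longleftrightarrow> (\<forall>p\<in>set (blk i). moebius X p \<in> set (blk j))" .
  have "root_of ?T = - fano_root j \<longleftrightarrow> ?T = - ?S j" by (simp only: fano_root_def root_Compl[symmetric] root_inj)
  also have "\<dots> \<longleftrightarrow> ?T \<subseteq> - ?S j" using cT cS(2) by (metis card_subset_eq finite order.refl)
  also have "\<dots> \<longleftrightarrow> (\<forall>p\<in>set (blk i). moebius X p \<notin> set (blk j))"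
    unfolding T unfolding image_image image_subset_iff Compl_iff by (simp only: mem)
  finally have 2: "root_of ?T = - fano_root j \<longleftrightarrow> (\<forall>p\<in>set (blk i). moebius X p \<notin> set (blk j))" .
  show ?thesis unfolding lift 1 2 matches_def agrees_def by simp
qed

definition agrees_some :: "nat list \<Rightarrow> bool" where
  "agrees_some xs \<longleftrightarrow> (\<exists>j\<in>set [0..<7]. agrees xs (blk j))"

text \<open>The translation by 1, the map x \<mapsto> -1/x, and a diagonal matrix built from the
  primitive root 3 and its inverse 5.\<close>

lemma generator_table:
  "\<forall>X\<in>set [(1,1,0,1), (0,6,1,0), (3,0,0,5)]. \<forall>i\<in>set [0..<7]. agrees_some (map (moebius X) (blk i))"
  by code_simp

text \<open>For c = 0 the determinant forces d to be the inverse of a, which is a^5 modulo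
  7.\<close>

lemma kernel_table_upper:
  "\<forall>a\<in>set [1..6]. \<forall>b\<in>set [0..6]. (\<forall>i\<in>set [0..<7]. matches (a, b, 0, a ^ 5) i i) \<longrightarrow> b = 0 \<and> (a = 1 \<or> a = 6)"
  by code_simp

text \<open>For nonzero c the determinant forces b = (a * d - 1) / c, with c^5 as the inverse of c.
  The entry is left unreduced, since \<open>moebius\<close> sees only residues.\<close>

lemma kernel_table_low:
  "\<forall>c\<in>set [1..3]. \<forall>a\<in>set [0..6]. \<forall>d\<in>set [0..6]. \<not> (\<forall>i\<in>set [0..<7]. matches (a, (a * d - 1) * c ^ 5, c, d) i i)"
  by code_simp

lemma kernel_table_high:
  "\<forall>c\<in>set [4..6]. \<forall>a\<in>set [0..6]. \<forall>d\<in>set [0..6]. \<not> (\<forall>i\<in>set [0..<7]. matches (a, (a * d - 1) * c ^ 5, c, d) i i)"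
  by code_simp

lemma minus_one_table: "\<forall>i\<in>set [0..<7]. matches (6, 0, 0, 6) i i"
  by code_simp

text \<open>The blocks are translates of one another, so translations are transitive on the seven
  points.\<close>

lemma move_to_0_table:
  "\<forall>i\<in>set [0..<7]. \<exists>X\<in>set [(1,0,0,1), (1,1,0,1), (1,2,0,1), (1,3,0,1), (1,4,0,1), (1,5,0,1), (1,6,0,1)]. matches X i 0"
  by code_simp

text \<open>The witnesses fix the point 0; they show that its stabilizer is transitive on the other
  six points.\<close>

lemma move_to_1_table:
  "\<forall>i\<in>set [1..<7]. \<exists>X\<in>set [(0,2,3,0), (0,1,6,0), (1,1,2,3), (0,3,2,0), (2,2,1,5), (1,3,6,5)]. matches X i 1 \<and> matches X 0 0"
  by code_simp

text \<open>The witnesses fix 0 and 1, hence the line {0, 1, 3}; the four points off it are 2, 4, 5,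
  6. With the previous tables this accounts for 7 * 6 * 4 = 168 triples.\<close>

lemma move_to_2_table:
  "\<forall>i\<in>set [2,4,5,6]. \<exists>X\<in>set [(1,0,0,1), (0,2,3,0), (2,1,2,5), (3,4,1,4)]. matches X i 2 \<and> matches X 0 0 \<and> matches X 1 1"
  by code_simp

section \<open>The normalizer\<close>

text \<open>Only up to sign, because the points of the Fano plane are reflections and a root and its
  negative have the same one.\<close>

definition sends :: "(real^8 \<Rightarrow> real^8) \<Rightarrow> nat \<Rightarrow> nat \<Rightarrow> bool" where
  "sends n i j \<longleftrightarrow> n (fano_root i) = fano_root j \<or> n (fano_root i) = - fano_root j"

definition stabilizes_frame :: "(real^8 \<Rightarrow> real^8) \<Rightarrow> bool" where
  "stabilizes_frame n \<longleftrightarrow> n \<in> Weyl_E7 \<and> (\<forall>i<7. \<exists>j<7. sends n i j)"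

lemmas fano_inner = frame_inner[OF frame_fano_root]

lemma sends_comp: "linear m \<Longrightarrow> sends n i j \<Longrightarrow> sends m j k \<Longrightarrow> sends (m \<circ> n) i k"
  unfolding sends_def using linear_neg[of m] by fastforce

lemma sends_inj:
  assumes n: "n \<in> Weyl_E7" and ij: "i < 7" "j < 7" and s: "sends n i k" "sends n j k"
  shows "i = j"
proof -
  have "n (fano_root i) \<bullet> n (fano_root j) \<noteq> 0 \<or> fano_root k \<bullet> fano_root k = 0"
    using s by (auto simp: sends_def)
  moreover have "fano_root k \<bullet> fano_root k \<noteq> 0"
  proof
    assume "fano_root k \<bullet> fano_root k = 0"
    then have "n (fano_root i) = 0" using s(1) by (auto simp: sends_def)
    then have "fano_root i \<bullet> fano_root i = 0" using Weyl_inner[OF n, of "fano_root i" "fano_root i"] by simp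
    then show False using fano_inner[OF ij(1,1)] by simp
  qed
  ultimately have "fano_root i \<bullet> fano_root j \<noteq> 0" by (simp add: Weyl_inner[OF n])
  then show ?thesis using fano_inner[OF ij] by (auto split: if_splits)
qed

lemma stabilizes_frame_comp:
  assumes m: "stabilizes_frame m" and n: "stabilizes_frame n"
  shows "stabilizes_frame (m \<circ> n)"
proof -
  have W: "m \<in> Weyl_E7" "n \<in> Weyl_E7" using m n by (simp_all add: stabilizes_frame_def)
  have "\<exists>k<7. sends (m \<circ> n) i k" if i: "i < 7" for i
  proof -
    obtain j where j: "j < 7" "sends n i j" using n i unfolding stabilizes_frame_def by blast
    obtain k where k: "k < 7" "sends m j k" using m j(1) unfolding stabilizes_frame_def by blast
    then show ?thesis using sends_comp[OF Weyl_linear[OF W(1)] j(2) k(2)] by blast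
  qed
  then show ?thesis using Weyl_comp[OF W] unfolding stabilizes_frame_def by blast
qed

text \<open>The frame and \<open>theta\<close> form a basis, so an element preserving each root up
  to sign is the flip of the set of negated roots.\<close>

lemma in_fano_group_iff:
  assumes n: "n \<in> Weyl_E7"
  shows "n \<in> frame_group fano_root \<longleftrightarrow> (\<forall>i<7. sends n i i)"
proof
  assume "n \<in> frame_group fano_root"
  then obtain J where J: "J \<subseteq> {..<7}" "n = flip fano_root J" by (auto simp: frame_group_def)
  then show "\<forall>i<7. sends n i i" using flip_frame[OF frame_fano_root J(1)] by (simp add: sends_def)
next
  assume *: "\<forall>i<7. sends n i i"
  define J where "J = {i. i < 7 \<and> n (fano_root i) \<noteq> fano_root i}"
  have J: "J \<subseteq> {..<7}" by (auto simp: J_def)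
  have "n x = flip fano_root J x" for x
  proof (rule frame_eqI[OF frame_fano_root])
    fix i :: nat assume i: "i < 7"
    have "x \<bullet> fano_root i = n x \<bullet> n (fano_root i)" by (simp add: Weyl_inner[OF n])
    moreover have "n (fano_root i) = (if i \<in> J then - fano_root i else fano_root i)"
      using * i by (auto simp: J_def sends_def)
    ultimately show "n x \<bullet> fano_root i = flip fano_root J x \<bullet> fano_root i"
      by (simp add: flip_inner[OF frame_fano_root J i] split: if_splits)
  next
    show "n x \<bullet> theta = flip fano_root J x \<bullet> theta"
      using Weyl_inner[OF n, of x theta] Weyl_theta[OF n] by (simp add: flip_theta[OF frame_fano_root J])
  qed
  then have "n = flip fano_root J" by blast
  then show "n \<in> frame_group fano_root" using J by (auto simp: frame_group_def)
qed

lemma max_abelian_fano_group: "max_abelian (frame_group fano_root)"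
  by (simp add: max_abelian_iff abelian_frame_group card_frame_group frame_fano_root)

lemma E7_root_eq_if_refl_eq:
  assumes "a \<in> E7_roots" "b \<in> E7_roots" "refl a = refl b"
  shows "a = b \<or> a = - b"
proof -
  have "refl b a = - a" using assms(3) by (metis refl_self)
  then have "2 *\<^sub>R a = (a \<bullet> b) *\<^sub>R b"
    using assms(2) by (simp add: refl_norm2 E7_root_norm scaleR_2 algebra_simps)
  then have "(1/2) *\<^sub>R (2 *\<^sub>R a) = (1/2) *\<^sub>R ((a \<bullet> b) *\<^sub>R b)" by (simp only:)
  then have eq: "a = ((a \<bullet> b) / 2) *\<^sub>R b" by simp
  have "a \<bullet> a = ((a \<bullet> b) / 2) * (a \<bullet> b)"
    using arg_cong[OF eq, of "\<lambda>x. a \<bullet> x"] by simp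
  then have "(a \<bullet> b)\<^sup>2 = 2\<^sup>2" using assms(1) by (simp add: E7_root_norm power2_eq_square)
  then have "a \<bullet> b = 2 \<or> a \<bullet> b = -2" by (simp only: power2_eq_iff)
  then show ?thesis using eq by auto
qed

lemma fano_frame_fano_root: "fano_frame fano_root"
  by (simp add: fano_frame_def frame_fano_root supp_fano)

text \<open>A normalizing element permutes the reflections of the group, and these are just the
  seven of the frame. Conversely, the conjugate contains all seven reflections and has the same
  order.\<close>

lemma normalizes_fano_group_iff:
  assumes n: "n \<in> Weyl_E7"
  shows "conj_group n (frame_group fano_root) = frame_group fano_root \<longleftrightarrow> stabilizes_frame n"
proof
  let ?M = "frame_group fano_root"
  assume eq: "conj_group n ?M = ?M"
  have "\<exists>j<7. sends n i j" if i: "i < 7" for i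
  proof -
    have fi: "fano_root i \<in> E7_roots" by (rule frame_root[OF frame_fano_root i])
    have "refl (fano_root i) \<in> ?M"
      using reflections_in_frame_group[OF fano_frame_fano_root] i by blast
    then have "refl (n (fano_root i)) \<in> ?M" using conj_group_refl[OF n, of _ ?M] eq by simp
    moreover have nroot: "n (fano_root i) \<in> E7_roots" by (rule Weyl_roots[OF n fi])
    ultimately have "refl (n (fano_root i)) \<in> (\<lambda>i. refl (fano_root i)) ` {..<7}"
      using reflections_in_frame_group[OF fano_frame_fano_root] by blast
    then obtain j where j: "j < 7" "refl (n (fano_root i)) = refl (fano_root j)" by auto
    then have "sends n i j"
      unfolding sends_def using E7_root_eq_if_refl_eq[OF nroot frame_root[OF frame_fano_root j(1)]] by simp
    then show ?thesis using j(1) by blast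
  qed
  then show "stabilizes_frame n" using n by (simp add: stabilizes_frame_def)
next
  let ?M = "frame_group fano_root"
  assume st: "stabilizes_frame n"
  then obtain \<pi> where \<pi>: "\<And>i. i < 7 \<Longrightarrow> \<pi> i < 7" "\<And>i. i < 7 \<Longrightarrow> sends n i (\<pi> i)"
    unfolding stabilizes_frame_def by metis
  have "inj_on \<pi> {..<7}" by (rule inj_onI) (metis \<pi>(2) lessThan_iff n sends_inj)
  then have surj: "\<pi> ` {..<7} = {..<7}"
    using \<pi>(1) by (intro endo_inj_surj) auto
  have "conj_group n ?M = ?M"
  proof (rule max_abelian_eq_frame_group[OF frame_fano_root max_abelian_conj[OF max_abelian_fano_group n]])
    fix j :: nat assume "j < 7"
    then obtain i where i: "i < 7" "j = \<pi> i" using surj by blast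
    have "refl (fano_root i) \<in> ?M"
      using reflections_in_frame_group[OF fano_frame_fano_root] i(1) by blast
    then have "refl (n (fano_root i)) \<in> conj_group n ?M" by (rule conj_group_refl[OF n])
    moreover have "refl (n (fano_root i)) = refl (fano_root j)"
      using \<pi>(2)[OF i(1)] i(2) by (auto simp: sends_def refl_minus)
    ultimately show "refl (fano_root j) \<in> conj_group n ?M" by simp
  qed
  then show "conj_group n ?M = ?M" .
qed

text \<open>The element permutes the weights, so it maps supports of weights, that is lines, to
  lines. The only line through \<open>i\<close> and \<open>j\<close> is therefore preserved, and
  with it the third point.\<close>

lemma sends_collinear:
  assumes st: "stabilizes_frame n" and t: "t < 7" "line t = {i, j, k}" "i \<noteq> j" "k \<noteq> i" "k \<noteq> j"
    and fix_ij: "sends n i i" "sends n j j"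
  shows "sends n k k"
proof -
  have n: "n \<in> Weyl_E7" using st by (simp add: stabilizes_frame_def)
  have less: "i < 7" "j < 7" "k < 7" using line_subset[OF t(1)] t(2) by auto
  obtain v where v: "v \<in> wts" "supp fano_root v = line t"
    using ex_wt_supp_line[OF fano_frame_fano_root t(1)] by blast
  have "supp fano_root (n v) \<in> line ` {..<7}"
    using supp_fano Weyl_wts[OF n v(1)] by blast
  then obtain s where s: "s < 7" "supp fano_root (n v) = line s" by auto
  have mem: "l' \<in> line s" if l: "l \<in> line t" "l' < 7" "sends n l l'" for l l'
  proof -
    have "fano_root l \<bullet> v \<noteq> 0" using l(1) v(2) by (auto simp: supp_def)
    then have "n (fano_root l) \<bullet> n v \<noteq> 0" by (simp add: Weyl_inner[OF n])
    then have "fano_root l' \<bullet> n v \<noteq> 0" using l(3) by (auto simp: sends_def)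
    then show ?thesis using l(2) s(2) by (auto simp: supp_def)
  qed
  have "i \<in> line s" "j \<in> line s" using mem[of i i] mem[of j j] less fix_ij t(2) by auto
  then have st: "s = t" using ex1_line[OF less(1,2) t(3)] s(1) t(1,2) by blast
  obtain k' where k': "k' < 7" "sends n k k'"
    using assms(1) less(3) unfolding stabilizes_frame_def by blast
  have "k' \<in> {i, j, k}" using mem[of k k'] k' t(2) st by simp
  moreover have "k' \<noteq> i" using sends_inj[OF n less(3,1)] k'(2) fix_ij(1) t(4) by blast
  moreover have "k' \<noteq> j" using sends_inj[OF n less(3,2)] k'(2) fix_ij(2) t(5) by blast
  ultimately show ?thesis using k'(2) by simp
qed

lemma sends_lift_SL:
  "X \<in> carrier SL27 \<Longrightarrow> i < 7 \<Longrightarrow> j < 7 \<Longrightarrow> sends (lift_SL X) i j \<longleftrightarrow> matches X i j"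
  by (simp add: sends_def lift_SL_fano_iff)

lemma stabilizes_frame_mult:
  assumes "X \<in> carrier SL27" "Y \<in> carrier SL27" "stabilizes_frame (lift_SL X)" "stabilizes_frame (lift_SL Y)"
  shows "stabilizes_frame (lift_SL (X \<otimes>\<^bsub>SL27\<^esub> Y))"
  unfolding lift_SL_mult[OF assms(1,2)] by (rule stabilizes_frame_comp[OF assms(3,4)])

section \<open>All of SL(2,7) stabilizes the frame\<close>

definition frame_SL :: "(int \<times> int \<times> int \<times> int) set" where
  "frame_SL = {X \<in> carrier SL27. stabilizes_frame (lift_SL X)}"

lemma frame_SL_mult: "X \<in> frame_SL \<Longrightarrow> Y \<in> frame_SL \<Longrightarrow> X \<otimes>\<^bsub>SL27\<^esub> Y \<in> frame_SL"
  using stabilizes_frame_mult[of X Y] monoid.m_closed[OF group.is_monoid[OF group_SL27], of X Y]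
  unfolding frame_SL_def by blast

lemma frame_SL_generators: "(1,1,0,1) \<in> frame_SL" "(0,6,1,0) \<in> frame_SL" "(3,0,0,5) \<in> frame_SL"
proof -
  have "X \<in> frame_SL" if X: "X \<in> set [(1,1,0,1), (0,6,1,0), (3,0,0,5)]" for X
  proof -
    have car: "X \<in> carrier SL27" using X by (auto simp: SL27_carrier)
    have "\<exists>j<7. sends (lift_SL X) i j" if i: "i < 7" for i
    proof -
      have "agrees_some (map (moebius X) (blk i))"
        using generator_table X i by (metis atLeastLessThan_iff set_upt zero_le)
      then obtain j where "j < 7" "matches X i j" by (auto simp: agrees_some_def matches_def)
      then show ?thesis using sends_lift_SL[OF car i] by blast
    qed
    then show ?thesis using car lift_SL_Weyl[OF car] by (simp add: frame_SL_def stabilizes_frame_def)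
  qed
  then show "(1,1,0,1) \<in> frame_SL" "(0,6,1,0) \<in> frame_SL" "(3,0,0,5) \<in> frame_SL" by simp_all
qed

lemma frame_SL_upper_unipotent:
  assumes "y \<in> {0..<7}"
  shows "(1, y, 0, 1) \<in> frame_SL"
proof -
  have step: "(1, (k + 1) mod 7, 0, 1) \<in> frame_SL" if "(1, k, 0, 1) \<in> frame_SL" for k
    using frame_SL_mult[OF frame_SL_generators(1) that] by (simp add: SL27_mult add.commute)
  have 1: "(1, 1, 0, 1) \<in> frame_SL" by (rule frame_SL_generators)
  have 2: "(1, 2, 0, 1) \<in> frame_SL" using step[OF 1] by simp
  have 3: "(1, 3, 0, 1) \<in> frame_SL" using step[OF 2] by simp
  have 4: "(1, 4, 0, 1) \<in> frame_SL" using step[OF 3] by simp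
  have 5: "(1, 5, 0, 1) \<in> frame_SL" using step[OF 4] by simp
  have 6: "(1, 6, 0, 1) \<in> frame_SL" using step[OF 5] by simp
  have 0: "(1, 0, 0, 1) \<in> frame_SL" using step[OF 6] by simp
  have "y = 0 \<or> y = 1 \<or> y = 2 \<or> y = 3 \<or> y = 4 \<or> y = 5 \<or> y = 6" using assms by auto
  then show ?thesis using 0 1 2 3 4 5 6 by (elim disjE) simp_all
qed

text \<open>3 is a primitive root modulo 7, so the powers of one generator are all the diagonal
  matrices of determinant 1.\<close>

lemma frame_SL_diagonal:
  assumes "a \<in> {0..<7}" "d \<in> {0..<7}" "(a * d) mod 7 = 1"
  shows "(a, 0, 0, d) \<in> frame_SL"
proof -
  have 3: "(3, 0, 0, 5) \<in> frame_SL" by (rule frame_SL_generators)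
  have 2: "(2, 0, 0, 4) \<in> frame_SL" using frame_SL_mult[OF 3 3] by (simp add: SL27_mult)
  have 6: "(6, 0, 0, 6) \<in> frame_SL" using frame_SL_mult[OF 3 2] by (simp add: SL27_mult)
  have 4: "(4, 0, 0, 2) \<in> frame_SL" using frame_SL_mult[OF 3 6] by (simp add: SL27_mult)
  have 5: "(5, 0, 0, 3) \<in> frame_SL" using frame_SL_mult[OF 3 4] by (simp add: SL27_mult)
  have 1: "(1, 0, 0, 1) \<in> frame_SL" using frame_SL_mult[OF 3 5] by (simp add: SL27_mult)
  have "a = 0 \<or> a = 1 \<or> a = 2 \<or> a = 3 \<or> a = 4 \<or> a = 5 \<or> a = 6" using assms(1) by auto
  moreover have "d = 0 \<or> d = 1 \<or> d = 2 \<or> d = 3 \<or> d = 4 \<or> d = 5 \<or> d = 6" using assms(2) by auto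
  ultimately show ?thesis using assms(3) 1 2 3 4 5 6 by (elim disjE) simp_all
qed

text \<open>The Bruhat decomposition: the upper triangular matrices and the Weyl element \<open>(0,6,1,0)\<close> generate.\<close>
lemma frame_SL_eq: "frame_SL = carrier SL27"
proof
  show "carrier SL27 \<subseteq> frame_SL"
  proof
    fix X assume X: "X \<in> carrier SL27"
    obtain a b c d where Xe: "X = (a, b, c, d)" by (metis prod.collapse)
    have r: "a \<in> {0..<7}" "b \<in> {0..<7}" "c \<in> {0..<7}" "d \<in> {0..<7}" and det: "(a * d - b * c) mod 7 = 1"
      using X by (simp_all add: Xe SL27_carrier)
    have m: "a mod 7 = a" "b mod 7 = b" "c mod 7 = c" "d mod 7 = d" using r by auto
    show "X \<in> frame_SL"
    proof (cases "c = 0")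
      case True
      then have ad: "(a * d) mod 7 = 1" using det by simp
      have "(a * ((d * b) mod 7)) mod 7 = ((a * d) * b) mod 7"
        by (simp add: mod_mult_right_eq mult.assoc)
      also have "\<dots> = ((a * d) mod 7 * b) mod 7" by (simp add: mod_mult_left_eq)
      also have "\<dots> = b" using ad m(2) by simp
      finally have "(a, 0, 0, d) \<otimes>\<^bsub>SL27\<^esub> (1, (d * b) mod 7, 0, 1) = X"
        using True m by (simp add: Xe SL27_mult)
      moreover have "(1, (d * b) mod 7, 0, 1) \<in> frame_SL" by (rule frame_SL_upper_unipotent) simp
      note frame_SL_mult[OF frame_SL_diagonal[OF r(1,4) ad] this]
      ultimately show ?thesis by simp
    next
      case False
      then have "c = 1 \<or> c = 2 \<or> c = 3 \<or> c = 4 \<or> c = 5 \<or> c = 6" using r(3) by auto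
      \<comment> \<open>\<open>e\<close> is the inverse of \<open>c\<close> modulo 7; the list gives
        the inverses of 1 to 6.\<close>
      then obtain e where e: "e \<in> {0..<7}" "(e * c) mod 7 = 1"
        by (elim disjE) (rule that[of 1] that[of 4] that[of 5] that[of 2] that[of 3] that[of 6]; simp; fail)+
      obtain q where q: "e * c = 1 + 7 * q" using e(2) by (metis mult_div_mod_eq add.commute)
      obtain p where p: "a * d - b * c = 1 + 7 * p" using det by (metis mult_div_mod_eq add.commute)
      \<comment> \<open>x = a / c and y = d / c are the two unipotent entries of the Bruhat
        factorization.\<close>
      define x y where "x = (a * e) mod 7" and "y = (d * e) mod 7"
      have cy: "(c * y) mod 7 = d"
      proof -
        have "(c * y) mod 7 = (c * (d * e)) mod 7" by (simp add: y_def mod_mult_right_eq)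
        also have "c * (d * e) = d + (d * q) * 7" using q by (simp add: algebra_simps) algebra
        finally show ?thesis using m(4) by simp
      qed
      have xc: "(x * c) mod 7 = a"
      proof -
        have "(x * c) mod 7 = ((a * e) * c) mod 7" by (simp add: x_def mod_mult_left_eq)
        also have "(a * e) * c = a + (a * q) * 7" using q by algebra
        finally show ?thesis using m(1) by simp
      qed
      have b: "((e * 6) mod 7 + x * d) mod 7 = b"
      proof -
        have "((e * 6) mod 7 + x * d) mod 7 = (e * 6 + (a * e) * d) mod 7"
          unfolding x_def by (intro mod_add_cong mod_mult_cong mod_mod_trivial refl)
        also have "e * 6 + (a * e) * d = b + (e + b * q + e * p) * 7" using p q by algebra
        finally show ?thesis unfolding mod_mult_self1 m(2) .
      qed
      have "(1, x, 0, 1) \<otimes>\<^bsub>SL27\<^esub> ((e, 0, 0, c) \<otimes>\<^bsub>SL27\<^esub> ((0, 6, 1, 0) \<otimes>\<^bsub>SL27\<^esub> (1, y, 0, 1))) = X"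
      proof -
        have "(0, 6, 1, 0) \<otimes>\<^bsub>SL27\<^esub> (1, y, 0, 1) = (0, 6, 1, y)" by (simp add: SL27_mult y_def)
        moreover have "(e, 0, 0, c) \<otimes>\<^bsub>SL27\<^esub> (0, 6, 1, y) = (0, (e * 6) mod 7, c, d)"
          using cy m(3) by (simp add: SL27_mult)
        moreover have "(1, x, 0, 1) \<otimes>\<^bsub>SL27\<^esub> (0, (e * 6) mod 7, c, d) = (a, b, c, d)"
          by (simp only: SL27_mult mult_1 mult_zero_left mult_zero_right add_0 xc b m)
        ultimately show ?thesis by (simp only: Xe)
      qed
      moreover have xy: "(1, x, 0, 1) \<in> frame_SL" "(1, y, 0, 1) \<in> frame_SL"
        by (intro frame_SL_upper_unipotent; simp add: x_def y_def)+
      note frame_SL_mult[OF xy(1) frame_SL_mult[OF frame_SL_diagonal[OF e(1) r(3) e(2)]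
            frame_SL_mult[OF frame_SL_generators(2) xy(2)]]]
      ultimately show ?thesis by simp
    qed
  qed
qed (auto simp: frame_SL_def)

lemma stabilizes_frame_lift_SL: "X \<in> carrier SL27 \<Longrightarrow> stabilizes_frame (lift_SL X)"
  using frame_SL_eq unfolding frame_SL_def by blast

text \<open>The determinant leaves two families of matrices, c = 0 and c nonzero, and the tables
  search each for elements that fix all seven points.\<close>

lemma lift_SL_in_fano_group_iff:
  assumes X: "X \<in> carrier SL27"
  shows "lift_SL X \<in> frame_group fano_root \<longleftrightarrow> X = (1,0,0,1) \<or> X = (6,0,0,6)"
proof -
  have iff: "lift_SL X \<in> frame_group fano_root \<longleftrightarrow> (\<forall>i\<in>set [0..<7]. matches X i i)"
    unfolding in_fano_group_iff[OF lift_SL_Weyl[OF X]] using sends_lift_SL[OF X] by auto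
  obtain a b c d where Xe: "X = (a, b, c, d)" by (metis prod.collapse)
  have r: "a \<in> {0..<7}" "b \<in> {0..<7}" "c \<in> {0..<7}" "d \<in> {0..<7}" and det: "(a * d - b * c) mod 7 = 1"
    using X by (simp_all add: Xe SL27_carrier)
  have m: "a mod 7 = a" "b mod 7 = b" "c mod 7 = c" "d mod 7 = d" using r by auto
  have pow6: "(u * u ^ 5) mod 7 = 1" if "u \<in> {1..6}" for u :: int
  proof -
    have "u = 1 \<or> u = 2 \<or> u = 3 \<or> u = 4 \<or> u = 5 \<or> u = 6" using that by auto
    then show ?thesis by (elim disjE) simp_all
  qed
  show ?thesis
  proof
    assume "lift_SL X \<in> frame_group fano_root"
    then have "\<forall>i\<in>set [0..<7]. matches X i i" using iff by blast
    then have M: "\<forall>i\<in>set [0..<7]. matches (a, b, c, d) i i" unfolding Xe .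
    show "X = (1,0,0,1) \<or> X = (6,0,0,6)"
    proof (cases "c = 0")
      case True
      then have ad: "(a * d) mod 7 = 1" using det by simp
      then have a: "a \<in> {1..6}" using r(1) by (cases "a = 0") auto
      have "(a ^ 5) mod 7 = (a ^ 5 * ((a * d) mod 7)) mod 7" by (simp add: ad)
      also have "\<dots> = ((a * a ^ 5) * d) mod 7" by (simp add: mod_mult_right_eq algebra_simps)
      also have "\<dots> = ((a * a ^ 5) mod 7 * d) mod 7" by (simp add: mod_mult_left_eq)
      also have "\<dots> = d mod 7" using pow6[OF a] by simp
      finally have d: "(a ^ 5) mod 7 = d mod 7" .
      have "moebius (a, b, 0, a ^ 5) = moebius (a, b, c, d)"
        by (rule moebius_cong) (simp_all add: True d)
      then have "\<forall>i\<in>set [0..<7]. matches (a, b, 0, a ^ 5) i i" using M by (simp add: matches_def)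
      then have "b = 0 \<and> (a = 1 \<or> a = 6)"
        using kernel_table_upper[rule_format, of a b] a r(2) by simp
      moreover have "d = 0 \<or> d = 1 \<or> d = 2 \<or> d = 3 \<or> d = 4 \<or> d = 5 \<or> d = 6" using r(4) by auto
      ultimately show ?thesis using ad unfolding Xe True by (elim conjE disjE) simp_all
    next
      case False
      then have c: "c \<in> {1..6}" using r(3) by auto
      obtain p where p: "a * d - b * c = 1 + 7 * p" using det by (metis mult_div_mod_eq add.commute)
      have "(a * d - 1) * c ^ 5 = b * (c * c ^ 5) + (p * c ^ 5) * 7" using p by algebra
      then have "((a * d - 1) * c ^ 5) mod 7 = (b * (c * c ^ 5)) mod 7" by (simp only: mod_mult_self1)
      also have "\<dots> = (b * ((c * c ^ 5) mod 7)) mod 7" by (simp only: mod_mult_right_eq)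
      also have "\<dots> = b mod 7" by (simp only: pow6[OF c] mult_1_right)
      finally have b: "((a * d - 1) * c ^ 5) mod 7 = b mod 7" .
      have "moebius (a, (a * d - 1) * c ^ 5, c, d) = moebius (a, b, c, d)"
        by (rule moebius_cong) (simp_all only: b)
      then have all: "\<forall>i\<in>set [0..<7]. matches (a, (a * d - 1) * c ^ 5, c, d) i i"
        using M unfolding matches_def by (simp only:)
      have ad: "a \<in> set [0..6]" "d \<in> set [0..6]" using r by auto
      have "c \<in> set [1..3] \<or> c \<in> set [4..6]" using c by auto
      then have False
      proof
        assume "c \<in> set [1..3]"
        from kernel_table_low[rule_format, OF this ad] all show False by (rule notE)
      next
        assume "c \<in> set [4..6]"
        from kernel_table_high[rule_format, OF this ad] all show False by (rule notE)
      qed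
      then show ?thesis ..
    qed
  next
    assume "X = (1,0,0,1) \<or> X = (6,0,0,6)"
    moreover have "matches (1,0,0,1) i i" if "i \<in> set [0..<7]" for i
      using blk_less[of i] that by (auto simp: matches_def agrees_def moebius_one)
    ultimately show "lift_SL X \<in> frame_group fano_root"
      unfolding iff using minus_one_table by blast
  qed
qed

lemma stabilizes_frame_obtain:
  assumes "stabilizes_frame n" "i < 7"
  obtains j where "j < 7" "sends n i j"
  using assms unfolding stabilizes_frame_def by blast

lemma lift_SL_move:
  assumes "X \<in> carrier SL27" "stabilizes_frame n"
  shows "stabilizes_frame (lift_SL X \<circ> n)"
  using stabilizes_frame_comp[OF stabilizes_frame_lift_SL[OF assms(1)] assms(2)] .

lemma sends_move:
  assumes "X \<in> carrier SL27" "sends n i j" "matches X j k" "j < 7" "k < 7"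
  shows "sends (lift_SL X \<circ> n) i k"
  using sends_comp[OF Weyl_linear[OF lift_SL_Weyl[OF assms(1)]] assms(2)]
    sends_lift_SL[OF assms(1,4,5)] assms(3) by blast

text \<open>\<open>PSL(2,7)\<close> is transitive on triples of non-collinear points of the Fano plane, and a collineation
  is determined by its values on such a triple.\<close>
lemma ex_lift_SL_in_fano_group:
  assumes n: "stabilizes_frame n"
  shows "\<exists>X\<in>carrier SL27. lift_SL X \<circ> n \<in> frame_group fano_root"
proof -
  obtain i where i: "i < 7" "sends n 0 i" by (rule stabilizes_frame_obtain[OF n, of 0]) simp_all
  have "\<exists>X\<in>set [(1,0,0,1), (1,1,0,1), (1,2,0,1), (1,3,0,1), (1,4,0,1), (1,5,0,1), (1,6,0,1)]. matches X i 0"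
    by (rule move_to_0_table[rule_format]) (use i in simp)
  moreover have "\<forall>X\<in>set [(1,0,0,1), (1,1,0,1), (1,2,0,1), (1,3,0,1), (1,4,0,1), (1,5,0,1), (1,6,0,1)]. X \<in> carrier SL27" by (simp add: SL27_carrier)
  ultimately obtain X where X: "X \<in> carrier SL27" "matches X i 0" by blast
  define n1 where "n1 = lift_SL X \<circ> n"
  have n1: "stabilizes_frame n1" unfolding n1_def by (rule lift_SL_move[OF X(1) n])
  have n1_0: "sends n1 0 0" unfolding n1_def by (rule sends_move[OF X(1) i(2) X(2) i(1)]) simp
  have n1W: "n1 \<in> Weyl_E7" using n1 by (simp add: stabilizes_frame_def)
  obtain j where j: "j < 7" "sends n1 1 j" by (rule stabilizes_frame_obtain[OF n1, of 1]) simp_all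
  have "j \<noteq> 0"
  proof
    assume "j = 0"
    then have "(1::nat) = 0" using sends_inj[OF n1W _ _ _ n1_0, of 1] j(2) by simp
    then show False by simp
  qed
  have "\<exists>Y\<in>set [(0,2,3,0), (0,1,6,0), (1,1,2,3), (0,3,2,0), (2,2,1,5), (1,3,6,5)]. matches Y j 1 \<and> matches Y 0 0"
    by (rule move_to_1_table[rule_format]) (use j \<open>j \<noteq> 0\<close> in simp)
  moreover have "\<forall>X\<in>set [(0,2,3,0), (0,1,6,0), (1,1,2,3), (0,3,2,0), (2,2,1,5), (1,3,6,5)]. X \<in> carrier SL27" by (simp add: SL27_carrier)
  ultimately obtain Y where Y: "Y \<in> carrier SL27" "matches Y j 1" "matches Y 0 0" by blast
  define n2 where "n2 = lift_SL Y \<circ> n1"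
  have n2: "stabilizes_frame n2" unfolding n2_def by (rule lift_SL_move[OF Y(1) n1])
  have n2_0: "sends n2 0 0" unfolding n2_def by (rule sends_move[OF Y(1) n1_0 Y(3)]) simp_all
  have n2_1: "sends n2 1 1" unfolding n2_def by (rule sends_move[OF Y(1) j(2) Y(2) j(1)]) simp
  have n2W: "n2 \<in> Weyl_E7" using n2 by (simp add: stabilizes_frame_def)
  \<comment> \<open>3 is the third point of the line {0, 1, 3}; this excludes it as the image of
    2.\<close>
  have n2_3: "sends n2 3 3"
    by (rule sends_collinear[OF n2, of 0 0 1 3]) (use n2_0 n2_1 in \<open>simp_all add: line_def\<close>)
  obtain k where k: "k < 7" "sends n2 2 k" by (rule stabilizes_frame_obtain[OF n2, of 2]) simp_all
  have "k \<noteq> l" if l: "sends n2 l l" "l < 7" "l \<noteq> 2" for l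
  proof
    assume "k = l"
    then have "(2::nat) = l" using sends_inj[OF n2W _ l(2) _ l(1), of 2] k(2) by simp
    then show False using l(3) by simp
  qed
  from this[OF n2_0] this[OF n2_1] this[OF n2_3] have "k \<noteq> 0" "k \<noteq> 1" "k \<noteq> 3" by simp_all
  then have "k = 2 \<or> k = 4 \<or> k = 5 \<or> k = 6" using k(1) by linarith
  then have "k \<in> set [2, 4, 5, 6]" by simp
  then have "\<exists>Z\<in>set [(1,0,0,1), (0,2,3,0), (2,1,2,5), (3,4,1,4)]. matches Z k 2 \<and> matches Z 0 0 \<and> matches Z 1 1"
    by (rule move_to_2_table[rule_format])
  moreover have "\<forall>X\<in>set [(1,0,0,1), (0,2,3,0), (2,1,2,5), (3,4,1,4)]. X \<in> carrier SL27" by (simp add: SL27_carrier)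
  ultimately obtain Z where Z: "Z \<in> carrier SL27" "matches Z k 2" "matches Z 0 0" "matches Z 1 1" by blast
  define n3 where "n3 = lift_SL Z \<circ> n2"
  have n3: "stabilizes_frame n3" unfolding n3_def by (rule lift_SL_move[OF Z(1) n2])
  have 0: "sends n3 0 0" unfolding n3_def by (rule sends_move[OF Z(1) n2_0 Z(3)]) simp_all
  have 1: "sends n3 1 1" unfolding n3_def by (rule sends_move[OF Z(1) n2_1 Z(4)]) simp_all
  have 2: "sends n3 2 2" unfolding n3_def by (rule sends_move[OF Z(1) k(2) Z(2) k(1)]) simp
  \<comment> \<open>The remaining points are generated from 0, 1, 2 by the lines {0, 1, 3}, {1, 2,
    4}, {6, 0, 2} and {4, 5, 0}; the last uses the point 4 just obtained.\<close>
  have 3: "sends n3 3 3"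
    by (rule sends_collinear[OF n3, of 0 0 1 3]) (use 0 1 in \<open>simp_all add: line_def\<close>)
  have 4: "sends n3 4 4"
    by (rule sends_collinear[OF n3, of 1 1 2 4]) (use 1 2 in \<open>simp_all add: line_def numeral_2_eq_2\<close>)
  have 6: "sends n3 6 6"
    by (rule sends_collinear[OF n3, of 6 0 2 6]) (use 0 2 in \<open>auto simp add: line_def\<close>)
  have 5: "sends n3 5 5"
    by (rule sends_collinear[OF n3, of 4 4 0 5]) (use 0 4 in \<open>auto simp add: line_def\<close>)
  have "\<forall>i<7. sends n3 i i"
  proof (intro allI impI)
    fix i :: nat assume "i < 7"
    then show "sends n3 i i" by (rule less_7_cases) (use 0 1 2 3 4 5 6 in simp_all)
  qed
  then have mem: "n3 \<in> frame_group fano_root"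
    using n3 in_fano_group_iff unfolding stabilizes_frame_def by blast
  let ?X = "Z \<otimes>\<^bsub>SL27\<^esub> (Y \<otimes>\<^bsub>SL27\<^esub> X)"
  note closed = monoid.m_closed[OF group.is_monoid[OF group_SL27]]
  have YX: "Y \<otimes>\<^bsub>SL27\<^esub> X \<in> carrier SL27" by (rule closed[OF Y(1) X(1)])
  have "lift_SL ?X \<circ> n = n3"
    unfolding n3_def n2_def n1_def lift_SL_mult[OF Z(1) YX] lift_SL_mult[OF Y(1) X(1)] comp_assoc ..
  then have "lift_SL ?X \<circ> n \<in> frame_group fano_root" using mem by (simp only:)
  then show ?thesis using closed[OF Z(1) YX] by blast
qed

section \<open>The quotient of the normalizer\<close>

lemma mem_normalizer_iff:
  assumes "M \<subseteq> Weyl_E7"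
  shows "n \<in> normalizer WE7 M \<longleftrightarrow> n \<in> Weyl_E7 \<and> conj_group n M = M"
proof -
  have "n <#\<^bsub>WE7\<^esub> M #>\<^bsub>WE7\<^esub> inv\<^bsub>WE7\<^esub> n = conj_group n M"
    by (auto simp: l_coset_def r_coset_def conj_group_def)
  then show ?thesis using assms by (simp add: normalizer_def stabilizer_def)
qed

text \<open>The first isomorphism theorem for the map from SL(2,7) that lifts a matrix, conjugates
  it by \<open>g\<close> and takes its coset: it is onto by transitivity on triples, and its kernel
  is the pair of scalar matrices by which \<open>PSL27\<close> is defined.\<close>

lemma normalizer_quotient_iso:
  assumes g: "g \<in> Weyl_E7" and M: "M = frame_group (g \<circ> fano_root)"
  shows "(WE7\<lparr>carrier := normalizer WE7 M\<rparr>) Mod M \<cong> PSL27"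
proof -
  let ?g' = "inv\<^bsub>WE7\<^esub> g" and ?M0 = "frame_group fano_root"
  let ?N = "WE7\<lparr>carrier := normalizer WE7 M\<rparr>"
  note g' = inv_WE7[OF g]
  have Mg: "M = conj_group g ?M0" by (simp add: M conj_frame_group[OF g])
  have M0g: "conj_group ?g' M = ?M0" by (simp add: Mg conj_group_inv[OF g])
  have "abelian_subgroup M" unfolding M by (rule abelian_frame_group[OF frame_comp[OF frame_fano_root g]])
  then have sub: "subgroup M WE7" and MW: "M \<subseteq> Weyl_E7"
    by (simp_all add: abelian_subgroup_def abelian_subgroupD(1))
  interpret normal M ?N by (rule group.subgroup_in_normalizer[OF group_WE7 sub])
  let ?c = "\<lambda>X. g \<circ> lift_SL X \<circ> ?g'"
  have cW: "?c X \<in> Weyl_E7" if "X \<in> carrier SL27" for X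
    by (intro Weyl_comp g g'(1) lift_SL_Weyl that)
  have c_mem: "?c X \<in> M \<longleftrightarrow> lift_SL X \<in> ?M0" if X: "X \<in> carrier SL27" for X
  proof
    assume "?c X \<in> M"
    then obtain m where m: "m \<in> ?M0" "?c X = g \<circ> m \<circ> ?g'" unfolding Mg conj_group_def by blast
    have "lift_SL X v = m v" for v
      using arg_cong[OF fun_cong[OF m(2), of "g v"], of ?g'] by (simp add: g'(2))
    then have "lift_SL X = m" by blast
    then show "lift_SL X \<in> ?M0" using m(1) by simp
  next
    assume "lift_SL X \<in> ?M0"
    then show "?c X \<in> M" unfolding Mg conj_group_def by (rule imageI)
  qed
  have cN: "?c X \<in> carrier ?N" if X: "X \<in> carrier SL27" for X
  proof -
    have st: "conj_group (lift_SL X) ?M0 = ?M0"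
      using normalizes_fano_group_iff[OF lift_SL_Weyl[OF X]] stabilizes_frame_lift_SL[OF X] by simp
    have gX: "g \<circ> lift_SL X \<in> Weyl_E7" by (rule Weyl_comp[OF g lift_SL_Weyl[OF X]])
    have "conj_group (?c X) M = conj_group (g \<circ> lift_SL X) (conj_group ?g' M)"
      by (rule conj_group_comp[OF gX g'(1), symmetric])
    also have "\<dots> = conj_group g (conj_group (lift_SL X) ?M0)"
      unfolding M0g by (rule conj_group_comp[OF g lift_SL_Weyl[OF X], symmetric])
    also have "\<dots> = M" by (simp only: st Mg)
    finally show ?thesis using cW[OF X] mem_normalizer_iff[OF MW] by simp
  qed
  have c_hom: "?c \<in> hom SL27 ?N"
  proof (rule homI)
    fix X Y assume XY: "X \<in> carrier SL27" "Y \<in> carrier SL27"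
    show "?c (X \<otimes>\<^bsub>SL27\<^esub> Y) = ?c X \<otimes>\<^bsub>?N\<^esub> ?c Y"
      by (simp add: lift_SL_mult[OF XY] fun_eq_iff g'(2))
  qed (rule cN)
  define h where "h = (\<lambda>a. M #>\<^bsub>?N\<^esub> a) \<circ> ?c"
  have h_hom: "h \<in> hom SL27 (?N Mod M)"
    unfolding h_def by (rule Group.hom_compose[OF c_hom r_coset_hom_Mod])
  interpret h: group_hom SL27 "?N Mod M" h
    by (intro group_hom.intro group_hom_axioms.intro group_SL27 factorgroup_is_group h_hom)
  have surj: "h ` carrier SL27 = carrier (?N Mod M)"
  proof
    show "h ` carrier SL27 \<subseteq> carrier (?N Mod M)" using h_hom by (auto simp: hom_def)
    show "carrier (?N Mod M) \<subseteq> h ` carrier SL27"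
    proof
      fix Q assume "Q \<in> carrier (?N Mod M)"
      then obtain n where n: "n \<in> carrier ?N" "Q = M #>\<^bsub>?N\<^esub> n" by (auto simp: FactGroup_def RCOSETS_def)
      have nW: "n \<in> Weyl_E7" "conj_group n M = M" using n(1) mem_normalizer_iff[OF MW] by auto
      define n0 where "n0 = ?g' \<circ> n \<circ> g"
      have n0W: "n0 \<in> Weyl_E7" unfolding n0_def by (intro Weyl_comp g g'(1) nW(1))
      \<comment> \<open>The transitivity result is applied to the inverse of \<open>n0\<close>: the
        lifted matrix times this inverse lies in the group, so the lifted matrix lies in the coset
        of \<open>n0\<close> itself.\<close>
      let ?n0' = "inv\<^bsub>WE7\<^esub> n0"
      note n0' = inv_WE7[OF n0W]
      have "conj_group n0 ?M0 = ?M0"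
      proof -
        have "conj_group n0 ?M0 = conj_group (?g' \<circ> n) M"
          unfolding n0_def Mg by (rule conj_group_comp[OF Weyl_comp[OF g'(1) nW(1)] g, symmetric])
        also have "\<dots> = conj_group ?g' (conj_group n M)"
          by (rule conj_group_comp[OF g'(1) nW(1), symmetric])
        also have "\<dots> = ?M0" by (simp only: nW(2) M0g)
        finally show ?thesis .
      qed
      then have "conj_group ?n0' ?M0 = ?M0" using conj_group_inv[OF n0W, of ?M0] by simp
      then have "stabilizes_frame ?n0'" using normalizes_fano_group_iff[OF n0'(1)] by simp
      then obtain X where X: "X \<in> carrier SL27" "lift_SL X \<circ> ?n0' \<in> ?M0"
        using ex_lift_SL_in_fano_group by blast
      define m where "m = g \<circ> (lift_SL X \<circ> ?n0') \<circ> ?g'"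
      have m: "m \<in> M" unfolding Mg conj_group_def m_def using X(2) by (rule imageI)
      have "?c X = m \<circ> n"
      proof
        fix v
        have "n v = g (n0 (?g' v))" by (simp add: n0_def g'(3))
        then show "?c X v = (m \<circ> n) v" by (simp add: m_def g'(2) n0'(2))
      qed
      then have cX: "?c X = m \<otimes>\<^bsub>?N\<^esub> n" by simp
      have "h X = M #>\<^bsub>?N\<^esub> (m \<otimes>\<^bsub>?N\<^esub> n)" unfolding h_def cX[symmetric] by simp
      also have "\<dots> = M #>\<^bsub>?N\<^esub> m #>\<^bsub>?N\<^esub> n"
        by (rule coset_mult_assoc[symmetric]) (use m n(1) subset in auto)
      also have "M #>\<^bsub>?N\<^esub> m = M" by (rule coset_join2) (use m subset is_subgroup in auto)
      finally have "h X = Q" by (simp only: n(2))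
      then show "Q \<in> h ` carrier SL27" using X(1) by blast
    qed
  qed
  have ker: "kernel SL27 (?N Mod M) h = {(1,0,0,1), (6,0,0,6)}"
  proof -
    have "h X = M \<longleftrightarrow> X = (1,0,0,1) \<or> X = (6,0,0,6)" if X: "X \<in> carrier SL27" for X
    proof -
      have "h X = M \<longleftrightarrow> ?c X \<in> M"
        unfolding h_def o_apply[of "\<lambda>a. M #>\<^bsub>?N\<^esub> a"]
        using coset_join1[OF _ cN[OF X] is_subgroup] coset_join2[OF cN[OF X] is_subgroup] by blast
      then show ?thesis using c_mem[OF X] lift_SL_in_fano_group_iff[OF X] by blast
    qed
    moreover have "(1,0,0,1) \<in> carrier SL27" "(6,0,0,6) \<in> carrier SL27" by (simp_all add: SL27_carrier)
    moreover have "\<one>\<^bsub>?N Mod M\<^esub> = M" by (simp add: FactGroup_def)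
    ultimately show ?thesis unfolding kernel_def by blast
  qed
  have "SL27 Mod kernel SL27 (?N Mod M) h \<cong> ?N Mod M" by (rule h.FactGroup_iso[OF surj])
  then have "PSL27 \<cong> ?N Mod M" by (simp only: ker PSL27_def)
  moreover have "group PSL27"
    using normal.factorgroup_is_group[OF h.normal_kernel] by (simp only: ker PSL27_def)
  ultimately show ?thesis by (rule group.iso_sym[rotated])
qed

theorem theorem4p5:
  assumes "subgroup M WE7"
    and "\<forall>x\<in>M. \<forall>y\<in>M. x \<circ> y = y \<circ> x"
    and "\<forall>M'. subgroup M' WE7 \<and> (\<forall>x\<in>M'. \<forall>y\<in>M'. x \<circ> y = y \<circ> x) \<longrightarrow> card M' \<le> card M"
  shows "WE7\<lparr>carrier := M\<rparr> \<cong> product_group {..<(7::nat)} (\<lambda>_. integer_mod_group 2)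
    \<and> (\<exists>\<beta> :: nat \<Rightarrow> real^8.
         (\<forall>i<7. \<beta> i \<in> E7_roots)
       \<and> (\<forall>i<7. \<forall>j<7. i \<noteq> j \<longrightarrow>
            \<beta> i \<bullet> \<beta> j = 0 \<and> \<beta> i + \<beta> j \<notin> E7_roots \<and> \<beta> i - \<beta> j \<notin> E7_roots)
       \<and> M = generate WE7 ((\<lambda>i. refl (\<beta> i)) ` {..<7})
       \<and> {s \<in> M. \<exists>a\<in>E7_roots. s = refl a} = (\<lambda>i. refl (\<beta> i)) ` {..<7}
       \<and> (let orbits = {(\<lambda>w. w v) ` M | v. v \<in> weights56}
          in card orbits = 7
             \<and> (\<forall>L\<in>orbits. card L = 8)
             \<and> fano_plane ((\<lambda>i. refl (\<beta> i)) ` {..<7}) orbits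
                 (\<lambda>s L. \<exists>i<7. s = refl (\<beta> i) \<and> (\<forall>v\<in>L. \<beta> i \<bullet> v \<noteq> 0))))
    \<and> (WE7\<lparr>carrier := normalizer WE7 M\<rparr>) Mod M \<cong> PSL27"
proof -
  have "max_abelian M" using assms by (simp add: max_abelian_def abelian_subgroup_def)
  then obtain g where g: "g \<in> Weyl_E7" "M = frame_group (g \<circ> fano_root)"
    using max_abelian_conj_fano by blast
  define \<beta> where "\<beta> = g \<circ> fano_root"
  have M: "M = frame_group \<beta>" by (simp add: \<beta>_def g(2))
  have ff: "fano_frame \<beta>" unfolding \<beta>_def by (rule fano_frame_comp[OF g(1)])
  note fr = fano_frame_frame[OF ff]
  \<comment> \<open>The sum and the difference of orthogonal roots have squared length 4, whereas
    roots have 2.\<close>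
  have strong: "\<beta> i \<bullet> \<beta> j = 0 \<and> \<beta> i + \<beta> j \<notin> E7_roots \<and> \<beta> i - \<beta> j \<notin> E7_roots"
    if "i < 7" "j < 7" "i \<noteq> j" for i j
  proof -
    have "\<beta> i \<bullet> \<beta> j = 0" "\<beta> j \<bullet> \<beta> i = 0" "\<beta> i \<bullet> \<beta> i = 2" "\<beta> j \<bullet> \<beta> j = 2"
      using frame_inner[OF fr] that by auto
    then have "(\<beta> i + \<beta> j) \<bullet> (\<beta> i + \<beta> j) = 4" "(\<beta> i - \<beta> j) \<bullet> (\<beta> i - \<beta> j) = 4"
      by (simp_all add: inner_add_left inner_add_right inner_diff_left inner_diff_right)
    then show ?thesis using \<open>\<beta> i \<bullet> \<beta> j = 0\<close> E7_root_norm by fastforce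
  qed
  let ?O = "(\<lambda>t. orbit_of \<beta> (line t)) ` {..<7}"
  have orbits: "{(\<lambda>w. w v) ` M | v. v \<in> weights56} = ?O"
    unfolding M by (rule orbits_eq[OF ff])
  have "card ?O = 7" using card_image[OF inj_orbit_of[OF ff]] by simp
  moreover have "\<forall>L\<in>?O. card L = 8" using card_orbit_of[OF ff] by auto
  ultimately have orb: "let orbits = {(\<lambda>w. w v) ` M | v. v \<in> weights56}
      in card orbits = 7 \<and> (\<forall>L\<in>orbits. card L = 8)
        \<and> fano_plane ((\<lambda>i. refl (\<beta> i)) ` {..<7}) orbits
            (\<lambda>s L. \<exists>i<7. s = refl (\<beta> i) \<and> (\<forall>v\<in>L. \<beta> i \<bullet> v \<noteq> 0))"
    unfolding Let_def orbits using fano_plane_orbits[OF ff] by blast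
  have gen: "M = generate WE7 ((\<lambda>i. refl (\<beta> i)) ` {..<7})"
    unfolding M by (rule frame_group_generate[OF ff])
  have refls: "{s \<in> M. \<exists>a\<in>E7_roots. s = refl a} = (\<lambda>i. refl (\<beta> i)) ` {..<7}"
    unfolding M by (rule reflections_in_frame_group[OF ff])
  have iso: "WE7\<lparr>carrier := M\<rparr> \<cong> product_group {..<(7::nat)} (\<lambda>_. integer_mod_group 2)"
    unfolding M by (rule frame_group_iso[OF ff])
  show ?thesis
    by (intro conjI exI[of _ \<beta>] iso normalizer_quotient_iso[OF g] gen refls orb allI impI
        frame_root[OF fr]; (use strong in blast)?)
qed

end
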